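(* Let $M$ be a real hypersurface in a Kähler manifold $\bar{M}$ with $\dim_{\mathbb{C}}(\bar M) \geq 2$, and let $(\phi,\xi,\eta,g)$ be the induced almost contact metric structure on $M$. The following statements are equivalent: (i) The almost contact form $\eta$ is closed, that is, $d\eta = 0$. (ii) The shape operator $A$ of $M$ and the structure tensor field $\phi$ satisfy $A\phi + \phi A = 0$. (iii) $M$ is a Hopf hypersurface and the maximal complex subbundle $\mathcal{C}$ of $TM$ is integrable.
   Context: Let $J$ be the Kähler structure and $g$ the Kähler metric of $\bar M$, with Levi-Civita derivative $\bar\nabla$; the induced metric on $M$ is also denoted by $g$. Let $\zeta$ be a (local) unit normal vector field on $M$. The shape operator is $A = A_\zeta$, $AX = -\bar\nabla_X\zeta$ for $X$ tangent to $M$. The Reeb vector field is $\xi = -J\zeta$, the almost contact form is $\eta(X) = g(X,\xi)$, and the structure tensor field $\phi$ is defined by $JX = \phi X + \eta(X)\zeta$ for all vector fields $X$ on $M$ (so $\phi X$ is the tangential component of $JX$). The maximal complex subbundle is $\mathcal{C} = \ker(\eta) = TM \cap J(TM)$. $M$ is a Hopf hypersurface if the integral curves of $\xi$ are geodesics in $M$. *)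

theory Defs
  imports "HOL-Analysis.Analysis"
begin

section \<open>Smooth manifolds\<close>

primrec Ck_on :: "nat \<Rightarrow> 'a::real_normed_vector set \<Rightarrow> ('a \<Rightarrow> 'b::real_normed_vector) \<Rightarrow> bool" where
  "Ck_on 0 S f \<longleftrightarrow> continuous_on S f"
| "Ck_on (Suc k) S f \<longleftrightarrow>
     (\<forall>x\<in>S. f differentiable (at x)) \<and> (\<forall>v. Ck_on k S (\<lambda>x. frechet_derivative f (at x) v))"

text \<open>Only used for open \<open>S\<close>.\<close>

definition smooth_on :: "'a::real_normed_vector set \<Rightarrow> ('a \<Rightarrow> 'b::real_normed_vector) \<Rightarrow> bool" where
  "smooth_on S f \<longleftrightarrow> (\<forall>k. Ck_on k S f)"

text \<open>A chart is its open domain together with its coordinate map; the coordinate map is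
  irrelevant outside of the domain.\<close>

type_synonym ('m, 'a) chart = "'m set \<times> ('m \<Rightarrow> 'a)"

definition chart_inv :: "('m, 'a) chart \<Rightarrow> 'a \<Rightarrow> 'm" where
  "chart_inv c = inv_into (fst c) (snd c)"

text \<open>A manifold is a whole type carrying a (not necessarily maximal) smooth atlas. The sort
  constraint expresses the usual topological conventions, Hausdorff and second countable.\<close>

definition smooth_atlas ::
    "('m::{t2_space,second_countable_topology}, 'a::euclidean_space) chart set \<Rightarrow> bool" where
  "smooth_atlas A \<longleftrightarrow>
     (\<Union>c\<in>A. fst c) = UNIV \<and>
     (\<forall>c\<in>A. open (fst c) \<and> open (snd c ` fst c) \<and>
            homeomorphism (fst c) (snd c ` fst c) (snd c) (chart_inv c)) \<and>
     (\<forall>c\<in>A. \<forall>d\<in>A. smooth_on (snd c ` (fst c \<inter> fst d)) (snd d \<circ> chart_inv c))"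

text \<open>Every point \<open>p\<close> is given a preferred chart, and the tangent space at \<open>p\<close> is the model space,
  a tangent vector being represented by its components in the preferred chart at \<open>p\<close>.
  So a vector field is a function from the manifold to the model space. The preferred chart
  depends on \<open>p\<close> in an arbitrary way: smoothness and differentiation of tensor fields always
  refer to components in a fixed chart, to which \<open>to_chart\<close> and \<open>from_chart\<close> translate.\<close>

definition chart_at :: "('m, 'a) chart set \<Rightarrow> 'm \<Rightarrow> ('m, 'a) chart" where
  "chart_at A p = (SOME c. c \<in> A \<and> p \<in> fst c)"

definition to_chart ::
    "('m, 'a::euclidean_space) chart set \<Rightarrow> ('m, 'a) chart \<Rightarrow> 'm \<Rightarrow> 'a \<Rightarrow> 'a" where
  "to_chart A c p =
     frechet_derivative (snd c \<circ> chart_inv (chart_at A p)) (at (snd (chart_at A p) p))"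

definition from_chart ::
    "('m, 'a::euclidean_space) chart set \<Rightarrow> ('m, 'a) chart \<Rightarrow> 'm \<Rightarrow> 'a \<Rightarrow> 'a" where
  "from_chart A c p = frechet_derivative (snd (chart_at A p) \<circ> chart_inv c) (at (snd c p))"

definition smooth_map_on ::
    "('m::topological_space, 'a::euclidean_space) chart set \<Rightarrow>
     ('n::topological_space, 'b::euclidean_space) chart set \<Rightarrow> 'm set \<Rightarrow> ('m \<Rightarrow> 'n) \<Rightarrow> bool" where
  "smooth_map_on A B U f \<longleftrightarrow> continuous_on U f \<and>
     (\<forall>c\<in>A. \<forall>d\<in>B. smooth_on (snd c ` (U \<inter> fst c \<inter> f -` fst d)) (snd d \<circ> f \<circ> chart_inv c))"

definition differential ::
    "('m, 'a::euclidean_space) chart set \<Rightarrow> ('n, 'b::euclidean_space) chart set \<Rightarrow>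
     ('m \<Rightarrow> 'n) \<Rightarrow> 'm \<Rightarrow> 'a \<Rightarrow> 'b" where
  "differential A B f p =
     frechet_derivative (snd (chart_at B (f p)) \<circ> f \<circ> chart_inv (chart_at A p))
       (at (snd (chart_at A p) p))"

text \<open>Smoothness on \<open>U\<close> of a vector field \<open>Z\<close> along \<open>f\<close>, that is, \<open>Z p\<close> is tangent to the target at
  \<open>f p\<close>. Vector fields on the manifold itself are the case \<open>f = id\<close>.\<close>

definition smooth_field_along ::
    "('m, 'a::euclidean_space) chart set \<Rightarrow> ('n, 'b::euclidean_space) chart set \<Rightarrow>
     ('m \<Rightarrow> 'n) \<Rightarrow> 'm set \<Rightarrow> ('m \<Rightarrow> 'b) \<Rightarrow> bool" where
  "smooth_field_along A B f U Z \<longleftrightarrow>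
     (\<forall>c\<in>A. \<forall>d\<in>B. smooth_on (snd c ` (U \<inter> fst c \<inter> f -` fst d))
        (\<lambda>x. to_chart B d (f (chart_inv c x)) (Z (chart_inv c x))))"

text \<open>The differential of a one-form \<open>\<omega>\<close>: applied to the coordinate fields \<open>X\<close>, \<open>Y\<close> (which commute)
  extending \<open>u\<close> and \<open>v\<close> it is \<open>X (\<omega> Y) - Y (\<omega> X)\<close>.\<close>

definition ext_deriv ::
    "('m, 'a::euclidean_space) chart set \<Rightarrow> ('m \<Rightarrow> 'a \<Rightarrow> real) \<Rightarrow> 'm \<Rightarrow> 'a \<Rightarrow> 'a \<Rightarrow> real" where
  "ext_deriv A \<omega> p u v =
     (let c = chart_at A p;
          comp = (\<lambda>w x. \<omega> (chart_inv c x) (from_chart A c (chart_inv c x) w))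
      in frechet_derivative (comp v) (at (snd c p)) u - frechet_derivative (comp u) (at (snd c p)) v)"


section \<open>Riemannian metrics and the Levi-Civita derivative\<close>

definition metric_in_chart ::
    "('m, 'a::euclidean_space) chart set \<Rightarrow> ('m \<Rightarrow> 'a \<Rightarrow> 'a \<Rightarrow> real) \<Rightarrow>
     ('m, 'a) chart \<Rightarrow> 'a \<Rightarrow> 'a \<Rightarrow> 'a \<Rightarrow> real" where
  "metric_in_chart A g c x v w =
     g (chart_inv c x) (from_chart A c (chart_inv c x) v) (from_chart A c (chart_inv c x) w)"

definition riemannian_metric ::
    "('m, 'a::euclidean_space) chart set \<Rightarrow> ('m \<Rightarrow> 'a \<Rightarrow> 'a \<Rightarrow> real) \<Rightarrow> bool" where
  "riemannian_metric A g \<longleftrightarrow>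
     (\<forall>p. bilinear (g p) \<and> (\<forall>u v. g p u v = g p v u) \<and> (\<forall>u. u \<noteq> 0 \<longrightarrow> g p u u > 0)) \<and>
     (\<forall>c\<in>A. \<forall>v w. smooth_on (snd c ` fst c) (\<lambda>x. metric_in_chart A g c x v w))"

text \<open>The Levi-Civita connection in a chart: \<open>\<Gamma> u v\<close> is the covariant derivative, at the point
  with coordinates \<open>x\<close>, of the coordinate field \<open>v\<close> in direction \<open>u\<close>. It is the unique bilinear
  map that is symmetric (the connection has no torsion) and compatible with the metric.\<close>

definition christoffel ::
    "('m, 'a::euclidean_space) chart set \<Rightarrow> ('m \<Rightarrow> 'a \<Rightarrow> 'a \<Rightarrow> real) \<Rightarrow>
     ('m, 'a) chart \<Rightarrow> 'a \<Rightarrow> 'a \<Rightarrow> 'a \<Rightarrow> 'a" where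
  "christoffel A g c x = (THE \<Gamma>. bilinear \<Gamma> \<and> (\<forall>u v. \<Gamma> u v = \<Gamma> v u) \<and>
     (\<forall>u v w. frechet_derivative (\<lambda>y. metric_in_chart A g c y v w) (at x) u =
        metric_in_chart A g c x (\<Gamma> u v) w + metric_in_chart A g c x v (\<Gamma> u w)))"

text \<open>Levi-Civita derivative at \<open>p\<close>, in direction \<open>u\<close> tangent to the source \<open>A\<close>, of a vector field
  \<open>Z\<close> along \<open>f\<close>; here \<open>g\<close> is the metric of the target \<open>B\<close>. The formula is written in the preferred
  charts at \<open>p\<close> and \<open>f p\<close>, in which tangent vectors at these two points are their own components.\<close>

definition cov_deriv ::
    "('m, 'a::euclidean_space) chart set \<Rightarrow> ('n, 'b::euclidean_space) chart set \<Rightarrow>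
     ('n \<Rightarrow> 'b \<Rightarrow> 'b \<Rightarrow> real) \<Rightarrow> ('m \<Rightarrow> 'n) \<Rightarrow> ('m \<Rightarrow> 'b) \<Rightarrow> 'm \<Rightarrow> 'a \<Rightarrow> 'b" where
  "cov_deriv A B g f Z p u =
     (let c = chart_at A p; d = chart_at B (f p)
      in frechet_derivative (\<lambda>x. to_chart B d (f (chart_inv c x)) (Z (chart_inv c x)))
           (at (snd c p)) u
         + christoffel B g d (snd d (f p)) (differential A B f p u) (Z p))"


section \<open>Curves and distributions\<close>

definition line_atlas :: "(real, real) chart set" where
  "line_atlas = {(UNIV, id)}"

definition velocity ::
    "('m, 'a::euclidean_space) chart set \<Rightarrow> (real \<Rightarrow> 'm) \<Rightarrow> real \<Rightarrow> 'a" where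
  "velocity A \<gamma> t = differential line_atlas A \<gamma> t 1"

text \<open>Curves are considered on open intervals \<open>I\<close>; their values elsewhere are irrelevant.\<close>

definition geodesic_on ::
    "('m::topological_space, 'a::euclidean_space) chart set \<Rightarrow> ('m \<Rightarrow> 'a \<Rightarrow> 'a \<Rightarrow> real) \<Rightarrow>
     real set \<Rightarrow> (real \<Rightarrow> 'm) \<Rightarrow> bool" where
  "geodesic_on A g I \<gamma> \<longleftrightarrow> smooth_map_on line_atlas A I \<gamma> \<and>
     (\<forall>t\<in>I. cov_deriv line_atlas A g \<gamma> (velocity A \<gamma>) t 1 = 0)"

definition integral_curve_on ::
    "('m::topological_space, 'a::euclidean_space) chart set \<Rightarrow> 'm set \<Rightarrow> ('m \<Rightarrow> 'a) \<Rightarrow>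
     real set \<Rightarrow> (real \<Rightarrow> 'm) \<Rightarrow> bool" where
  "integral_curve_on A U X I \<gamma> \<longleftrightarrow> smooth_map_on line_atlas A I \<gamma> \<and>
     (\<forall>t\<in>I. \<gamma> t \<in> U \<and> velocity A \<gamma> t = X (\<gamma> t))"

text \<open>Slice charts are allowed to be any charts compatible with the atlas.\<close>

definition embedded_submanifold ::
    "('m::{t2_space,second_countable_topology}, 'a::euclidean_space) chart set \<Rightarrow> nat \<Rightarrow> 'm set \<Rightarrow> bool"
  where
  "embedded_submanifold A k N \<longleftrightarrow>
     (\<forall>p\<in>N. \<exists>c S. smooth_atlas (insert c A) \<and> p \<in> fst c \<and> subspace S \<and> dim S = k \<and>
        snd c ` (fst c \<inter> N) = snd c ` fst c \<inter> S)"

definition tangent_space_of ::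
    "('m::topological_space, 'a::euclidean_space) chart set \<Rightarrow> 'm set \<Rightarrow> 'm \<Rightarrow> 'a set" where
  "tangent_space_of A N p =
     {velocity A \<gamma> 0 | \<gamma> e. e > 0 \<and> smooth_map_on line_atlas A {-e<..<e} \<gamma> \<and>
        \<gamma> ` {-e<..<e} \<subseteq> N \<and> \<gamma> 0 = p}"

text \<open>A distribution \<open>D\<close> is integrable if every point lies in an integral manifold. As immersions
  are locally embeddings, it makes no difference that integral manifolds are embedded here.\<close>

definition integrable_distribution ::
    "('m::{t2_space,second_countable_topology}, 'a::euclidean_space) chart set \<Rightarrow>
     ('m \<Rightarrow> 'a set) \<Rightarrow> bool" where
  "integrable_distribution A D \<longleftrightarrow>
     (\<forall>p. \<exists>N. p \<in> N \<and> embedded_submanifold A (dim (D p)) N \<and>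
        (\<forall>q\<in>N. tangent_space_of A N q = D q))"


section \<open>Kaehler manifolds\<close>

definition smooth_endomorphism_field ::
    "('m, 'a::euclidean_space) chart set \<Rightarrow> ('m \<Rightarrow> 'a \<Rightarrow> 'a) \<Rightarrow> bool" where
  "smooth_endomorphism_field A J \<longleftrightarrow> (\<forall>p. linear (J p)) \<and>
     (\<forall>c\<in>A. \<forall>v. smooth_on (snd c ` fst c)
        (\<lambda>x. to_chart A c (chart_inv c x) (J (chart_inv c x) (from_chart A c (chart_inv c x) v))))"

text \<open>An almost Hermitian manifold with parallel complex structure. The real dimension
  \<open>DIM('b)\<close> is twice the complex dimension.\<close>

definition kaehler_manifold ::
    "('n::{t2_space,second_countable_topology}, 'b::euclidean_space) chart set \<Rightarrow>
     ('n \<Rightarrow> 'b \<Rightarrow> 'b \<Rightarrow> real) \<Rightarrow> ('n \<Rightarrow> 'b \<Rightarrow> 'b) \<Rightarrow> bool" where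
  "kaehler_manifold B g J \<longleftrightarrow>
     smooth_atlas B \<and> riemannian_metric B g \<and> smooth_endomorphism_field B J \<and>
     (\<forall>p u. J p (J p u) = - u) \<and>
     (\<forall>p u v. g p (J p u) (J p v) = g p u v) \<and>
     (\<forall>U Y. open U \<longrightarrow> smooth_field_along B B id U Y \<longrightarrow>
        (\<forall>p\<in>U. \<forall>u. cov_deriv B B g id (\<lambda>q. J q (Y q)) p u = J p (cov_deriv B B g id Y p u)))"


section \<open>Real hypersurfaces\<close>

text \<open>A hypersurface is a manifold \<open>M\<close> (atlas \<open>A\<close>) of codimension one immersed by \<open>f\<close> into the
  ambient manifold (atlas \<open>B\<close>); embedded hypersurfaces are the case of an inclusion.
  A vector \<open>u\<close> tangent to \<open>M\<close> at \<open>p\<close> is identified with \<open>differential A B f p u\<close>.\<close>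

definition real_hypersurface ::
    "('m::{t2_space,second_countable_topology}, 'a::euclidean_space) chart set \<Rightarrow>
     ('n::{t2_space,second_countable_topology}, 'b::euclidean_space) chart set \<Rightarrow>
     ('m \<Rightarrow> 'n) \<Rightarrow> bool" where
  "real_hypersurface A B f \<longleftrightarrow>
     smooth_atlas A \<and> smooth_map_on A B UNIV f \<and> (\<forall>p. inj (differential A B f p)) \<and>
     DIM('a) + 1 = DIM('b)"

definition induced_metric ::
    "('m, 'a::euclidean_space) chart set \<Rightarrow> ('n, 'b::euclidean_space) chart set \<Rightarrow> ('m \<Rightarrow> 'n) \<Rightarrow>
     ('n \<Rightarrow> 'b \<Rightarrow> 'b \<Rightarrow> real) \<Rightarrow> 'm \<Rightarrow> 'a \<Rightarrow> 'a \<Rightarrow> real" where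
  "induced_metric A B f g p u v = g (f p) (differential A B f p u) (differential A B f p v)"

definition unit_normal_on ::
    "('m, 'a::euclidean_space) chart set \<Rightarrow> ('n, 'b::euclidean_space) chart set \<Rightarrow> ('m \<Rightarrow> 'n) \<Rightarrow>
     ('n \<Rightarrow> 'b \<Rightarrow> 'b \<Rightarrow> real) \<Rightarrow> 'm set \<Rightarrow> ('m \<Rightarrow> 'b) \<Rightarrow> bool" where
  "unit_normal_on A B f g U \<zeta> \<longleftrightarrow> smooth_field_along A B f U \<zeta> \<and>
     (\<forall>p\<in>U. g (f p) (\<zeta> p) (\<zeta> p) = 1 \<and> (\<forall>u. g (f p) (\<zeta> p) (differential A B f p u) = 0))"

definition shape_operator ::
    "('m, 'a::euclidean_space) chart set \<Rightarrow> ('n, 'b::euclidean_space) chart set \<Rightarrow> ('m \<Rightarrow> 'n) \<Rightarrow>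
     ('n \<Rightarrow> 'b \<Rightarrow> 'b \<Rightarrow> real) \<Rightarrow> ('m \<Rightarrow> 'b) \<Rightarrow> 'm \<Rightarrow> 'a \<Rightarrow> 'a" where
  "shape_operator A B f g \<zeta> p u =
     (THE w. differential A B f p w = - cov_deriv A B g f \<zeta> p u)"

definition reeb_field ::
    "('m, 'a::euclidean_space) chart set \<Rightarrow> ('n, 'b::euclidean_space) chart set \<Rightarrow> ('m \<Rightarrow> 'n) \<Rightarrow>
     ('n \<Rightarrow> 'b \<Rightarrow> 'b) \<Rightarrow> ('m \<Rightarrow> 'b) \<Rightarrow> 'm \<Rightarrow> 'a" where
  "reeb_field A B f J \<zeta> p = (THE w. differential A B f p w = - J (f p) (\<zeta> p))"

definition contact_form ::
    "('m, 'a::euclidean_space) chart set \<Rightarrow> ('n, 'b::euclidean_space) chart set \<Rightarrow> ('m \<Rightarrow> 'n) \<Rightarrow>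
     ('n \<Rightarrow> 'b \<Rightarrow> 'b \<Rightarrow> real) \<Rightarrow> ('n \<Rightarrow> 'b \<Rightarrow> 'b) \<Rightarrow> ('m \<Rightarrow> 'b) \<Rightarrow> 'm \<Rightarrow> 'a \<Rightarrow> real" where
  "contact_form A B f g J \<zeta> p u = induced_metric A B f g p u (reeb_field A B f J \<zeta> p)"

definition structure_tensor ::
    "('m, 'a::euclidean_space) chart set \<Rightarrow> ('n, 'b::euclidean_space) chart set \<Rightarrow> ('m \<Rightarrow> 'n) \<Rightarrow>
     ('n \<Rightarrow> 'b \<Rightarrow> 'b \<Rightarrow> real) \<Rightarrow> ('n \<Rightarrow> 'b \<Rightarrow> 'b) \<Rightarrow> ('m \<Rightarrow> 'b) \<Rightarrow> 'm \<Rightarrow> 'a \<Rightarrow> 'a" where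
  "structure_tensor A B f g J \<zeta> p u =
     (THE w. J (f p) (differential A B f p u) =
        differential A B f p w + contact_form A B f g J \<zeta> p u *\<^sub>R \<zeta> p)"

text \<open>\<open>TM \<inter> J(TM)\<close>; it coincides with the kernel of the contact form of any local unit normal.\<close>

definition maximal_complex_subbundle ::
    "('m, 'a::euclidean_space) chart set \<Rightarrow> ('n, 'b::euclidean_space) chart set \<Rightarrow> ('m \<Rightarrow> 'n) \<Rightarrow>
     ('n \<Rightarrow> 'b \<Rightarrow> 'b) \<Rightarrow> 'm \<Rightarrow> 'a set" where
  "maximal_complex_subbundle A B f J p =
     {u. differential A B f p u \<in> J (f p) ` range (differential A B f p)}"

text \<open>A unit normal need only exist locally, and it is unique up to sign. The conditions below
  therefore quantify over all smooth unit normals \<open>\<zeta>\<close> defined on open subsets \<open>U\<close> of \<open>M\<close>.\<close>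

definition contact_form_closed ::
    "('m::topological_space, 'a::euclidean_space) chart set \<Rightarrow>
     ('n, 'b::euclidean_space) chart set \<Rightarrow> ('m \<Rightarrow> 'n) \<Rightarrow>
     ('n \<Rightarrow> 'b \<Rightarrow> 'b \<Rightarrow> real) \<Rightarrow> ('n \<Rightarrow> 'b \<Rightarrow> 'b) \<Rightarrow> bool" where
  "contact_form_closed A B f g J \<longleftrightarrow>
     (\<forall>U \<zeta>. open U \<longrightarrow> unit_normal_on A B f g U \<zeta> \<longrightarrow>
        (\<forall>p\<in>U. \<forall>u v. ext_deriv A (contact_form A B f g J \<zeta>) p u v = 0))"

definition shape_anticommutes_structure ::
    "('m::topological_space, 'a::euclidean_space) chart set \<Rightarrow>
     ('n, 'b::euclidean_space) chart set \<Rightarrow> ('m \<Rightarrow> 'n) \<Rightarrow>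
     ('n \<Rightarrow> 'b \<Rightarrow> 'b \<Rightarrow> real) \<Rightarrow> ('n \<Rightarrow> 'b \<Rightarrow> 'b) \<Rightarrow> bool" where
  "shape_anticommutes_structure A B f g J \<longleftrightarrow>
     (\<forall>U \<zeta>. open U \<longrightarrow> unit_normal_on A B f g U \<zeta> \<longrightarrow>
        (\<forall>p\<in>U. \<forall>u.
           shape_operator A B f g \<zeta> p (structure_tensor A B f g J \<zeta> p u) +
           structure_tensor A B f g J \<zeta> p (shape_operator A B f g \<zeta> p u) = 0))"

definition hopf_hypersurface ::
    "('m::topological_space, 'a::euclidean_space) chart set \<Rightarrow>
     ('n, 'b::euclidean_space) chart set \<Rightarrow> ('m \<Rightarrow> 'n) \<Rightarrow>
     ('n \<Rightarrow> 'b \<Rightarrow> 'b \<Rightarrow> real) \<Rightarrow> ('n \<Rightarrow> 'b \<Rightarrow> 'b) \<Rightarrow> bool" where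
  "hopf_hypersurface A B f g J \<longleftrightarrow>
     (\<forall>U \<zeta> I \<gamma>. open U \<longrightarrow> unit_normal_on A B f g U \<zeta> \<longrightarrow> open I \<longrightarrow> is_interval I \<longrightarrow>
        integral_curve_on A U (reeb_field A B f J \<zeta>) I \<gamma> \<longrightarrow>
        geodesic_on A (induced_metric A B f g) I \<gamma>)"

end

theory Submission
  imports Defs
begin

text \<open>Everything follows from computing the exterior derivative of \<open>\<eta>\<close> in two ways.

  The first computation is intrinsic to \<open>M\<close>. The form \<open>\<eta>\<close> is dual to the unit field \<open>\<xi>\<close>, so, with the
  Levi-Civita derivative \<open>\<nabla>\<close> of the induced metric, \<open>d\<eta>(u, v) = g(\<nabla>\<^sub>u \<xi>, v) - g(\<nabla>\<^sub>v \<xi>, u)\<close>. As \<open>\<xi>\<close> has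
  constant length, \<open>d\<eta>(\<xi>, v) = g(\<nabla>\<^sub>\<xi> \<xi>, v)\<close>. Hence the integral curves of \<open>\<xi>\<close> are geodesics if and only if
  \<open>d\<eta>(\<xi>, \<cdot>) = 0\<close> (\<open>integral_curves_geodesic_iff\<close>); one direction of this uses that an integral curve
  passes through every point, which is the Picard-Lindeloef theorem. If the kernel of \<open>\<eta>\<close> is integrable,
  then \<open>\<eta>\<close>, and with it \<open>d\<eta>\<close>, pulls back to zero on the integral manifolds
  (\<open>ext_deriv_vanishes_on_integral_manifold\<close>). As the tangent space is spanned by \<open>\<xi>\<close> and the kernel of
  \<open>\<eta>\<close>, which is the maximal complex subbundle, (iii) implies (i). Conversely, a closed \<open>\<eta>\<close> is locally
  the differential of a function by the Poincare lemma, and the level sets of this function are integral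
  manifolds of the kernel (\<open>closed_dual_integral_manifold\<close>).

  The second computation takes place in the ambient manifold. There \<open>\<eta>(u) = - g(u, J \<zeta>)\<close>, the
  derivative of \<open>\<zeta>\<close> in direction \<open>u\<close> is \<open>- A u\<close>, and \<open>J\<close> is parallel. Together with the symmetry
  of the second fundamental form this gives \<open>d\<eta>(u, v) = g(v, (A \<phi> + \<phi> A) u)\<close>
  (\<open>ext_deriv_contact_form\<close>), so that (i) and (ii) are equivalent at each point.

  Tangent vectors are components in preferred charts, so a pointwise identity is proved by
  calculus in the preferred charts at that one point. Other charts enter only where a neighbourhood
  matters: for the Poincare lemma, for slice charts and for flows. They are compared through the rule that pullback
  commutes with the exterior derivative, which rests on the symmetry of second derivatives.\<close>

section \<open>Calculus of smooth maps\<close>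

lemma Ck_on_subset: "Ck_on k S f \<Longrightarrow> T \<subseteq> S \<Longrightarrow> Ck_on k T f"
  by (induction k arbitrary: f) (auto intro: continuous_on_subset)

text \<open>The derivatives in \<open>Ck_on\<close> are two-sided, so agreement of the functions on the set transfers them
  only because the set is open.\<close>

lemma Ck_on_cong:
  assumes "open S" "\<And>x. x \<in> S \<Longrightarrow> f x = g x" "Ck_on k S f"
  shows "Ck_on k S g"
  using assms(2,3)
proof (induction k arbitrary: f g)
  case 0
  then show ?case by (simp cong: continuous_on_cong)
next
  case (Suc k)
  have d: "(g has_derivative frechet_derivative f (at x)) (at x)" if "x \<in> S" for x
    using Suc.prems that has_derivative_transform_within_open[OF _ assms(1) that, of f _ UNIV g]
    by (auto simp: frechet_derivative_works)
  have eq: "frechet_derivative g (at x) = frechet_derivative f (at x)" if "x \<in> S" for x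
    using frechet_derivative_at[OF d[OF that]] by simp
  show ?case
  proof (simp, intro conjI ballI allI)
    show "g differentiable at x" if "x \<in> S" for x
      using d[OF that] by (auto simp: differentiable_def)
    show "Ck_on k S (\<lambda>x. frechet_derivative g (at x) v)" for v
      by (rule Suc.IH[of "\<lambda>x. frechet_derivative f (at x) v"]) (use eq Suc.prems in auto)
  qed
qed

lemma Ck_on_SucI:
  assumes "open S" "\<And>x. x \<in> S \<Longrightarrow> (f has_derivative f' x) (at x)"
    and "\<And>v. Ck_on k S (\<lambda>x. f' x v)"
  shows "Ck_on (Suc k) S f"
proof (simp, intro conjI ballI allI)
  show "f differentiable at x" if "x \<in> S" for x
    using assms(2)[OF that] by (auto simp: differentiable_def)
  show "Ck_on k S (\<lambda>x. frechet_derivative f (at x) v)" for v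
    by (rule Ck_on_cong[OF assms(1) _ assms(3)[of v]])
       (use frechet_derivative_at[OF assms(2)] in metis)
qed

lemma Ck_on_Suc_has_derivative:
  "Ck_on (Suc k) S f \<Longrightarrow> x \<in> S \<Longrightarrow> (f has_derivative frechet_derivative f (at x)) (at x)"
  by (simp add: frechet_derivative_works)

lemma Ck_on_SucD: "Ck_on (Suc k) S f \<Longrightarrow> Ck_on k S f"
proof (induction k arbitrary: f)
  case 0
  then show ?case
    by (auto intro!: continuous_at_imp_continuous_on differentiable_imp_continuous_within)
next
  case (Suc k)
  show ?case
    using Suc.prems Suc.IH by (subst Ck_on.simps(2)) simp
qed

lemma Ck_on_const: "open S \<Longrightarrow> Ck_on k S (\<lambda>x. c)"
  by (induction k arbitrary: c) (auto intro!: Ck_on_SucI derivative_eq_intros simp del: Ck_on.simps(2))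

lemma Ck_on_bounded_linear_compose:
  assumes "open S" "bounded_linear L" "Ck_on k S f"
  shows "Ck_on k S (\<lambda>x. L (f x))"
  using assms(3)
proof (induction k arbitrary: f)
  case 0
  then show ?case using bounded_linear.continuous_on[OF assms(2)] by auto
next
  case (Suc k)
  show ?case
    by (rule Ck_on_SucI[OF assms(1) bounded_linear.has_derivative[OF assms(2)
          Ck_on_Suc_has_derivative[OF Suc.prems]]]) (use Suc in auto)
qed

lemma Ck_on_add:
  assumes "open S" "Ck_on k S f" "Ck_on k S g"
  shows "Ck_on k S (\<lambda>x. f x + g x)"
  using assms(2,3)
proof (induction k arbitrary: f g)
  case 0
  then show ?case by (auto intro: continuous_intros)
next
  case (Suc k)
  show ?case
    by (rule Ck_on_SucI[OF assms(1) has_derivative_add[OF Ck_on_Suc_has_derivative[OF Suc.prems(1)]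
          Ck_on_Suc_has_derivative[OF Suc.prems(2)]]]) (use Suc in auto)
qed

lemma Ck_on_sum:
  assumes "open S" "\<And>i. i \<in> I \<Longrightarrow> Ck_on k S (f i)"
  shows "Ck_on k S (\<lambda>x. \<Sum>i\<in>I. f i x)"
  using assms(2)
  by (induction I rule: infinite_finite_induct) (auto intro!: Ck_on_const Ck_on_add assms(1))

lemma Ck_on_bilinear:
  assumes "open S" "bounded_bilinear B" "Ck_on k S f" "Ck_on k S g"
  shows "Ck_on k S (\<lambda>x. B (f x) (g x))"
  using assms(3,4)
proof (induction k arbitrary: f g)
  case 0
  then show ?case using bounded_bilinear.continuous_on[OF assms(2)] by auto
next
  case (Suc k)
  show ?case
    by (rule Ck_on_SucI[OF assms(1) bounded_bilinear.FDERIV[OF assms(2)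
          Ck_on_Suc_has_derivative[OF Suc.prems(1)] Ck_on_Suc_has_derivative[OF Suc.prems(2)]]])
       (use Suc Ck_on_SucD[OF Suc.prems(1)] Ck_on_SucD[OF Suc.prems(2)]
         in \<open>auto intro!: Ck_on_add assms(1)\<close>)
qed

lemma linear_expand_basis:
  fixes w :: "'a::euclidean_space"
  assumes "linear L"
  shows "L w = (\<Sum>b\<in>Basis. (w \<bullet> b) *\<^sub>R L b)"
  by (subst euclidean_representation[of w, symmetric])
     (simp add: linear_sum[OF assms] linear_cmul[OF assms] del: euclidean_representation)

text \<open>The matrix-vector product: expand the vector in the standard basis. This is how derivatives, known only in
  each fixed direction to be of class \<open>C\<^sup>k\<close>, are applied to varying directions.\<close>

lemma Ck_on_linear_family:
  fixes w :: "'a::real_normed_vector \<Rightarrow> 'b::euclidean_space"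
  assumes "open S" "\<And>x. x \<in> S \<Longrightarrow> linear (M x)"
    and "\<And>b. Ck_on k S (\<lambda>x. M x b)" "Ck_on k S w"
  shows "Ck_on k S (\<lambda>x. M x (w x))"
proof (rule Ck_on_cong[OF assms(1)])
  show "(\<Sum>b\<in>Basis. (w x \<bullet> b) *\<^sub>R M x b) = M x (w x)" if "x \<in> S" for x
    by (rule linear_expand_basis[OF assms(2)[OF that], symmetric])
  show "Ck_on k S (\<lambda>x. \<Sum>b\<in>Basis. (w x \<bullet> b) *\<^sub>R M x b)"
    by (rule Ck_on_sum[OF assms(1) Ck_on_bilinear[OF assms(1) bounded_bilinear_scaleR
          Ck_on_bounded_linear_compose[OF assms(1) bounded_linear_inner_left assms(4)] assms(3)]])
qed

text \<open>Induction on the order, for all outer functions simultaneously: by the chain rule the derivative of the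
  composite is a linear family, composed of the derivatives of the outer function, applied to the
  derivative of the inner one.\<close>

lemma Ck_on_compose:
  fixes f :: "'a::real_normed_vector \<Rightarrow> 'b::euclidean_space"
  assumes "open S" "open T" "f ` S \<subseteq> T" "Ck_on k S f" "Ck_on k T h"
  shows "Ck_on k S (\<lambda>x. h (f x))"
  using assms(4,5)
proof (induction k arbitrary: h)
  case 0
  then show ?case
    using continuous_on_compose2[of T h S f] assms(3) by auto
next
  case (Suc k)
  have df: "(f has_derivative frechet_derivative f (at x)) (at x)" if "x \<in> S" for x
    using Ck_on_Suc_has_derivative[OF Suc.prems(1)] that by auto
  have dh: "(h has_derivative frechet_derivative h (at (f x))) (at (f x))" if "x \<in> S" for x
    using Ck_on_Suc_has_derivative[OF Suc.prems(2)] assms(3) that by auto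
  show ?case
  proof (rule Ck_on_SucI[OF assms(1) has_derivative_compose[OF df dh]])
    fix v
    show "Ck_on k S (\<lambda>x. frechet_derivative h (at (f x)) (frechet_derivative f (at x) v))"
    proof (rule Ck_on_linear_family[OF assms(1)])
      show "linear (frechet_derivative h (at (f x)))" if "x \<in> S" for x
        using has_derivative_linear[OF dh[OF that]] .
      show "Ck_on k S (\<lambda>x. frechet_derivative h (at (f x)) b)" for b
        using Suc.IH[of "\<lambda>y. frechet_derivative h (at y) b"] Ck_on_SucD[OF Suc.prems(1)] Suc.prems(2)
        by auto
      show "Ck_on k S (\<lambda>x. frechet_derivative f (at x) v)"
        using Suc by auto
    qed
  qed
qed

text \<open>All these closure properties pass to maps that are of class \<open>C\<^sup>k\<close> for every \<open>k\<close>.\<close>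

lemma smooth_on_cong:
  "open S \<Longrightarrow> (\<And>x. x \<in> S \<Longrightarrow> f x = g x) \<Longrightarrow> smooth_on S f \<Longrightarrow> smooth_on S g"
  unfolding smooth_on_def using Ck_on_cong by blast

lemma smooth_on_subset: "smooth_on S f \<Longrightarrow> T \<subseteq> S \<Longrightarrow> smooth_on T f"
  unfolding smooth_on_def using Ck_on_subset by blast

lemma smooth_on_differentiable: "smooth_on S f \<Longrightarrow> x \<in> S \<Longrightarrow> f differentiable (at x)"
  unfolding smooth_on_def using Ck_on.simps(2)[of 0] by blast

lemma smooth_on_has_derivative:
  "smooth_on S f \<Longrightarrow> x \<in> S \<Longrightarrow> (f has_derivative frechet_derivative f (at x)) (at x)"
  using smooth_on_differentiable frechet_derivative_works by blast

lemma smooth_on_linear_derivative: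
  "smooth_on S f \<Longrightarrow> x \<in> S \<Longrightarrow> linear (frechet_derivative f (at x))"
  using smooth_on_has_derivative has_derivative_linear by blast

lemma smooth_on_continuous: "smooth_on S f \<Longrightarrow> continuous_on S f"
  unfolding smooth_on_def using Ck_on.simps(1) by blast

lemma smooth_on_derivative: "smooth_on S f \<Longrightarrow> smooth_on S (\<lambda>x. frechet_derivative f (at x) v)"
  unfolding smooth_on_def using Ck_on.simps(2) by blast

lemma smooth_on_const: "open S \<Longrightarrow> smooth_on S (\<lambda>x. c)"
  by (simp add: smooth_on_def Ck_on_const)

lemma smooth_on_bounded_linear_compose:
  "open S \<Longrightarrow> bounded_linear L \<Longrightarrow> smooth_on S f \<Longrightarrow> smooth_on S (\<lambda>x. L (f x))"
  by (simp add: smooth_on_def Ck_on_bounded_linear_compose)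

lemma smooth_on_id: "open S \<Longrightarrow> smooth_on S (\<lambda>x. x)"
  unfolding smooth_on_def
proof
  show "open S \<Longrightarrow> Ck_on k S (\<lambda>x. x)" for k
    by (cases k)
       (auto intro!: Ck_on_SucI[OF _ has_derivative_ident] Ck_on_const simp del: Ck_on.simps(2))
qed

lemma smooth_on_add:
  "open S \<Longrightarrow> smooth_on S f \<Longrightarrow> smooth_on S g \<Longrightarrow> smooth_on S (\<lambda>x. f x + g x)"
  by (simp add: smooth_on_def Ck_on_add)

lemma smooth_on_sum:
  "open S \<Longrightarrow> (\<And>i. i \<in> I \<Longrightarrow> smooth_on S (f i)) \<Longrightarrow> smooth_on S (\<lambda>x. \<Sum>i\<in>I. f i x)"
  by (simp add: smooth_on_def Ck_on_sum)

lemma smooth_on_bilinear: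
  "open S \<Longrightarrow> bounded_bilinear B \<Longrightarrow> smooth_on S f \<Longrightarrow> smooth_on S g \<Longrightarrow>
    smooth_on S (\<lambda>x. B (f x) (g x))"
  by (simp add: smooth_on_def Ck_on_bilinear)

lemma smooth_on_minus: "open S \<Longrightarrow> smooth_on S f \<Longrightarrow> smooth_on S (\<lambda>x. - f x)"
  by (rule smooth_on_bounded_linear_compose[OF _ bounded_linear_minus[OF bounded_linear_ident]])

lemma smooth_on_diff:
  "open S \<Longrightarrow> smooth_on S f \<Longrightarrow> smooth_on S g \<Longrightarrow> smooth_on S (\<lambda>x. f x - g x)"
  using smooth_on_add[OF _ _ smooth_on_minus, of S f g] by simp

lemma smooth_on_linear_family:
  fixes w :: "'a::real_normed_vector \<Rightarrow> 'b::euclidean_space"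
  assumes "open S" "\<And>x. x \<in> S \<Longrightarrow> linear (M x)"
    and "\<And>b. smooth_on S (\<lambda>x. M x b)" "smooth_on S w"
  shows "smooth_on S (\<lambda>x. M x (w x))"
  using assms Ck_on_linear_family[of S M _ w] by (simp add: smooth_on_def)

lemma smooth_on_bilinear_family:
  fixes v :: "'a::real_normed_vector \<Rightarrow> 'b::euclidean_space" and w :: "'a \<Rightarrow> 'c::euclidean_space"
  assumes S: "open S" and bil: "\<And>x. x \<in> S \<Longrightarrow> bilinear (M x)"
    and sm: "\<And>b c. smooth_on S (\<lambda>x. M x b c)" "smooth_on S v" "smooth_on S w"
  shows "smooth_on S (\<lambda>x. M x (v x) (w x))"
proof (rule smooth_on_linear_family[OF S _ _ sm(3)])
  show "linear (M x (v x))" if "x \<in> S" for x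
    using bil[OF that] by (simp add: bilinear_def)
  show "smooth_on S (\<lambda>x. M x (v x) b)" for b
    by (rule smooth_on_linear_family[OF S _ _ sm(2), where M="\<lambda>x v. M x v b"])
       (use bil sm(1) in \<open>auto simp: bilinear_def\<close>)
qed

lemma smooth_on_compose:
  fixes f :: "'a::real_normed_vector \<Rightarrow> 'b::euclidean_space"
  assumes "open S" "open T" "f ` S \<subseteq> T" "smooth_on S f" "smooth_on T h"
  shows "smooth_on S (\<lambda>x. h (f x))"
  using Ck_on_compose[OF assms(1-3)] assms(4,5) unfolding smooth_on_def by blast

text \<open>Every derivative of a real power is a multiple of another real power; the factor \<open>c\<close> makes the induction close.\<close>

lemma smooth_on_powr: "smooth_on {0<..} (\<lambda>x::real. x powr a)"
proof -
  have "Ck_on k {0<..} (\<lambda>x::real. c * x powr a)" for k c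
  proof (induction k arbitrary: a c)
    case 0
    show ?case by (auto intro!: continuous_intros)
  next
    case (Suc k)
    have d: "((\<lambda>x. c * x powr a) has_derivative (\<lambda>v. v * (c * (a * x powr (a - 1))))) (at x)"
      if "x \<in> {0<..}" for x :: real
      using that by (auto intro!: derivative_eq_intros simp: powr_diff field_simps)
    show ?case
    proof (rule Ck_on_SucI[OF _ d])
      show "Ck_on k {0<..} (\<lambda>x. v * (c * (a * x powr (a - 1))))" for v
        using Suc[of "v * c * a" "a - 1"] by (simp add: mult_ac)
    qed auto
  qed
  from this[of _ 1] show ?thesis by (simp add: smooth_on_def)
qed

lemma Ck_on_local:
  assumes "\<And>x. x \<in> S \<Longrightarrow> \<exists>T. open T \<and> x \<in> T \<and> Ck_on k T f"
  shows "Ck_on k S f"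
  using assms
proof (induction k arbitrary: f)
  case 0
  show ?case
  proof (rule continuous_at_imp_continuous_on[THEN Ck_on.simps(1)[THEN iffD2]], rule ballI)
    fix x assume "x \<in> S"
    with 0 obtain T where "open T" "x \<in> T" "continuous_on T f" by auto
    then show "isCont f x" by (simp add: continuous_on_eq_continuous_at)
  qed
next
  case (Suc k)
  show ?case
  proof (simp, intro conjI ballI allI)
    show "f differentiable at x" if "x \<in> S" for x using Suc.prems[OF that] by auto
    show "Ck_on k S (\<lambda>x. frechet_derivative f (at x) v)" for v
      by (rule Suc.IH) (use Suc.prems in fastforce)
  qed
qed

lemma smooth_on_local:
  assumes "\<And>x. x \<in> S \<Longrightarrow> \<exists>T. open T \<and> x \<in> T \<and> smooth_on T f"
  shows "smooth_on S f"
  unfolding smooth_on_def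
proof
  show "Ck_on k S f" for k
    by (rule Ck_on_local) (use assms in \<open>auto simp: smooth_on_def\<close>)
qed

lemma smooth_on_if_derivative_smooth:
  assumes "open S" "\<And>x. x \<in> S \<Longrightarrow> (f has_derivative f' x) (at x)"
    and "\<And>v. smooth_on S (\<lambda>x. f' x v)"
  shows "smooth_on S f"
  unfolding smooth_on_def
proof
  fix k
  show "Ck_on k S f"
    using Ck_on_SucD[OF Ck_on_SucI[OF assms(1,2)]] assms(3) by (auto simp: smooth_on_def)
qed

text \<open>Along with the family \<open>M\<close> of linear maps, the map \<open>(x, w) \<mapsto> (x, M x w)\<close> of the product space is
  invertible, so the inverse function theorem differentiates its inverse \<open>(x, w) \<mapsto> (x, N x w)\<close>. The result is the
  formula \<open>- N M' N\<close> for the derivative of an inverse matrix, with \<open>M'\<close> expanded in the basis.\<close>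

lemma has_derivative_inverse_linear_family:
  fixes M N :: "'a::euclidean_space \<Rightarrow> 'b::euclidean_space \<Rightarrow> 'b"
  assumes S: "open S" and linM: "\<And>x. x \<in> S \<Longrightarrow> linear (M x)" and linN: "\<And>x. x \<in> S \<Longrightarrow> linear (N x)"
    and NM: "\<And>x w. x \<in> S \<Longrightarrow> N x (M x w) = w" and MN: "\<And>x w. x \<in> S \<Longrightarrow> M x (N x w) = w"
    and der: "\<And>b x. x \<in> S \<Longrightarrow> ((\<lambda>x. M x b) has_derivative M' x b) (at x)"
    and x: "x \<in> S"
  shows "((\<lambda>x. N x w) has_derivative
           (\<lambda>u. - N x (\<Sum>b\<in>Basis. (N x w \<bullet> b) *\<^sub>R M' x b u))) (at x)"
proof -
  define P where "P = (\<lambda>z. (fst z, M (fst z) (snd z)))"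
  define Q where "Q = (\<lambda>z. (fst z, N (fst z) (snd z)))"
  have PQ: "Q (P z) = z" if "z \<in> S \<times> UNIV" for z
    using that NM by (auto simp: P_def Q_def)
  define E where "E = (\<lambda>z w. \<Sum>b\<in>Basis. (snd z \<bullet> b) *\<^sub>R M' (fst z) b w)"
  define P' where "P' = (\<lambda>z v. (fst v, E z (fst v) + M (fst z) (snd v)))"
  have derP: "(P has_derivative P' z) (at z)" if z: "z \<in> S \<times> UNIV" for z
  proof -
    have "((\<lambda>z. \<Sum>b\<in>Basis. (snd z \<bullet> b) *\<^sub>R M (fst z) b) has_derivative
        (\<lambda>v. E z (fst v) + M (fst z) (snd v))) (at z)"
    proof -
      have "((\<lambda>z. \<Sum>b\<in>Basis. (snd z \<bullet> b) *\<^sub>R M (fst z) b) has_derivative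
        (\<lambda>v. \<Sum>b\<in>Basis. (snd z \<bullet> b) *\<^sub>R M' (fst z) b (fst v) + (snd v \<bullet> b) *\<^sub>R M (fst z) b)) (at z)"
        using z by (auto intro!: derivative_eq_intros has_derivative_compose[OF _ der])
      moreover have "(\<Sum>b\<in>Basis. (snd z \<bullet> b) *\<^sub>R M' (fst z) b (fst v) + (snd v \<bullet> b) *\<^sub>R M (fst z) b)
          = E z (fst v) + M (fst z) (snd v)" for v
        using z linear_expand_basis[OF linM, of "fst z" "snd v"]
        by (auto simp: E_def sum.distrib)
      ultimately show ?thesis by simp
    qed
    then have "((\<lambda>z. M (fst z) (snd z)) has_derivative
        (\<lambda>v. E z (fst v) + M (fst z) (snd v))) (at z)"
      by (rule has_derivative_transform_within_open[OF _ open_Times[OF S open_UNIV] z])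
         (metis SigmaE fst_conv linM linear_expand_basis)
    then show ?thesis
      unfolding P_def P'_def by (auto intro!: derivative_eq_intros)
  qed
  define z where "z = (x, N x w)"
  define Q' where "Q' = (\<lambda>v. (fst v, N x (snd v - E z (fst v))))"
  have "(Q has_derivative Q') (at (P z))"
  proof (rule has_derivative_inverse_on[where f=P and g=Q and f'=P' and g'="\<lambda>_. Q'" and S="S \<times> UNIV"])
    show "P' z \<circ> Q' = id"
      using x MN by (auto simp: P'_def Q'_def z_def)
  qed (use derP PQ x S in \<open>auto simp: z_def open_Times\<close>)
  then have Qd: "(Q has_derivative Q') (at (x, w))"
    using x MN by (simp add: P_def z_def)
  have "((\<lambda>y. (y, w)) has_derivative (\<lambda>u. (u, 0))) (at x)"
    by (auto intro!: derivative_eq_intros)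
  from has_derivative_snd[OF has_derivative_compose[OF this Qd]]
  show ?thesis
    using linear_diff[OF linN[OF x]] linear_0[OF linN[OF x]]
    by (simp add: Q_def Q'_def E_def z_def)
qed

text \<open>The formula for the derivative expresses one more derivative of the inverse by the inverse itself, which starts
  an induction on the order.\<close>

lemma smooth_on_inverse_linear_family:
  fixes M N :: "'a::euclidean_space \<Rightarrow> 'b::euclidean_space \<Rightarrow> 'b"
  assumes S: "open S" and linM: "\<And>x. x \<in> S \<Longrightarrow> linear (M x)" and linN: "\<And>x. x \<in> S \<Longrightarrow> linear (N x)"
    and NM: "\<And>x w. x \<in> S \<Longrightarrow> N x (M x w) = w" and MN: "\<And>x w. x \<in> S \<Longrightarrow> M x (N x w) = w"
    and sm: "\<And>b. smooth_on S (\<lambda>x. M x b)"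
  shows "smooth_on S (\<lambda>x. N x w)"
proof -
  note der = has_derivative_inverse_linear_family[OF S linM linN NM MN
      smooth_on_has_derivative[OF sm]]
  have "Ck_on k S (\<lambda>x. N x w)" for k
  proof (induction k arbitrary: w)
    case 0
    have "continuous (at x) (\<lambda>x. N x w)" if "x \<in> S" for x
      using has_derivative_continuous[OF der[OF _ _ _ _ _ that]] by auto
    then show ?case by (auto intro!: continuous_at_imp_continuous_on)
  next
    case (Suc k)
    show ?case
    proof (rule Ck_on_SucI[OF S der])
      fix v
      have "Ck_on k S (\<lambda>x. N x (\<Sum>b\<in>Basis. (N x w \<bullet> b) *\<^sub>R frechet_derivative (\<lambda>x. M x b) (at x) v))"
      proof (rule Ck_on_linear_family[OF S linN Suc])
        show "Ck_on k S (\<lambda>x. \<Sum>b\<in>Basis. (N x w \<bullet> b) *\<^sub>R frechet_derivative (\<lambda>x. M x b) (at x) v)"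
          by (rule Ck_on_sum[OF S Ck_on_bilinear[OF S bounded_bilinear_scaleR
                Ck_on_bounded_linear_compose[OF S bounded_linear_inner_left Suc]]])
             (use smooth_on_derivative[OF sm] in \<open>auto simp: smooth_on_def\<close>)
      qed
      then show "Ck_on k S (\<lambda>x. - N x (\<Sum>b\<in>Basis. (N x w \<bullet> b) *\<^sub>R frechet_derivative (\<lambda>x. M x b) (at x) v))"
        by (rule Ck_on_bounded_linear_compose[OF S bounded_linear_minus[OF bounded_linear_ident]])
    qed
  qed
  then show ?thesis by (simp add: smooth_on_def)
qed

text \<open>The derivative of the inverse map is the inverse linear family composed with the inverse map, so each order of
  differentiability of the inverse map gives the next.\<close>

lemma smooth_on_inverse_map:
  fixes \<Psi> \<Theta> :: "'a::euclidean_space \<Rightarrow> 'a"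
  assumes S: "open S" and T: "open (\<Psi> ` S)" and sm: "smooth_on S \<Psi>"
    and inv: "\<And>x. x \<in> S \<Longrightarrow> \<Theta> (\<Psi> x) = x"
    and inj: "\<And>x. x \<in> S \<Longrightarrow> inj (frechet_derivative \<Psi> (at x))"
  shows "smooth_on (\<Psi> ` S) \<Theta>"
proof -
  define M where "M = (\<lambda>x. frechet_derivative \<Psi> (at x))"
  define N where "N = (\<lambda>x. inv (M x))"
  have linM: "linear (M x)" if "x \<in> S" for x
    using smooth_on_linear_derivative[OF sm that] by (simp add: M_def)
  have injM: "inj (M x)" if "x \<in> S" for x using inj that by (simp add: M_def)
  have surjM: "surj (M x)" if "x \<in> S" for x
    using linM[OF that] injM[OF that] by (simp add: linear_injective_imp_surjective)
  have NM: "N x (M x w) = w" if "x \<in> S" for x w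
    using injM that by (simp add: N_def)
  have MN: "M x (N x w) = w" if "x \<in> S" for x w
    using surjM that by (simp add: N_def surj_f_inv_f)
  have linN: "linear (N x)" if "x \<in> S" for x
    unfolding N_def by (rule inj_linear_imp_inv_linear[OF linM[OF that] injM[OF that]])
  have smN: "smooth_on S (\<lambda>x. N x w)" for w
    by (rule smooth_on_inverse_linear_family[OF S linM linN NM MN])
       (use smooth_on_derivative[OF sm] in \<open>auto simp: M_def\<close>)
  have der: "(\<Theta> has_derivative N (\<Theta> y)) (at y)" if "y \<in> \<Psi> ` S" for y
  proof -
    from that obtain x where x: "x \<in> S" "y = \<Psi> x" by auto
    have "(\<Theta> has_derivative N x) (at (\<Psi> x))"
      by (rule has_derivative_inverse_on[where f=\<Psi> and g=\<Theta> and f'=M and g'=N and S=S])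
         (use smooth_on_has_derivative[OF sm] MN[OF x(1)] S inv x(1) in \<open>auto simp: fun_eq_iff M_def\<close>)
    then show ?thesis using x inv by simp
  qed
  have img: "\<Theta> ` \<Psi> ` S \<subseteq> S" using inv by auto
  have "Ck_on k (\<Psi> ` S) \<Theta>" for k
  proof (induction k)
    case 0
    show ?case using has_derivative_continuous[OF der] by (auto intro!: continuous_at_imp_continuous_on)
  next
    case (Suc k)
    show ?case
      by (rule Ck_on_SucI[OF T der], assumption, rule Ck_on_compose[OF T S img Suc])
         (use smN in \<open>auto simp: smooth_on_def\<close>)
  qed
  then show ?thesis by (simp add: smooth_on_def)
qed


section \<open>Derivatives of families of linear and bilinear maps\<close>

text \<open>The product rule for a matrix-vector product, with the derivative of the matrix taken entry by entry against
  the fixed vector \<open>w x\<close>.\<close>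

lemma has_derivative_linear_family:
  fixes w :: "'a::real_normed_vector \<Rightarrow> 'b::euclidean_space"
  assumes S: "open S" "x \<in> S" and lin: "\<And>y. y \<in> S \<Longrightarrow> linear (M y)"
    and M: "\<And>b. (\<lambda>y. M y b) differentiable (at x)"
    and w: "(w has_derivative w') (at x)"
  shows "((\<lambda>y. M y (w y)) has_derivative
           (\<lambda>u. frechet_derivative (\<lambda>y. M y (w x)) (at x) u + M x (w' u))) (at x)"
proof -
  define M' where "M' = (\<lambda>b. frechet_derivative (\<lambda>y. M y b) (at x))"
  have M': "((\<lambda>y. M y b) has_derivative M' b) (at x)" for b
    using M by (simp add: M'_def frechet_derivative_works)
  have expand: "((\<lambda>y. M y (v y)) has_derivative
      (\<lambda>u. (\<Sum>b\<in>Basis. (v x \<bullet> b) *\<^sub>R M' b u + (v' u \<bullet> b) *\<^sub>R M x b))) (at x)"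
    if v: "(v has_derivative v') (at x)" for v v'
  proof (rule has_derivative_transform_within_open[OF _ S])
    show "((\<lambda>y. \<Sum>b\<in>Basis. (v y \<bullet> b) *\<^sub>R M y b) has_derivative
      (\<lambda>u. (\<Sum>b\<in>Basis. (v x \<bullet> b) *\<^sub>R M' b u + (v' u \<bullet> b) *\<^sub>R M x b))) (at x)"
      by (intro has_derivative_sum has_derivative_scaleR has_derivative_inner_left v M')
    show "(\<Sum>b\<in>Basis. (v y \<bullet> b) *\<^sub>R M y b) = M y (v y)" if "y \<in> S" for y
      by (rule linear_expand_basis[OF lin[OF that], symmetric])
  qed
  have 1: "frechet_derivative (\<lambda>y. M y (w x)) (at x) u = (\<Sum>b\<in>Basis. (w x \<bullet> b) *\<^sub>R M' b u)" for u
    using fun_cong[OF has_derivative_unique[OF M'[of "w x"] expand[OF has_derivative_const[of "w x"]]], of u]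
    by (simp add: M'_def)
  have 2: "M x (w' u) = (\<Sum>b\<in>Basis. (w' u \<bullet> b) *\<^sub>R M x b)" for u
    by (rule linear_expand_basis[OF lin[OF S(2)]])
  show ?thesis
    using expand[OF w] unfolding 1 2 by (simp add: sum.distrib)
qed

lemma linear_frechet_derivative_family:
  fixes M :: "'a::real_normed_vector \<Rightarrow> 'b::euclidean_space \<Rightarrow> 'c::real_normed_vector"
  assumes S: "open S" "x \<in> S" and lin: "\<And>y. y \<in> S \<Longrightarrow> linear (M y)"
    and M: "\<And>b. (\<lambda>y. M y b) differentiable (at x)"
  shows "linear (\<lambda>b. frechet_derivative (\<lambda>y. M y b) (at x) u)"
proof -
  have d: "((\<lambda>y. M y b) has_derivative frechet_derivative (\<lambda>y. M y b) (at x)) (at x)" for b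
    using M by (simp add: frechet_derivative_works)
  show ?thesis
  proof
    fix b c r
    have "((\<lambda>y. M y (b + c)) has_derivative (\<lambda>u. frechet_derivative (\<lambda>y. M y b) (at x) u +
        frechet_derivative (\<lambda>y. M y c) (at x) u)) (at x)"
      by (rule has_derivative_transform_within_open[OF has_derivative_add[OF d d] S])
         (simp add: linear_add[OF lin])
    from has_derivative_unique[OF d this]
    show "frechet_derivative (\<lambda>y. M y (b + c)) (at x) u =
       frechet_derivative (\<lambda>y. M y b) (at x) u + frechet_derivative (\<lambda>y. M y c) (at x) u"
      by (simp add: fun_eq_iff)
    have "((\<lambda>y. M y (r *\<^sub>R b)) has_derivative (\<lambda>u. r *\<^sub>R frechet_derivative (\<lambda>y. M y b) (at x) u)) (at x)"
      by (rule has_derivative_transform_within_open[OF has_derivative_scaleR_right[OF d] S])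
         (simp add: linear_cmul[OF lin])
    from has_derivative_unique[OF d this]
    show "frechet_derivative (\<lambda>y. M y (r *\<^sub>R b)) (at x) u = r *\<^sub>R frechet_derivative (\<lambda>y. M y b) (at x) u"
      by (simp add: fun_eq_iff)
  qed
qed

lemma has_derivative_bilinear_family:
  fixes v :: "'a::real_normed_vector \<Rightarrow> 'b::euclidean_space" and w :: "'a \<Rightarrow> 'c::euclidean_space"
  assumes S: "open S" "x \<in> S" and bil: "\<And>y. y \<in> S \<Longrightarrow> bilinear (G y)"
    and G: "\<And>b c. (\<lambda>y. G y b c) differentiable (at x)"
    and v: "(v has_derivative v') (at x)" and w: "(w has_derivative w') (at x)"
  shows "((\<lambda>y. G y (v y) (w y)) has_derivative
           (\<lambda>u. frechet_derivative (\<lambda>y. G y (v x) (w x)) (at x) u + G x (v' u) (w x) + G x (v x) (w' u)))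
         (at x)"
proof -
  have lin1: "linear (\<lambda>b. G y b c)" and lin2: "linear (G y b)" if "y \<in> S" for y b c
    using bil[OF that] by (auto simp: bilinear_def)
  have d: "((\<lambda>y. G y (v y) c) has_derivative
      (\<lambda>u. frechet_derivative (\<lambda>y. G y (v x) c) (at x) u + G x (v' u) c)) (at x)" for c
    by (rule has_derivative_linear_family[where M="\<lambda>y b. G y b c", OF S _ _ v]) (use lin1 G in auto)
  have "((\<lambda>y. G y (v y) (w y)) has_derivative
      (\<lambda>u. frechet_derivative (\<lambda>y. G y (v y) (w x)) (at x) u + G x (v x) (w' u))) (at x)"
    by (rule has_derivative_linear_family[where M="\<lambda>y. G y (v y)", OF S lin2 _ w])
       (use d in \<open>auto simp: differentiable_def\<close>)
  then show ?thesis
    by (simp add: frechet_derivative_at[OF d, symmetric])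
qed


section \<open>Symmetry of second derivatives\<close>

text \<open>Applying the mean value theorem first in direction \<open>u\<close> and then in direction \<open>v\<close> evaluates the second
  difference as a second derivative at a nearby point.\<close>

lemma second_difference_mean_value:
  fixes F :: "'a::real_normed_vector \<Rightarrow> real"
  assumes ball: "ball x r \<subseteq> S" and h: "0 < h" "h * (norm u + norm v) < r"
    and F: "\<And>y. y \<in> S \<Longrightarrow> (F has_derivative F' y) (at y)"
    and F': "\<And>y. y \<in> S \<Longrightarrow> ((\<lambda>y. F' y u) has_derivative F'' y) (at y)"
  shows "\<exists>z\<in>ball x r. F (x + h *\<^sub>R u + h *\<^sub>R v) - F (x + h *\<^sub>R u) - (F (x + h *\<^sub>R v) - F x) = h * (h * F'' z v)"
proof -
  have mem: "x + s *\<^sub>R u + t *\<^sub>R v \<in> ball x r" if "0 \<le> s" "s \<le> h" "0 \<le> t" "t \<le> h" for s t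
  proof -
    have "norm (s *\<^sub>R u + t *\<^sub>R v) \<le> s * norm u + t * norm v"
      using norm_triangle_ineq[of "s *\<^sub>R u" "t *\<^sub>R v"] that by simp
    also have "\<dots> \<le> h * norm u + h * norm v"
      using that by (intro add_mono mult_right_mono) auto
    finally have "norm (s *\<^sub>R u + t *\<^sub>R v) < r" using h(2) by (simp add: distrib_left)
    moreover have "dist x (x + s *\<^sub>R u + t *\<^sub>R v) = norm (s *\<^sub>R u + t *\<^sub>R v)"
      by (simp add: dist_norm norm_minus_commute add.assoc add.commute)
    ultimately show ?thesis by simp
  qed
  define \<psi> where "\<psi> = (\<lambda>s. F (x + s *\<^sub>R u + h *\<^sub>R v) - F (x + s *\<^sub>R u))"
  have d\<psi>: "(\<psi> has_real_derivative F' (x + s *\<^sub>R u + h *\<^sub>R v) u - F' (x + s *\<^sub>R u) u) (at s)"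
    if "0 \<le> s" "s \<le> h" for s
  proof -
    have a: "x + s *\<^sub>R u + h *\<^sub>R v \<in> S" using mem[OF that, of h] h ball by auto
    have b: "x + s *\<^sub>R u \<in> S" using mem[OF that, of 0] h ball by auto
    have 1: "((\<lambda>s. F (x + s *\<^sub>R u + h *\<^sub>R v)) has_derivative (\<lambda>d. F' (x + s *\<^sub>R u + h *\<^sub>R v) (d *\<^sub>R u))) (at s)"
      by (rule has_derivative_compose[where f="\<lambda>s. x + s *\<^sub>R u + h *\<^sub>R v", OF _ F[OF a]]) (auto intro!: derivative_eq_intros)
    have 2: "((\<lambda>s. F (x + s *\<^sub>R u)) has_derivative (\<lambda>d. F' (x + s *\<^sub>R u) (d *\<^sub>R u))) (at s)"
      by (rule has_derivative_compose[where f="\<lambda>s. x + s *\<^sub>R u", OF _ F[OF b]]) (auto intro!: derivative_eq_intros)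
    show ?thesis
      unfolding \<psi>_def has_field_derivative_def
      by (rule has_derivative_eq_rhs[OF has_derivative_diff[OF 1 2]])
         (simp add: fun_eq_iff linear_cmul[OF has_derivative_linear[OF F[OF a]]]
           linear_cmul[OF has_derivative_linear[OF F[OF b]]] right_diff_distrib mult.commute)
  qed
  obtain s where s: "0 < s" "s < h"
    and s_eq: "\<psi> h - \<psi> 0 = (h - 0) * (F' (x + s *\<^sub>R u + h *\<^sub>R v) u - F' (x + s *\<^sub>R u) u)"
    using MVT2[OF h(1) d\<psi>] by auto
  define \<theta> where "\<theta> = (\<lambda>t. F' (x + s *\<^sub>R u + t *\<^sub>R v) u)"
  have d\<theta>: "(\<theta> has_real_derivative F'' (x + s *\<^sub>R u + t *\<^sub>R v) v) (at t)" if "0 \<le> t" "t \<le> h" for t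
  proof -
    have a: "x + s *\<^sub>R u + t *\<^sub>R v \<in> S" using mem[of s t] that s ball by auto
    have 1: "((\<lambda>t. F' (x + s *\<^sub>R u + t *\<^sub>R v) u) has_derivative (\<lambda>d. F'' (x + s *\<^sub>R u + t *\<^sub>R v) (d *\<^sub>R v))) (at t)"
      by (rule has_derivative_compose[where f="\<lambda>t. x + s *\<^sub>R u + t *\<^sub>R v", OF _ F'[OF a]]) (auto intro!: derivative_eq_intros)
    show ?thesis
      unfolding \<theta>_def has_field_derivative_def
      by (rule has_derivative_eq_rhs[OF 1])
         (simp add: fun_eq_iff linear_cmul[OF has_derivative_linear[OF F'[OF a]]])
  qed
  obtain t where t: "0 < t" "t < h" and t_eq: "\<theta> h - \<theta> 0 = (h - 0) * F'' (x + s *\<^sub>R u + t *\<^sub>R v) v"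
    using MVT2[OF h(1) d\<theta>] by auto
  show ?thesis
    by (rule bexI[of _ "x + s *\<^sub>R u + t *\<^sub>R v"])
       (use s_eq t_eq mem[of s t] s t in \<open>auto simp: \<psi>_def \<theta>_def\<close>)
qed

text \<open>The second difference is symmetric in the two directions. Hence the two mixed derivatives agree at points
  arbitrarily close to \<open>x\<close>, and by continuity at \<open>x\<close> itself.\<close>

lemma symmetric_second_derivative_real:
  fixes F :: "'a::real_normed_vector \<Rightarrow> real"
  assumes S: "open S" "x \<in> S" and F: "smooth_on S F"
  shows "frechet_derivative (\<lambda>y. frechet_derivative F (at y) u) (at x) v =
         frechet_derivative (\<lambda>y. frechet_derivative F (at y) v) (at x) u"
proof -
  define H where "H = (\<lambda>u v y. frechet_derivative (\<lambda>y. frechet_derivative F (at y) u) (at y) v)"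
  note d1 = smooth_on_has_derivative[OF F]
  note d2 = smooth_on_has_derivative[OF smooth_on_derivative[OF F]]
  obtain R where R: "R > 0" "ball x R \<subseteq> S"
    using S open_contains_ball by blast
  have "isCont (H u v) x" "isCont (H v u) x"
    using smooth_on_continuous[OF smooth_on_derivative[OF smooth_on_derivative[OF F]]] S
    by (auto simp: H_def continuous_on_eq_continuous_at)
  have small: "\<bar>H u v x - H v u x\<bar> \<le> e" if e: "e > 0" for e
  proof -
    obtain r1 where r1: "r1 > 0" "\<And>y. dist y x < r1 \<Longrightarrow> dist (H u v y) (H u v x) < e / 2"
      using \<open>isCont (H u v) x\<close> e unfolding continuous_at_eps_delta
      by (metis dist_commute half_gt_zero)
    obtain r2 where r2: "r2 > 0" "\<And>y. dist y x < r2 \<Longrightarrow> dist (H v u y) (H v u x) < e / 2"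
      using \<open>isCont (H v u) x\<close> e unfolding continuous_at_eps_delta
      by (metis dist_commute half_gt_zero)
    define r where "r = min R (min r1 r2)"
    have r: "r > 0" "ball x r \<subseteq> S" using R r1 r2 by (auto simp: r_def)
    \<comment> \<open>Adding 1 keeps the step size defined when both directions are zero.\<close>
    define h where "h = r / (norm u + norm v + 1)"
    have np: "norm u + norm v + 1 > 0" by (simp add: add_nonneg_pos)
    have h: "h > 0" using r np by (simp add: h_def)
    have "h * (norm u + norm v + 1) = r" using np by (simp add: h_def)
    then have hr: "h * (norm u + norm v) < r" using h by (simp add: algebra_simps)
    obtain y where y: "y \<in> ball x r"
      "F (x + h *\<^sub>R u + h *\<^sub>R v) - F (x + h *\<^sub>R u) - (F (x + h *\<^sub>R v) - F x) = h * (h * H u v y)"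
      using second_difference_mean_value[OF r(2) h hr d1 d2] unfolding H_def by blast
    obtain z where z: "z \<in> ball x r"
      "F (x + h *\<^sub>R v + h *\<^sub>R u) - F (x + h *\<^sub>R v) - (F (x + h *\<^sub>R u) - F x) = h * (h * H v u z)"
      using second_difference_mean_value[OF r(2) h _ d1 d2, of v u] hr
      unfolding H_def by (auto simp: add.commute)
    have "h * (h * H u v y) = h * (h * H v u z)"
      using y(2) z(2) by (simp only: add.assoc add.commute[of "h *\<^sub>R v"])
    then have "H u v y = H v u z" using h by simp
    moreover have "dist (H u v y) (H u v x) < e / 2" "dist (H v u z) (H v u x) < e / 2"
      using r1(2)[of y] r2(2)[of z] y(1) z(1) by (auto simp: r_def dist_commute)
    ultimately show ?thesis unfolding dist_real_def by linarith
  qed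
  have "\<bar>H u v x - H v u x\<bar> \<le> 0"
    by (rule field_le_epsilon) (simp add: small)
  then show ?thesis by (simp add: H_def)
qed

lemma frechet_derivative_inner:
  assumes "F differentiable (at x)"
  shows "frechet_derivative (\<lambda>y. F y \<bullet> b) (at x) u = frechet_derivative F (at x) u \<bullet> b"
  using frechet_derivative_at[OF has_derivative_inner_left[OF assms[unfolded frechet_derivative_works]]]
  by (simp add: fun_eq_iff)

lemma symmetric_second_derivative:
  fixes F :: "'a::real_normed_vector \<Rightarrow> 'b::euclidean_space"
  assumes S: "open S" "x \<in> S" and F: "smooth_on S F"
  shows "frechet_derivative (\<lambda>y. frechet_derivative F (at y) u) (at x) v =
         frechet_derivative (\<lambda>y. frechet_derivative F (at y) v) (at x) u"
proof (rule euclidean_eqI)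
  fix b :: 'b
  assume "b \<in> Basis"
  have Fb: "smooth_on S (\<lambda>y. F y \<bullet> b)"
    by (rule smooth_on_bounded_linear_compose[OF S(1) bounded_linear_inner_left F])
  have *: "frechet_derivative (\<lambda>y. frechet_derivative (\<lambda>y. F y \<bullet> b) (at y) u) (at x) v =
      frechet_derivative (\<lambda>y. frechet_derivative F (at y) u) (at x) v \<bullet> b" for u v
  proof -
    have "((\<lambda>y. frechet_derivative (\<lambda>y. F y \<bullet> b) (at y) u) has_derivative
        (\<lambda>v. frechet_derivative (\<lambda>y. frechet_derivative F (at y) u) (at x) v \<bullet> b)) (at x)"
      by (rule has_derivative_transform_within_open[OF has_derivative_inner_left[OF
            smooth_on_has_derivative[OF smooth_on_derivative[OF F] S(2)]] S])
         (simp add: frechet_derivative_inner[OF smooth_on_differentiable[OF F]])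
    from frechet_derivative_at[OF this] show ?thesis by (simp add: fun_eq_iff)
  qed
  show "frechet_derivative (\<lambda>y. frechet_derivative F (at y) u) (at x) v \<bullet> b =
         frechet_derivative (\<lambda>y. frechet_derivative F (at y) v) (at x) u \<bullet> b"
    using symmetric_second_derivative_real[OF S Fb, of u v] by (simp add: *)
qed


section \<open>One-forms on open subsets of Euclidean space\<close>

text \<open>The coordinate expression of the exterior derivative: \<open>\<omega> y v\<close> is the value at \<open>y\<close> of the form \<open>\<omega>\<close> on the vector \<open>v\<close>.\<close>

definition form_deriv ::
    "('a::euclidean_space \<Rightarrow> 'a \<Rightarrow> real) \<Rightarrow> 'a \<Rightarrow> 'a \<Rightarrow> 'a \<Rightarrow> real" where
  "form_deriv \<omega> x u v =
     frechet_derivative (\<lambda>y. \<omega> y v) (at x) u - frechet_derivative (\<lambda>y. \<omega> y u) (at x) v"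

lemma form_deriv_cong:
  assumes "open S" "x \<in> S" "\<And>y w. y \<in> S \<Longrightarrow> \<omega> y w = \<omega>' y w" "\<And>w. (\<lambda>y. \<omega> y w) differentiable (at x)"
  shows "form_deriv \<omega> x u v = form_deriv \<omega>' x u v"
proof -
  have "frechet_derivative (\<lambda>y. \<omega> y w) (at x) = frechet_derivative (\<lambda>y. \<omega>' y w) (at x)" for w
    using has_derivative_transform_within_open[OF assms(4)[unfolded frechet_derivative_works] assms(1,2),
        of w "\<lambda>y. \<omega>' y w"] assms(3) frechet_derivative_at by metis
  then show ?thesis by (simp add: form_deriv_def)
qed

text \<open>The derivative of the pulled back form contains one term in which the map is differentiated twice. It is symmetric in
  the two directions and drops out of the antisymmetrization.\<close>

lemma form_deriv_pullback:
  fixes \<phi> :: "'a::euclidean_space \<Rightarrow> 'b::euclidean_space"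
  assumes S: "open S" "x \<in> S" and T: "open T" "\<phi> ` S \<subseteq> T" and \<phi>: "smooth_on S \<phi>"
    and lin: "\<And>y. y \<in> T \<Longrightarrow> linear (\<omega> y)" and \<omega>: "\<And>w. smooth_on T (\<lambda>y. \<omega> y w)"
  shows "form_deriv (\<lambda>y w. \<omega> (\<phi> y) (frechet_derivative \<phi> (at y) w)) x u v =
         form_deriv \<omega> (\<phi> x) (frechet_derivative \<phi> (at x) u) (frechet_derivative \<phi> (at x) v)"
proof -
  define D where "D = (\<lambda>y. frechet_derivative \<phi> (at y))"
  have Tx: "\<phi> x \<in> T" using S T by auto
  have d\<phi>: "(\<phi> has_derivative D x) (at x)"
    unfolding D_def by (rule smooth_on_has_derivative[OF \<phi> S(2)])
  have dc: "((\<lambda>y. \<omega> (\<phi> y) b) has_derivative (\<lambda>u. frechet_derivative (\<lambda>z. \<omega> z b) (at (\<phi> x)) (D x u))) (at x)" for b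
    by (rule has_derivative_compose[OF d\<phi> smooth_on_has_derivative[OF \<omega> Tx]])
  have "((\<lambda>y. \<omega> (\<phi> y) (D y w)) has_derivative
      (\<lambda>u. frechet_derivative (\<lambda>y. \<omega> (\<phi> y) (D x w)) (at x) u
        + \<omega> (\<phi> x) (frechet_derivative (\<lambda>y. D y w) (at x) u))) (at x)" for w
  proof (rule has_derivative_linear_family[OF S, where M="\<lambda>y. \<omega> (\<phi> y)"])
    show "linear (\<omega> (\<phi> y))" if "y \<in> S" for y using lin that T by auto
    show "(\<lambda>y. \<omega> (\<phi> y) b) differentiable at x" for b using dc by (auto simp: differentiable_def)
    show "((\<lambda>y. D y w) has_derivative frechet_derivative (\<lambda>y. D y w) (at x)) (at x)"
      unfolding D_def by (rule smooth_on_has_derivative[OF smooth_on_derivative[OF \<phi>] S(2)])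
  qed
  from frechet_derivative_at[OF this, symmetric]
  have "frechet_derivative (\<lambda>y. \<omega> (\<phi> y) (D y w)) (at x) u =
      frechet_derivative (\<lambda>z. \<omega> z (D x w)) (at (\<phi> x)) (D x u)
        + \<omega> (\<phi> x) (frechet_derivative (\<lambda>y. D y w) (at x) u)" for w u
    by (simp add: frechet_derivative_at[OF dc, symmetric])
  moreover have "frechet_derivative (\<lambda>y. D y v) (at x) u = frechet_derivative (\<lambda>y. D y u) (at x) v"
    unfolding D_def by (rule symmetric_second_derivative[OF S \<phi>])
  ultimately show ?thesis by (simp add: form_deriv_def D_def)
qed

lemma form_deriv_bilinear:
  assumes S: "open S" "x \<in> S" and lin: "\<And>y. y \<in> S \<Longrightarrow> linear (\<omega> y)"
    and \<omega>: "\<And>w. (\<lambda>y. \<omega> y w) differentiable (at x)"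
  shows "bilinear (form_deriv \<omega> x)"
proof -
  have 1: "linear (\<lambda>u. frechet_derivative (\<lambda>y. \<omega> y v) (at x) u)" for v
    using \<omega>[of v] linear_frechet_derivative by blast
  have 2: "linear (\<lambda>v. frechet_derivative (\<lambda>y. \<omega> y v) (at x) u)" for u
    by (rule linear_frechet_derivative_family[OF S lin \<omega>])
  show ?thesis
    unfolding bilinear_def form_deriv_def by (intro conjI allI linear_compose_sub 1 2)
qed

text \<open>The Poincare lemma: the potential is the integral of the form along the segments from the centre. Differentiating
  under the integral sign and using that the form is closed, the integrand becomes the derivative of
  \<open>t \<mapsto> t \<omega>(p + t (x - p)) v\<close>, where \<open>p\<close> is the centre.\<close>

lemma closed_form_exact_on_ball:
  fixes \<omega> :: "'a::euclidean_space \<Rightarrow> 'a \<Rightarrow> real"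
  assumes r: "r > 0" and lin: "\<And>y. y \<in> ball p r \<Longrightarrow> linear (\<omega> y)"
    and \<omega>: "\<And>w. smooth_on (ball p r) (\<lambda>y. \<omega> y w)"
    and closed: "\<And>y u v. y \<in> ball p r \<Longrightarrow> form_deriv \<omega> y u v = 0"
  obtains h where "\<And>x. x \<in> ball p r \<Longrightarrow> (h has_derivative \<omega> x) (at x)"
proof
  let ?U = "ball p r"
  define P where "P = (\<lambda>x t. p + t *\<^sub>R (x - p))"
  define f where "f = (\<lambda>x t. \<omega> (P x t) (x - p))"
  define f' where "f' = (\<lambda>x t v. t * frechet_derivative (\<lambda>y. \<omega> y (x - p)) (at (P x t)) v + \<omega> (P x t) v)"
  have P: "P x t \<in> ?U" if "x \<in> ?U" "t \<in> cbox 0 1" for x t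
  proof -
    have "norm (t *\<^sub>R (x - p)) \<le> norm (x - p)"
      using that by (simp add: mult_left_le_one_le)
    then show ?thesis using that by (simp add: P_def dist_norm norm_minus_commute)
  qed
  have dP: "((\<lambda>x. P x t) has_derivative (\<lambda>v. t *\<^sub>R v)) (at x)" for x t
    unfolding P_def by (auto intro!: derivative_eq_intros)
  have df: "((\<lambda>x. f x t) has_derivative f' x t) (at x)" if x: "x \<in> ?U" and t: "t \<in> cbox 0 1" for x t
  proof -
    have dc: "((\<lambda>y. \<omega> (P y t) b) has_derivative (\<lambda>v. frechet_derivative (\<lambda>z. \<omega> z b) (at (P x t)) (t *\<^sub>R v))) (at x)" for b
      by (rule has_derivative_compose[OF dP smooth_on_has_derivative[OF \<omega> P[OF that]]])
    have "((\<lambda>y. \<omega> (P y t) (y - p)) has_derivative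
      (\<lambda>v. frechet_derivative (\<lambda>y. \<omega> (P y t) (x - p)) (at x) v + \<omega> (P x t) v)) (at x)"
    proof (rule has_derivative_linear_family[OF open_ball x, where M="\<lambda>y. \<omega> (P y t)"])
      show "linear (\<omega> (P y t))" if "y \<in> ?U" for y using lin P that t by blast
      show "(\<lambda>y. \<omega> (P y t) b) differentiable at x" for b using dc by (auto simp: differentiable_def)
    qed (auto intro!: derivative_eq_intros)
    then show ?thesis
      unfolding f_def f'_def
      by (simp add: frechet_derivative_at[OF dc, symmetric]
          linear_cmul[OF smooth_on_linear_derivative[OF \<omega> P[OF that]]])
  qed
  have contP: "continuous_on (?U \<times> cbox 0 1) (\<lambda>z. P (fst z) (snd z))"
    unfolding P_def by (intro continuous_intros)
  have imP: "(\<lambda>z. P (fst z) (snd z)) ` (?U \<times> cbox 0 1) \<subseteq> ?U"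
    using P by auto
  have cont\<omega>: "continuous_on (?U \<times> cbox 0 1) (\<lambda>z. \<omega> (P (fst z) (snd z)) b)" for b
    by (rule continuous_on_compose2[OF smooth_on_continuous[OF \<omega>] contP imP])
  have contd: "continuous_on (?U \<times> cbox 0 1) (\<lambda>z. frechet_derivative (\<lambda>y. \<omega> y c) (at (P (fst z) (snd z))) b)" for b c
    by (rule continuous_on_compose2[OF smooth_on_continuous[OF smooth_on_derivative[OF \<omega>]] contP imP])
  have lin_d: "linear (\<lambda>c. frechet_derivative (\<lambda>y. \<omega> y c) (at y) b)" if "y \<in> ?U" for y b
    by (rule linear_frechet_derivative_family[OF open_ball that lin smooth_on_differentiable[OF \<omega> that]])
  have contf': "continuous_on (?U \<times> cbox 0 1) (\<lambda>z. f' (fst z) (snd z) b)" for b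
  proof -
    have "continuous_on (?U \<times> cbox 0 1) (\<lambda>z. \<Sum>c\<in>Basis. ((fst z - p) \<bullet> c) *\<^sub>R
        frechet_derivative (\<lambda>y. \<omega> y c) (at (P (fst z) (snd z))) b)"
      by (intro continuous_intros contd)
    moreover have "(\<Sum>c\<in>Basis. ((fst z - p) \<bullet> c) *\<^sub>R
        frechet_derivative (\<lambda>y. \<omega> y c) (at (P (fst z) (snd z))) b) =
        frechet_derivative (\<lambda>y. \<omega> y (fst z - p)) (at (P (fst z) (snd z))) b"
      if "z \<in> ?U \<times> cbox 0 1" for z
      by (rule linear_expand_basis[OF lin_d, symmetric]) (use P that in auto)
    ultimately have "continuous_on (?U \<times> cbox 0 1)
        (\<lambda>z. frechet_derivative (\<lambda>y. \<omega> y (fst z - p)) (at (P (fst z) (snd z))) b)"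
      using continuous_on_cong by (metis (no_types, lifting))
    then show ?thesis unfolding f'_def by (intro continuous_intros cont\<omega>)
  qed
  have bl: "blinfun_apply (Blinfun (f' x t)) = f' x t" if "x \<in> ?U" "t \<in> cbox 0 1" for x t
    using has_derivative_bounded_linear[OF df[OF that]] by (rule bounded_linear_Blinfun_apply)
  have contf: "continuous_on (cbox 0 1) (f x)" if "x \<in> ?U" for x
    unfolding f_def
    by (rule continuous_on_compose2[OF smooth_on_continuous[OF \<omega>]])
       (use P that in \<open>auto simp: P_def intro!: continuous_intros\<close>)
  have contbl: "continuous_on (?U \<times> cbox 0 1) (\<lambda>(x, t). Blinfun (f' x t))"
  proof (rule continuous_on_blinfun_componentwise)
    fix b :: 'a
    have "f' (fst z) (snd z) b = blinfun_apply (case z of (x, t) \<Rightarrow> Blinfun (f' x t)) b"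
      if "z \<in> ?U \<times> cbox 0 1" for z
      using that bl by (cases z) auto
    then show "continuous_on (?U \<times> cbox 0 1) (\<lambda>z. blinfun_apply (case z of (x, t) \<Rightarrow> Blinfun (f' x t)) b)"
      using contf'[of b] continuous_on_cong by (metis (no_types, lifting))
  qed
  fix x
  assume x: "x \<in> ?U"
  have "((\<lambda>x. integral (cbox 0 1) (f x)) has_derivative
      integral (cbox 0 1) (\<lambda>t. Blinfun (f' x t))) (at x within ?U)"
    by (rule leibniz_rule[OF _ integrable_continuous[OF contf] contbl x convex_ball])
       (use df bl in \<open>auto intro: has_derivative_at_withinI\<close>)
  moreover have "blinfun_apply (integral (cbox 0 1) (\<lambda>t. Blinfun (f' x t))) = \<omega> x"
  proof
    fix v
    have cb: "continuous_on (cbox 0 1) (\<lambda>t. Blinfun (f' x t))"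
    proof -
      have 1: "continuous_on (cbox 0 1) (\<lambda>t. (x, t))" by (intro continuous_intros)
      have 2: "(\<lambda>t. (x, t)) ` cbox 0 1 \<subseteq> ?U \<times> cbox 0 1" using x by auto
      from continuous_on_compose2[OF contbl 1 2] show ?thesis by simp
    qed
    have "integral (cbox 0 1) (\<lambda>t. Blinfun (f' x t)) v = integral (cbox 0 1) (\<lambda>t. Blinfun (f' x t) v)"
      by (rule blinfun_apply_integral[OF integrable_continuous[OF cb]])
    also have "\<dots> = integral {0..1} (\<lambda>t. f' x t v)"
      using bl[OF x] by (auto intro!: integral_cong)
    also have "\<dots> = 1 * \<omega> (P x 1) v - 0 * \<omega> (P x 0) v"
    proof (rule integral_unique[OF fundamental_theorem_of_calculus])
      fix t :: real
      assume "t \<in> {0..1}"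
      then have Pt: "P x t \<in> ?U" using P x by auto
      have "((\<lambda>t. P x t) has_derivative (\<lambda>d. d *\<^sub>R (x - p))) (at t)"
        unfolding P_def by (auto intro!: derivative_eq_intros)
      from has_derivative_compose[OF this smooth_on_has_derivative[OF \<omega> Pt]]
      have "((\<lambda>t. \<omega> (P x t) v) has_derivative
          (\<lambda>d. frechet_derivative (\<lambda>y. \<omega> y v) (at (P x t)) (d *\<^sub>R (x - p)))) (at t)" .
      then have "((\<lambda>t. t * \<omega> (P x t) v) has_derivative
          (\<lambda>d. t * frechet_derivative (\<lambda>y. \<omega> y v) (at (P x t)) (d *\<^sub>R (x - p)) + d * \<omega> (P x t) v)) (at t)"
        by (auto intro!: derivative_eq_intros)
      moreover have "frechet_derivative (\<lambda>y. \<omega> y v) (at (P x t)) (x - p) =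
          frechet_derivative (\<lambda>y. \<omega> y (x - p)) (at (P x t)) v"
        using closed[OF Pt, of "x - p" v] by (simp add: form_deriv_def)
      ultimately have "((\<lambda>t. t * \<omega> (P x t) v) has_vector_derivative f' x t v) (at t)"
        unfolding has_vector_derivative_def f'_def
        by (simp add: linear_cmul[OF smooth_on_linear_derivative[OF \<omega> Pt]] distrib_left mult_ac add.commute)
      then show "((\<lambda>t. t * \<omega> (P x t) v) has_vector_derivative f' x t v) (at t within {0..1})"
        by (rule has_vector_derivative_at_within)
    qed simp
    finally show "blinfun_apply (integral (cbox 0 1) (\<lambda>t. Blinfun (f' x t))) v = \<omega> x v"
      by (simp add: P_def)
  qed
  ultimately show "((\<lambda>x. integral (cbox 0 1) (f x)) has_derivative \<omega> x) (at x)"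
    using x by (simp add: at_within_open[OF _ open_ball])
qed


section \<open>Integral curves of vector fields\<close>

text \<open>The partial derivatives are bounded on the compact ball, and their sum bounds the operator norm.\<close>

lemma smooth_on_lipschitz_on_cball:
  fixes X :: "'a::euclidean_space \<Rightarrow> 'b::euclidean_space"
  assumes S: "open S" "cball p r \<subseteq> S" and X: "smooth_on S X"
  obtains L where "L \<ge> 0" "\<And>x y. x \<in> cball p r \<Longrightarrow> y \<in> cball p r \<Longrightarrow> norm (X x - X y) \<le> L * norm (x - y)"
proof -
  define D where "D = (\<lambda>x. frechet_derivative X (at x))"
  have dX: "(X has_derivative D x) (at x)" if "x \<in> cball p r" for x
    unfolding D_def using smooth_on_has_derivative[OF X] S that by auto
  have "bounded ((\<lambda>x. D x b) ` cball p r)" for b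
    unfolding D_def
    by (intro compact_imp_bounded compact_continuous_image compact_cball
        continuous_on_subset[OF smooth_on_continuous[OF smooth_on_derivative[OF X]] S(2)])
  then have "\<exists>K. \<forall>x\<in>cball p r. norm (D x b) \<le> K" for b
    unfolding bounded_iff by auto
  then obtain K where K: "\<And>b x. x \<in> cball p r \<Longrightarrow> norm (D x b) \<le> K b"
    by metis
  define L where "L = (\<Sum>b\<in>Basis. \<bar>K b\<bar>)"
  have "onorm (D x) \<le> L" if x: "x \<in> cball p r" for x
  proof (rule onorm_le)
    fix v :: 'a
    have "D x v = (\<Sum>b\<in>Basis. (v \<bullet> b) *\<^sub>R D x b)"
      by (rule linear_expand_basis[OF has_derivative_linear[OF dX[OF x]]])
    also have "norm \<dots> \<le> (\<Sum>b\<in>Basis. norm v * \<bar>K b\<bar>)"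
    proof (rule order_trans[OF norm_sum sum_mono])
      fix b :: 'a
      assume b: "b \<in> Basis"
      show "norm ((v \<bullet> b) *\<^sub>R D x b) \<le> norm v * \<bar>K b\<bar>"
        unfolding norm_scaleR
        by (rule mult_mono) (use Basis_le_norm[OF b, of v] K[OF x, of b] in auto)
    qed
    finally show "norm (D x v) \<le> L * norm v" by (simp add: L_def sum_distrib_left mult.commute)
  qed
  then have "norm (X x - X y) \<le> L * norm (x - y)" if "x \<in> cball p r" "y \<in> cball p r" for x y
    using differentiable_bound[OF convex_cball, of p r X D L x y] dX that has_derivative_at_withinI by blast
  moreover have "L \<ge> 0" by (simp add: L_def sum_nonneg)
  ultimately show ?thesis using that by blast
qed

text \<open>The Picard operator is a contraction on the space of all bounded continuous functions on the real line,
  once the vector field has been made globally Lipschitz and bounded, by composing it with the nearest point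
  projection to a ball, and time has been clamped to a short interval. Its fixed point stays in the ball during this
  interval, where the modified vector field is the given one.\<close>

lemma picard_lindelof:
  fixes X :: "'a::euclidean_space \<Rightarrow> 'a"
  assumes S: "open S" "p \<in> S" and X: "smooth_on S X"
  obtains \<tau> u where "\<tau> > 0" "u 0 = p"
    "\<And>t. t \<in> {-\<tau><..<\<tau>} \<Longrightarrow> u t \<in> S"
    "\<And>t. t \<in> {-\<tau><..<\<tau>} \<Longrightarrow> (u has_vector_derivative X (u t)) (at t)"
proof -
  obtain r where r: "r > 0" "cball p r \<subseteq> S" using S open_contains_cball by blast
  let ?C = "cball p r"
  have C: "convex ?C" "closed ?C" "?C \<noteq> {}" using r by auto
  obtain L where L: "L \<ge> 0" "\<And>x y. x \<in> ?C \<Longrightarrow> y \<in> ?C \<Longrightarrow> norm (X x - X y) \<le> L * norm (x - y)"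
    using smooth_on_lipschitz_on_cball[OF S(1) r(2) X] by blast
  have "bounded (X ` ?C)"
    by (intro compact_imp_bounded compact_continuous_image compact_cball
        continuous_on_subset[OF smooth_on_continuous[OF X] r(2)])
  then obtain K where K: "K > 0" "\<And>x. x \<in> ?C \<Longrightarrow> norm (X x) \<le> K"
    unfolding bounded_pos by auto
  define Y where "Y = (\<lambda>x. X (closest_point ?C x))"
  have cp: "closest_point ?C x \<in> ?C" for x by (rule closest_point_in_set[OF C(2,3)])
  have YK: "norm (Y x) \<le> K" for x unfolding Y_def by (rule K(2)[OF cp])
  have YL: "norm (Y x - Y y) \<le> L * norm (x - y)" for x y
  proof -
    have "norm (Y x - Y y) \<le> L * norm (closest_point ?C x - closest_point ?C y)"
      unfolding Y_def by (rule L(2)[OF cp cp])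
    also have "\<dots> \<le> L * norm (x - y)"
      using closest_point_lipschitz[OF C, of x y] L(1) by (intro mult_left_mono) (auto simp: dist_norm)
    finally show ?thesis .
  qed
  have contY: "continuous_on T Y" for T
  proof (rule continuous_on_subset[of UNIV])
    show "continuous_on UNIV Y"
      unfolding Y_def
      by (rule continuous_on_compose2[OF continuous_on_subset[OF smooth_on_continuous[OF X] r(2)]
            continuous_on_closest_point[OF C]]) (use cp in auto)
  qed simp
  \<comment> \<open>The first bound makes the operator contract by 1/2, the second keeps its values in the ball.\<close>
  define \<tau> where "\<tau> = min (1 / (8 * (L + 1))) (r / (4 * K))"
  have \<tau>: "\<tau> > 0" using r K L by (simp add: \<tau>_def)
  have \<tau>L: "4 * \<tau> * L \<le> 1/2"
  proof -
    have "\<tau> * (8 * (L + 1)) \<le> 1 / (8 * (L + 1)) * (8 * (L + 1))"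
      by (rule mult_right_mono) (use L in \<open>auto simp: \<tau>_def\<close>)
    then have "\<tau> * (8 * (L + 1)) \<le> 1" using L by simp
    then show ?thesis using \<tau> by (simp add: algebra_simps)
  qed
  have \<tau>K: "4 * \<tau> * K \<le> r"
  proof -
    have "\<tau> * (4 * K) \<le> r / (4 * K) * (4 * K)"
      by (rule mult_right_mono) (use K in \<open>auto simp: \<tau>_def\<close>)
    then show ?thesis using K by (simp add: mult_ac)
  qed
  define clamp' where "clamp' = (\<lambda>t. max (-\<tau>) (min t \<tau>))"
  have cl: "clamp' t \<in> {-\<tau>..\<tau>}" for t using \<tau> by (auto simp: clamp'_def)
  have contcl: "continuous_on T clamp'" for T unfolding clamp'_def by (intro continuous_intros)
  \<comment> \<open>Integrating from the left end of the interval and subtracting the value at 0 avoids oriented integrals. The price is a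
    factor 2 in the estimates.\<close>
  define I where "I = (\<lambda>u t. integral {-\<tau>..t} (\<lambda>s. Y (u s)))"
  define P where "P = (\<lambda>u t. p + (I u (clamp' t) - I u 0))"
  have contYu: "continuous_on T (\<lambda>s. Y (u s))" if "continuous_on UNIV u" for T and u :: "real \<Rightarrow> 'a"
    by (rule continuous_on_compose2[OF contY[of UNIV]]) (use that in \<open>auto intro: continuous_on_subset\<close>)
  have Ib: "norm (I u t) \<le> 2 * \<tau> * K" if "continuous_on UNIV u" "t \<in> {-\<tau>..\<tau>}" for u t
  proof -
    have "norm (I u t) \<le> K * (t - - \<tau>)"
      unfolding I_def by (rule integral_bound) (use that contYu YK in auto)
    also have "\<dots> \<le> K * (2 * \<tau>)" using that K by (intro mult_left_mono) auto
    finally show ?thesis by (simp add: mult_ac)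
  qed
  have Id: "(I u has_vector_derivative Y (u t)) (at t within {-\<tau>..\<tau>})"
    if "continuous_on UNIV u" "t \<in> {-\<tau>..\<tau>}" for u t
    unfolding I_def by (rule integral_has_vector_derivative) (use that contYu in auto)
  have Ic: "continuous_on {-\<tau>..\<tau>} (I u)" if "continuous_on UNIV u" for u
    using has_vector_derivative_continuous[OF Id[OF that]] by (auto simp: continuous_on_eq_continuous_within)
  have Pc: "continuous_on UNIV (P u)" if "continuous_on UNIV u" for u
    unfolding P_def
    by (intro continuous_intros continuous_on_compose2[OF Ic[OF that] contcl]) (use cl in auto)
  have Pb: "norm (P u t - p) \<le> r" if "continuous_on UNIV u" for u t
  proof -
    have "norm (P u t - p) \<le> norm (I u (clamp' t)) + norm (I u 0)"
      unfolding P_def using norm_triangle_ineq4 by simp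
    also have "\<dots> \<le> 2 * \<tau> * K + 2 * \<tau> * K"
      using Ib[OF that cl[of t]] Ib[OF that, of 0] \<tau> by (intro add_mono) auto
    finally show ?thesis using \<tau>K by (simp add: mult_ac)
  qed
  have Pbc: "P u \<in> bcontfun" if "continuous_on UNIV u" for u
  proof (rule bcontfun_normI[OF Pc[OF that]])
    show "norm (P u t) \<le> norm p + r" for t
      using Pb[OF that, of t] norm_triangle_sub[of "P u t" p] by linarith
  qed
  define \<Phi> where "\<Phi> = (\<lambda>u :: real \<Rightarrow>\<^sub>C 'a. Bcontfun (P u))"
  have \<Phi>: "apply_bcontfun (\<Phi> u) = P u" for u
    unfolding \<Phi>_def by (rule Bcontfun_inverse[OF Pbc]) simp
  have Idiff: "norm (I u t - I v t) \<le> 2 * \<tau> * (L * dist u v)" if "t \<in> {-\<tau>..\<tau>}" for u v :: "real \<Rightarrow>\<^sub>C 'a" and t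
  proof -
    have c: "continuous_on T (\<lambda>s. Y (apply_bcontfun w s))" for w :: "real \<Rightarrow>\<^sub>C 'a" and T
      by (rule contYu) simp
    have "I u t - I v t = integral {-\<tau>..t} (\<lambda>s. Y (u s) - Y (v s))"
      unfolding I_def by (rule integral_diff[symmetric]; rule integrable_continuous_real; rule c)
    also have "norm \<dots> \<le> (L * dist u v) * (t - - \<tau>)"
    proof (rule integral_bound)
      show "norm (Y (u s) - Y (v s)) \<le> L * dist u v" for s
        using YL[of "u s" "v s"] mult_left_mono[OF dist_bounded[of u s v] L(1)]
        by (simp add: dist_norm)
    qed (use that c in \<open>auto intro!: continuous_intros\<close>)
    also have "\<dots> \<le> (L * dist u v) * (2 * \<tau>)"
      using that L(1) by (intro mult_left_mono) auto
    finally show ?thesis by (simp add: mult_ac)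
  qed
  have "dist (\<Phi> u) (\<Phi> v) \<le> 1/2 * dist u v" for u v
  proof (rule dist_bound)
    fix t
    have "dist (\<Phi> u t) (\<Phi> v t) = norm ((I u (clamp' t) - I v (clamp' t)) - (I u 0 - I v 0))"
      by (simp add: \<Phi> P_def dist_norm algebra_simps)
    also have "\<dots> \<le> norm (I u (clamp' t) - I v (clamp' t)) + norm (I u 0 - I v 0)"
      by (rule norm_triangle_ineq4)
    also have "\<dots> \<le> 2 * \<tau> * (L * dist u v) + 2 * \<tau> * (L * dist u v)"
      using \<tau> by (intro add_mono Idiff cl) auto
    also have "\<dots> = (4 * \<tau> * L) * dist u v" by simp
    also have "\<dots> \<le> 1/2 * dist u v" by (rule mult_right_mono[OF \<tau>L]) simp
    finally show "dist (\<Phi> u t) (\<Phi> v t) \<le> 1/2 * dist u v" .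
  qed
  then obtain U where U: "\<Phi> U = U"
    using banach_fix_type[of "1/2" \<Phi>] by auto
  define u where "u = apply_bcontfun U"
  have uc: "continuous_on UNIV u" by (simp add: u_def)
  have uP: "u = P u" using \<Phi>[of U] U by (simp add: u_def)
  have uC: "u t \<in> ?C" for t using Pb[OF uc, of t] uP by (metis dist_norm mem_cball dist_commute)
  have Yu: "Y (u t) = X (u t)" for t unfolding Y_def using closest_point_self[OF uC] by simp
  show ?thesis
  proof
    show "\<tau> > 0" by (rule \<tau>)
    show "u 0 = p" using \<tau> by (subst uP) (simp add: P_def clamp'_def)
    fix t
    assume t: "t \<in> {-\<tau><..<\<tau>}"
    show "u t \<in> S" using uC r by auto
    have "(I u has_vector_derivative Y (u t)) (at t)"
      using has_vector_derivative_within_subset[OF Id[OF uc, of t] greaterThanLessThan_subseteq_atLeastAtMost_iff[THEN iffD2]]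
        has_vector_derivative_within_open[OF t open_greaterThanLessThan] t by auto
    then have "((\<lambda>t. p + (I u t - I u 0)) has_vector_derivative Y (u t)) (at t)"
      by (auto intro!: derivative_eq_intros)
    then have "(u has_vector_derivative Y (u t)) (at t)"
    proof (rule has_vector_derivative_transform_within_open[OF _ open_greaterThanLessThan t])
      show "p + (I u s - I u 0) = u s" if "s \<in> {-\<tau><..<\<tau>}" for s
        using that by (subst (3) uP) (auto simp: P_def clamp'_def)
    qed
    then show "(u has_vector_derivative X (u t)) (at t)" by (simp add: Yu)
  qed
qed

text \<open>Bootstrapping: the velocity is the vector field along the curve, hence as often differentiable as the curve.\<close>

lemma smooth_integral_curve:
  fixes X :: "'a::euclidean_space \<Rightarrow> 'a"
  assumes S: "open S" and T: "open T" and X: "smooth_on S X"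
    and u: "\<And>t. t \<in> T \<Longrightarrow> u t \<in> S" "\<And>t. t \<in> T \<Longrightarrow> (u has_vector_derivative X (u t)) (at t)"
  shows "smooth_on T u"
proof -
  have "Ck_on k T u" for k
  proof (induction k)
    case 0
    show ?case using has_vector_derivative_continuous[OF u(2)]
      by (auto intro!: continuous_at_imp_continuous_on)
  next
    case (Suc k)
    have "Ck_on k T (\<lambda>t. X (u t))"
      by (rule Ck_on_compose[OF T S _ Suc]) (use u X in \<open>auto simp: smooth_on_def\<close>)
    then have "Ck_on k T (\<lambda>t. d *\<^sub>R X (u t))" for d
      by (rule Ck_on_bounded_linear_compose[OF T bounded_linear_scaleR_right])
    from Ck_on_SucI[OF T u(2)[unfolded has_vector_derivative_def] this]
    show ?case by simp
  qed
  then show ?thesis by (simp add: smooth_on_def)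
qed


section \<open>The Levi-Civita connection in coordinates\<close>

definition inner_form :: "('a::real_vector \<Rightarrow> 'a \<Rightarrow> real) \<Rightarrow> bool" where
  "inner_form G \<longleftrightarrow> bilinear G \<and> (\<forall>u v. G u v = G v u) \<and> (\<forall>u. u \<noteq> 0 \<longrightarrow> G u u > 0)"

lemma inner_form_bilinear: "inner_form G \<Longrightarrow> bilinear G"
  by (simp add: inner_form_def)

lemma inner_form_commute: "inner_form G \<Longrightarrow> G u v = G v u"
  unfolding inner_form_def by blast

lemma inner_form_linear: "inner_form G \<Longrightarrow> linear (G u)"
  unfolding inner_form_def bilinear_def by blast

lemma inner_form_eq_0: "inner_form G \<Longrightarrow> G u u = 0 \<Longrightarrow> u = 0"
  unfolding inner_form_def by (metis less_irrefl)

lemma inner_form_eqI: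
  assumes "inner_form G" "\<And>w. G u w = G v w"
  shows "u = v"
proof -
  have "G (u - v) (u - v) = 0"
    using assms by (simp add: bilinear_lsub[OF inner_form_bilinear])
  then show ?thesis using inner_form_eq_0[OF assms(1)] by force
qed

lemma inner_form_pullback:
  assumes "inner_form G" "linear L" "inj L"
  shows "inner_form (\<lambda>u v. G (L u) (L v))"
  unfolding inner_form_def
proof (intro conjI allI impI)
  note b = inner_form_bilinear[OF assms(1)]
  show "bilinear (\<lambda>u v. G (L u) (L v))"
    unfolding bilinear_def
    by (auto intro!: linearI simp: linear_add[OF assms(2)] linear_cmul[OF assms(2)]
        bilinear_ladd[OF b] bilinear_radd[OF b] bilinear_lmul[OF b] bilinear_rmul[OF b])
  show "G (L u) (L v) = G (L v) (L u)" for u v by (rule inner_form_commute[OF assms(1)])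
  show "G (L u) (L u) > 0" if "u \<noteq> 0" for u
  proof -
    have "L u \<noteq> 0" using that assms(2,3) by (metis linear_0 injD)
    then show ?thesis using assms(1) by (simp add: inner_form_def)
  qed
qed

definition gram :: "('a::euclidean_space \<Rightarrow> 'a \<Rightarrow> real) \<Rightarrow> 'a \<Rightarrow> 'a" where
  "gram G z = (\<Sum>b\<in>Basis. G z b *\<^sub>R b)"

lemma inner_gram:
  assumes "linear (G z)"
  shows "gram G z \<bullet> w = G z w"
  unfolding gram_def inner_sum_left
  by (subst linear_expand_basis[OF assms, of w]) (simp add: inner_commute mult.commute)

lemma linear_gram: "bilinear G \<Longrightarrow> linear (gram G)"
  unfolding gram_def
  by (rule linearI)
     (simp_all add: bilinear_ladd bilinear_lmul scaleR_left_distrib sum.distrib scaleR_sum_right)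

lemma inj_gram:
  assumes "inner_form G"
  shows "inj (gram G)"
proof (rule injI)
  fix u v
  assume "gram G u = gram G v"
  then have "gram G u \<bullet> w = gram G v \<bullet> w" for w by simp
  then show "u = v"
    unfolding inner_gram[OF inner_form_linear[OF assms]] by (rule inner_form_eqI[OF assms])
qed

lemma surj_gram: "inner_form G \<Longrightarrow> surj (gram G)"
  using linear_injective_imp_surjective[OF linear_gram[OF inner_form_bilinear] inj_gram] by simp

text \<open>The Gram matrix is injective, hence surjective.\<close>

lemma inner_form_riesz:
  fixes G :: "'a::euclidean_space \<Rightarrow> 'a \<Rightarrow> real"
  assumes G: "inner_form G" and l: "linear l"
  obtains z where "\<And>w. G z w = l w"
proof -
  obtain z where z: "gram G z = (\<Sum>b\<in>Basis. l b *\<^sub>R b)" using surj_gram[OF G] by (metis surjD)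
  have "G z w = l w" for w
  proof -
    have "G z w = (\<Sum>b\<in>Basis. l b *\<^sub>R b) \<bullet> w"
      unfolding z[symmetric] by (rule inner_gram[OF inner_form_linear[OF G], symmetric])
    also have "\<dots> = l w"
      unfolding inner_sum_left
      by (subst linear_expand_basis[OF l, of w]) (simp add: inner_commute mult.commute)
    finally show ?thesis .
  qed
  then show ?thesis using that by blast
qed

text \<open>The vectors representing a smooth family of functionals are obtained by inverting the Gram matrices, which preserves
  smoothness. This gives the smoothness of the Reeb field and of local unit normals.\<close>

lemma smooth_on_riesz:
  fixes G :: "'c::euclidean_space \<Rightarrow> 'a::euclidean_space \<Rightarrow> 'a \<Rightarrow> real"
  assumes S: "open S" and G: "\<And>y. y \<in> S \<Longrightarrow> inner_form (G y)"
    and smG: "\<And>u v. smooth_on S (\<lambda>y. G y u v)" and sml: "\<And>w. smooth_on S (\<lambda>y. l y w)"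
    and X: "\<And>y w. y \<in> S \<Longrightarrow> G y (X y) w = l y w"
  shows "smooth_on S X"
proof -
  define N where "N = (\<lambda>y. inv (gram (G y)))"
  have lin: "linear (gram (G y))" if "y \<in> S" for y
    by (rule linear_gram[OF inner_form_bilinear[OF G[OF that]]])
  have NM: "N y (gram (G y) w) = w" if "y \<in> S" for y w
    using inj_gram[OF G[OF that]] by (simp add: N_def)
  have MN: "gram (G y) (N y w) = w" if "y \<in> S" for y w
    using surj_gram[OF G[OF that]] by (simp add: N_def surj_f_inv_f)
  have linN: "linear (N y)" if "y \<in> S" for y
    unfolding N_def by (rule inj_linear_imp_inv_linear[OF lin[OF that] inj_gram[OF G[OF that]]])
  have smM: "smooth_on S (\<lambda>y. gram (G y) b)" for b
    unfolding gram_def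
    by (intro smooth_on_sum[OF S] smooth_on_bilinear[OF S bounded_bilinear_scaleR] smG smooth_on_const[OF S])
  have "smooth_on S (\<lambda>y. N y (\<Sum>b\<in>Basis. l y b *\<^sub>R b))"
  proof (rule smooth_on_linear_family[OF S linN])
    show "smooth_on S (\<lambda>y. N y w)" for w
      by (rule smooth_on_inverse_linear_family[OF S lin linN NM MN smM])
    show "smooth_on S (\<lambda>y. \<Sum>b\<in>Basis. l y b *\<^sub>R b)"
      by (intro smooth_on_sum[OF S] smooth_on_bilinear[OF S bounded_bilinear_scaleR] sml smooth_on_const[OF S])
  qed
  then show ?thesis
  proof (rule smooth_on_cong[OF S, rotated])
    fix y assume y: "y \<in> S"
    have "gram (G y) (X y) = (\<Sum>b\<in>Basis. l y b *\<^sub>R b)"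
      using X[OF y] by (simp add: gram_def)
    then show "N y (\<Sum>b\<in>Basis. l y b *\<^sub>R b) = X y" using NM[OF y] by metis
  qed
qed

text \<open>The defining condition of the connection \<open>christoffel\<close>, for a metric given in coordinates.\<close>

definition levi_civita_at ::
    "('a::euclidean_space \<Rightarrow> 'a \<Rightarrow> 'a \<Rightarrow> real) \<Rightarrow> 'a \<Rightarrow> ('a \<Rightarrow> 'a \<Rightarrow> 'a) \<Rightarrow> bool" where
  "levi_civita_at G x \<Gamma> \<longleftrightarrow> bilinear \<Gamma> \<and> (\<forall>u v. \<Gamma> u v = \<Gamma> v u) \<and>
     (\<forall>u v w. frechet_derivative (\<lambda>y. G y v w) (at x) u = G x (\<Gamma> u v) w + G x v (\<Gamma> u w))"

lemma levi_civita_atD: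
  assumes "levi_civita_at G x \<Gamma>"
  shows "bilinear \<Gamma>" "\<Gamma> u v = \<Gamma> v u"
    "frechet_derivative (\<lambda>y. G y v w) (at x) u = G x (\<Gamma> u v) w + G x v (\<Gamma> u w)"
  using assms unfolding levi_civita_at_def by blast+

text \<open>Cyclically permuting the compatibility condition and using the symmetry of \<open>\<Gamma>\<close> yields the Koszul formula, which determines
  the inner products of \<open>\<Gamma> u v\<close> with all vectors. Conversely, its right hand side \<open>k u v\<close> is a linear functional, and the vector
  representing it defines a connection.\<close>

lemma ex1_levi_civita_at:
  assumes S: "open S" "x \<in> S" and G: "\<And>y. y \<in> S \<Longrightarrow> inner_form (G y)"
    and dG: "\<And>v w. (\<lambda>y. G y v w) differentiable (at x)"
  shows "\<exists>!\<Gamma>. levi_civita_at G x \<Gamma>"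
proof -
  note Gx = G[OF S(2)]
  note b = inner_form_bilinear[OF Gx]
  define d where "d = (\<lambda>u v w. frechet_derivative (\<lambda>y. G y v w) (at x) u)"
  define k where "k = (\<lambda>u v w. (d u v w + d v u w - d w u v) / 2)"
  have d1: "linear (\<lambda>u. d u v w)" for v w
    unfolding d_def using dG linear_frechet_derivative by blast
  have d3: "linear (\<lambda>w. d u v w)" for u v
    unfolding d_def by (rule linear_frechet_derivative_family[OF S inner_form_linear[OF G] dG])
  have dsym: "d u v w = d u w v" for u v w
  proof -
    have "((\<lambda>y. G y v w) has_derivative frechet_derivative (\<lambda>y. G y w v) (at x)) (at x)"
      by (rule has_derivative_transform_within_open[OF dG[unfolded frechet_derivative_works] S])
         (rule inner_form_commute[OF G])
    from frechet_derivative_at[OF this] show ?thesis by (simp add: d_def)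
  qed
  have d2: "linear (\<lambda>v. d u v w)" for u w
    using d3[of u w] by (simp add: dsym[of u _ w])
  have koszul: "G x (\<Gamma> u v) w = k u v w" if "levi_civita_at G x \<Gamma>" for \<Gamma> u v w
  proof -
    have c: "d u v w = G x (\<Gamma> u v) w + G x (\<Gamma> u w) v" for u v w
      using levi_civita_atD(3)[OF that] by (simp add: d_def inner_form_commute[OF Gx, of v])
    have "d u v w + d v u w - d w u v = 2 * G x (\<Gamma> u v) w"
      unfolding c using levi_civita_atD(2)[OF that, of v u] levi_civita_atD(2)[OF that, of w u]
        levi_civita_atD(2)[OF that, of w v] by simp
    then show ?thesis by (simp add: k_def)
  qed
  have "\<exists>z. \<forall>w. G x z w = k u v w" for u v
  proof -
    have "linear (k u v)" unfolding k_def
      using linear_compose_scale_right[OF linear_compose_sub[OF linear_compose_add[OF d3[of u v] d3[of v u]] d1[of u v]], of "1/2"]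
      by simp
    from inner_form_riesz[OF Gx this] show ?thesis by metis
  qed
  then obtain \<Gamma> where \<Gamma>: "\<And>u v w. G x (\<Gamma> u v) w = k u v w" by metis
  have klin: "linear (\<lambda>u. k u v w)" for v w
    unfolding k_def
    using linear_compose_scale_right[OF linear_compose_sub[OF linear_compose_add[OF d1[of v w] d2[of v w]] d2[of w v]], of "1/2"]
    by simp
  have ksym: "k u v w = k v u w" for u v w
    using dsym[of w u v] by (simp add: k_def)
  have \<Gamma>sym: "\<Gamma> u v = \<Gamma> v u" for u v
    by (rule inner_form_eqI[OF Gx]) (simp add: \<Gamma> ksym[of u v])
  have \<Gamma>lin: "linear (\<lambda>u. \<Gamma> u v)" for v
  proof (rule linearI)
    show "\<Gamma> (u + u') v = \<Gamma> u v + \<Gamma> u' v" for u u'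
      by (rule inner_form_eqI[OF Gx]) (simp add: \<Gamma> bilinear_ladd[OF b] linear_add[OF klin])
    show "\<Gamma> (r *\<^sub>R u) v = r *\<^sub>R \<Gamma> u v" for r u
      by (rule inner_form_eqI[OF Gx]) (simp add: \<Gamma> bilinear_lmul[OF b] linear_cmul[OF klin])
  qed
  have "levi_civita_at G x \<Gamma>"
    unfolding levi_civita_at_def
  proof (intro conjI allI)
    show "bilinear \<Gamma>"
      unfolding bilinear_def using \<Gamma>lin by (auto simp: \<Gamma>sym[of _ "_ :: 'a"] intro: \<Gamma>lin)
    show "\<Gamma> u v = \<Gamma> v u" for u v by (rule \<Gamma>sym)
    have "d u v w = k u v w + k u w v" for u v w
      using dsym[of u v w] dsym[of v u w] dsym[of w u v] by (simp add: k_def field_simps)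
    then show "frechet_derivative (\<lambda>y. G y v w) (at x) u = G x (\<Gamma> u v) w + G x v (\<Gamma> u w)" for u v w
      unfolding inner_form_commute[OF Gx, of v "\<Gamma> u w"] \<Gamma> by (simp add: d_def)
  qed
  moreover have "\<Gamma>' = \<Gamma>" if "levi_civita_at G x \<Gamma>'" for \<Gamma>'
    by (intro ext inner_form_eqI[OF Gx]) (simp add: koszul[OF that] \<Gamma>)
  ultimately show ?thesis by blast
qed

text \<open>By compatibility and symmetry of the connection the exterior derivative of the dual form is the antisymmetrized covariant
  derivative of the field. The latter is orthogonal to the field, as this has constant length, so inserting the field leaves
  only its acceleration.\<close>

lemma form_deriv_dual_unit_field:
  assumes S: "open S" "x \<in> S" and G: "\<And>y. y \<in> S \<Longrightarrow> inner_form (G y)"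
    and dG: "\<And>v w. (\<lambda>y. G y v w) differentiable (at x)"
    and \<Gamma>: "levi_civita_at G x \<Gamma>" and X: "(X has_derivative X') (at x)"
    and unit: "\<And>y. y \<in> S \<Longrightarrow> G y (X y) (X y) = 1"
  shows "form_deriv (\<lambda>y w. G y (X y) w) x (X x) v = G x (X' (X x) + \<Gamma> (X x) (X x)) v"
proof -
  note Gx = G[OF S(2)]
  note b = inner_form_bilinear[OF Gx]
  have bil: "bilinear (G y)" if "y \<in> S" for y by (rule inner_form_bilinear[OF G[OF that]])
  define N where "N = (\<lambda>u. X' u + \<Gamma> u (X x))"
  have d: "((\<lambda>y. G y (X y) w) has_derivative (\<lambda>u. G x (N u) w + G x (X x) (\<Gamma> u w))) (at x)" for w
    by (rule has_derivative_eq_rhs[OF has_derivative_bilinear_family[OF S bil dG X has_derivative_const]])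
       (simp_all add: levi_civita_atD(3)[OF \<Gamma>] N_def bilinear_ladd[OF b] bilinear_rzero[OF b] add_ac)
  have "((\<lambda>y. G y (X y) (X y)) has_derivative (\<lambda>u. G x (N u) (X x) + G x (X x) (N u))) (at x)"
    by (rule has_derivative_eq_rhs[OF has_derivative_bilinear_family[OF S bil dG X X]])
       (simp_all add: levi_civita_atD(3)[OF \<Gamma>] N_def bilinear_ladd[OF b] bilinear_radd[OF b] add_ac)
  moreover have "((\<lambda>y. G y (X y) (X y)) has_derivative (\<lambda>u. 0)) (at x)"
    by (rule has_derivative_transform_within_open[OF has_derivative_const S]) (simp add: unit)
  ultimately have "(\<lambda>u. G x (N u) (X x) + G x (X x) (N u)) = (\<lambda>u. 0)"
    by (rule has_derivative_unique)
  then have orth: "G x (N u) (X x) = 0" for u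
    using inner_form_commute[OF Gx, of "X x" "N u"] fun_cong[of _ _ u] by fastforce
  show ?thesis
    unfolding form_deriv_def frechet_derivative_at[OF d, symmetric]
    using levi_civita_atD(2)[OF \<Gamma>, of "X x" v] orth[of v] by (simp add: N_def)
qed


section \<open>Charts, transition maps and differentials\<close>

text \<open>The derivative of a map with respect to arbitrary charts \<open>c\<close> and \<open>d\<close>. The transition maps between charts of a manifold
  are the case \<open>f = id\<close>, so that one chain rule covers transition maps, differentials and their interplay.\<close>

definition map_deriv ::
    "('m, 'a::euclidean_space) chart \<Rightarrow> ('n, 'b::euclidean_space) chart \<Rightarrow> ('m \<Rightarrow> 'n) \<Rightarrow> 'm \<Rightarrow> 'a \<Rightarrow> 'b" where
  "map_deriv c d f p = frechet_derivative (snd d \<circ> f \<circ> chart_inv c) (at (snd c p))"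

lemma to_chart_eq: "to_chart A c p = map_deriv (chart_at A p) c id p"
  by (simp add: to_chart_def map_deriv_def)

lemma from_chart_eq: "from_chart A c p = map_deriv c (chart_at A p) id p"
  by (simp add: from_chart_def map_deriv_def)

lemma differential_eq: "differential A B f p = map_deriv (chart_at A p) (chart_at B (f p)) f p"
  by (simp add: differential_def map_deriv_def)

lemma chart_at_in:
  assumes "smooth_atlas A"
  shows "chart_at A p \<in> A" "p \<in> fst (chart_at A p)"
proof -
  have "\<exists>c. c \<in> A \<and> p \<in> fst c" using assms unfolding smooth_atlas_def by blast
  then have "chart_at A p \<in> A \<and> p \<in> fst (chart_at A p)"
    unfolding chart_at_def by (rule someI_ex)
  then show "chart_at A p \<in> A" "p \<in> fst (chart_at A p)" by auto
qed

lemma atlas_chart: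
  assumes "smooth_atlas A" "c \<in> A"
  shows "open (fst c)" "open (snd c ` fst c)"
    "homeomorphism (fst c) (snd c ` fst c) (snd c) (chart_inv c)"
  using assms unfolding smooth_atlas_def by blast+

lemma chart_inv_chart: "smooth_atlas A \<Longrightarrow> c \<in> A \<Longrightarrow> q \<in> fst c \<Longrightarrow> chart_inv c (snd c q) = q"
  using atlas_chart(3) unfolding homeomorphism_def by blast

lemma chart_chart_inv: "smooth_atlas A \<Longrightarrow> c \<in> A \<Longrightarrow> x \<in> snd c ` fst c \<Longrightarrow> snd c (chart_inv c x) = x"
  using atlas_chart(3) unfolding homeomorphism_def by blast

lemma chart_inv_in: "smooth_atlas A \<Longrightarrow> c \<in> A \<Longrightarrow> x \<in> snd c ` fst c \<Longrightarrow> chart_inv c x \<in> fst c"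
  using atlas_chart(3) unfolding homeomorphism_def by blast

lemma chart_image_iff:
  assumes "smooth_atlas A" "c \<in> A" "V \<subseteq> fst c"
  shows "x \<in> snd c ` V \<longleftrightarrow> x \<in> snd c ` fst c \<and> chart_inv c x \<in> V"
  using assms chart_inv_chart[OF assms(1,2)] chart_chart_inv[OF assms(1,2)]
  by (auto simp: image_iff)

lemma open_chart_image:
  assumes A: "smooth_atlas A" "c \<in> A" and V: "open V" "V \<subseteq> fst c"
  shows "open (snd c ` V)"
proof -
  have "snd c ` V = snd c ` fst c \<inter> chart_inv c -` V"
    using chart_image_iff[OF A V(2)] by auto
  moreover have "continuous_on (snd c ` fst c) (chart_inv c)"
    using atlas_chart(3)[OF A] by (simp add: homeomorphism_def)
  ultimately show ?thesis
    using continuous_open_preimage[OF _ atlas_chart(2)[OF A] V(1)] by simp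
qed

lemma open_chart_vimage:
  assumes A: "smooth_atlas A" "c \<in> A" and V: "open V"
  shows "open (fst c \<inter> snd c -` V)"
  using continuous_open_preimage[OF _ atlas_chart(1)[OF A] V] atlas_chart(3)[OF A]
  by (simp add: homeomorphism_def)

lemma smooth_transition:
  assumes "smooth_atlas A" "c \<in> A" "d \<in> A"
  shows "smooth_on (snd c ` (fst c \<inter> fst d)) (snd d \<circ> id \<circ> chart_inv c)"
  using assms unfolding smooth_atlas_def by simp

lemma smooth_map_on_id: "smooth_atlas A \<Longrightarrow> smooth_map_on A A UNIV id"
  unfolding smooth_map_on_def using smooth_transition by fastforce

definition chart_dom :: "('m, 'a) chart \<Rightarrow> ('n, 'b) chart \<Rightarrow> 'm set \<Rightarrow> ('m \<Rightarrow> 'n) \<Rightarrow> 'm set" where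
  "chart_dom c d U f = U \<inter> fst c \<inter> f -` fst d"

lemma smooth_map_rep:
  "smooth_map_on A B U f \<Longrightarrow> c \<in> A \<Longrightarrow> d \<in> B \<Longrightarrow> smooth_on (snd c ` chart_dom c d U f) (snd d \<circ> f \<circ> chart_inv c)"
  unfolding smooth_map_on_def chart_dom_def by blast

lemma open_chart_dom:
  assumes "smooth_atlas A" "smooth_atlas B" "c \<in> A" "d \<in> B" "open U" "continuous_on U f"
  shows "open (chart_dom c d U f)"
proof -
  have "open (U \<inter> f -` fst d)"
    using continuous_open_preimage[OF assms(6,5)] atlas_chart(1)[OF assms(2,4)] by simp
  then have "open (fst c \<inter> (U \<inter> f -` fst d))" using atlas_chart(1)[OF assms(1,3)] by (rule open_Int[rotated])
  then show ?thesis by (simp add: chart_dom_def Int_ac)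
qed

lemma map_deriv_has_derivative:
  assumes "smooth_map_on A B U f" "c \<in> A" "d \<in> B" "p \<in> chart_dom c d U f"
  shows "((snd d \<circ> f \<circ> chart_inv c) has_derivative map_deriv c d f p) (at (snd c p))"
  unfolding map_deriv_def
  using smooth_on_has_derivative[OF smooth_map_rep[OF assms(1-3)]] assms(4) by blast

lemma map_deriv_compose:
  assumes A: "smooth_atlas A" "c \<in> A" and B: "smooth_atlas B" "d \<in> B" and E: "e \<in> E"
    and f: "smooth_map_on A B U f" "open U" and h: "smooth_map_on B E V h"
    and p: "p \<in> chart_dom c d U f" "f p \<in> chart_dom d e V h"
  shows "map_deriv c e (h \<circ> f) p = map_deriv d e h (f p) \<circ> map_deriv c d f p"
proof -
  note fd = map_deriv_has_derivative[OF f(1) A(2) B(2) p(1)]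
  have cp: "chart_inv c (snd c p) = p"
    using chart_inv_chart[OF A] p by (simp add: chart_dom_def)
  have eq: "(snd d \<circ> f \<circ> chart_inv c) (snd c p) = snd d (f p)" using cp by simp
  have "((snd e \<circ> h \<circ> chart_inv d) has_derivative map_deriv d e h (f p))
      (at ((snd d \<circ> f \<circ> chart_inv c) (snd c p)))"
    unfolding eq by (rule map_deriv_has_derivative[OF h B(2) E p(2)])
  from has_derivative_compose[OF fd this]
  have 1: "((\<lambda>x. (snd e \<circ> h \<circ> chart_inv d) ((snd d \<circ> f \<circ> chart_inv c) x)) has_derivative
      (\<lambda>u. map_deriv d e h (f p) (map_deriv c d f p u))) (at (snd c p))" .
  have op: "open (snd c ` chart_dom c d U f)"
    using open_chart_image[OF A open_chart_dom[OF A(1) B(1) A(2) B(2) f(2)]] f(1)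
    by (auto simp: smooth_map_on_def chart_dom_def)
  have "((snd e \<circ> (h \<circ> f) \<circ> chart_inv c) has_derivative
      (\<lambda>u. map_deriv d e h (f p) (map_deriv c d f p u))) (at (snd c p))"
  proof (rule has_derivative_transform_within_open[OF 1 op])
    show "snd c p \<in> snd c ` chart_dom c d U f" using p(1) by blast
    fix x assume "x \<in> snd c ` chart_dom c d U f"
    then have "f (chart_inv c x) \<in> fst d"
      using chart_inv_chart[OF A] by (auto simp: chart_dom_def)
    then show "(snd e \<circ> h \<circ> chart_inv d) ((snd d \<circ> f \<circ> chart_inv c) x) = (snd e \<circ> (h \<circ> f) \<circ> chart_inv c) x"
      using chart_inv_chart[OF B] by simp
  qed
  from frechet_derivative_at[OF this] show ?thesis by (simp add: map_deriv_def fun_eq_iff)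
qed

lemma linear_map_deriv:
  "smooth_map_on A B U f \<Longrightarrow> c \<in> A \<Longrightarrow> d \<in> B \<Longrightarrow> p \<in> chart_dom c d U f \<Longrightarrow> linear (map_deriv c d f p)"
  by (rule has_derivative_linear[OF map_deriv_has_derivative])

lemma map_deriv_id_same:
  assumes "smooth_atlas A" "c \<in> A" "p \<in> fst c"
  shows "map_deriv c c id p = id"
proof -
  have "((snd c \<circ> id \<circ> chart_inv c) has_derivative (\<lambda>u. u)) (at (snd c p))"
    by (rule has_derivative_transform_within_open[OF has_derivative_ident atlas_chart(2)[OF assms(1,2)]])
       (use assms chart_chart_inv[OF assms(1,2)] in auto)
  from frechet_derivative_at[OF this] show ?thesis by (simp add: map_deriv_def fun_eq_iff)
qed

lemma map_deriv_id_compose: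
  assumes "smooth_atlas A" "c \<in> A" "d \<in> A" "e \<in> A" "p \<in> fst c" "p \<in> fst d" "p \<in> fst e"
  shows "map_deriv d e id p (map_deriv c d id p u) = map_deriv c e id p u"
  using map_deriv_compose[OF assms(1,2,1,3,4) smooth_map_on_id[OF assms(1)] open_UNIV
      smooth_map_on_id[OF assms(1)], of p] assms
  by (simp add: chart_dom_def)

lemma linear_transition:
  assumes "smooth_atlas A" "c \<in> A" "d \<in> A" "p \<in> fst c" "p \<in> fst d"
  shows "linear (map_deriv c d id p)"
  by (rule linear_map_deriv[OF smooth_map_on_id[OF assms(1)] assms(2,3)])
     (use assms in \<open>simp add: chart_dom_def\<close>)

lemma linear_to_chart: "smooth_atlas A \<Longrightarrow> c \<in> A \<Longrightarrow> p \<in> fst c \<Longrightarrow> linear (to_chart A c p)"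
  unfolding to_chart_eq by (rule linear_transition) (auto simp: chart_at_in)

lemma linear_from_chart: "smooth_atlas A \<Longrightarrow> c \<in> A \<Longrightarrow> p \<in> fst c \<Longrightarrow> linear (from_chart A c p)"
  unfolding from_chart_eq by (rule linear_transition) (auto simp: chart_at_in)

lemma to_chart_from_chart:
  "smooth_atlas A \<Longrightarrow> c \<in> A \<Longrightarrow> d \<in> A \<Longrightarrow> p \<in> fst c \<Longrightarrow> p \<in> fst d \<Longrightarrow>
    to_chart A d p (from_chart A c p u) = map_deriv c d id p u"
  unfolding to_chart_eq from_chart_eq by (rule map_deriv_id_compose) (auto simp: chart_at_in)

lemma to_from_chart: "smooth_atlas A \<Longrightarrow> c \<in> A \<Longrightarrow> p \<in> fst c \<Longrightarrow> to_chart A c p (from_chart A c p u) = u"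
  by (simp add: to_chart_from_chart map_deriv_id_same)

lemma from_to_chart: "smooth_atlas A \<Longrightarrow> c \<in> A \<Longrightarrow> p \<in> fst c \<Longrightarrow> from_chart A c p (to_chart A c p u) = u"
  unfolding to_chart_eq from_chart_eq
  by (simp add: map_deriv_id_compose chart_at_in map_deriv_id_same)

lemma transition_to_chart:
  "smooth_atlas A \<Longrightarrow> c \<in> A \<Longrightarrow> d \<in> A \<Longrightarrow> p \<in> fst c \<Longrightarrow> p \<in> fst d \<Longrightarrow>
    map_deriv c d id p (to_chart A c p u) = to_chart A d p u"
  unfolding to_chart_eq by (rule map_deriv_id_compose) (auto simp: chart_at_in)

lemma to_chart_at: "smooth_atlas A \<Longrightarrow> to_chart A (chart_at A p) p u = u"
  unfolding to_chart_eq by (simp add: chart_at_in map_deriv_id_same)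

lemma from_chart_at: "smooth_atlas A \<Longrightarrow> from_chart A (chart_at A p) p u = u"
  unfolding from_chart_eq by (simp add: chart_at_in map_deriv_id_same)

lemma inj_from_chart: "smooth_atlas A \<Longrightarrow> c \<in> A \<Longrightarrow> p \<in> fst c \<Longrightarrow> inj (from_chart A c p)"
  by (rule inj_on_inverseI[where g="to_chart A c p"]) (simp add: to_from_chart)

lemma to_chart_differential:
  assumes A: "smooth_atlas A" "c \<in> A" and B: "smooth_atlas B" "d \<in> B"
    and f: "smooth_map_on A B U f" "open U" and p: "p \<in> chart_dom c d U f"
  shows "to_chart B d (f p) (differential A B f p u) = map_deriv c d f p (to_chart A c p u)"
proof -
  let ?c = "chart_at A p" and ?d = "chart_at B (f p)"
  have p': "p \<in> chart_dom ?c d U f" "p \<in> chart_dom ?c ?d U f"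
    using p by (auto simp: chart_dom_def chart_at_in A B)
  have "map_deriv ?c d (id \<circ> f) p = map_deriv ?d d id (f p) \<circ> map_deriv ?c ?d f p"
    by (rule map_deriv_compose[OF A(1) _ B(1) _ B(2) f smooth_map_on_id[OF B(1)]])
       (use p p' A B in \<open>auto simp: chart_at_in chart_dom_def\<close>)
  moreover have "map_deriv ?c d (f \<circ> id) p = map_deriv c d f (id p) \<circ> map_deriv ?c c id p"
    by (rule map_deriv_compose[OF A(1) _ A B(2) smooth_map_on_id[OF A(1)] open_UNIV f(1)])
       (use p p' A B in \<open>auto simp: chart_at_in chart_dom_def\<close>)
  ultimately show ?thesis
    by (simp add: to_chart_eq differential_eq fun_eq_iff)
qed

lemma differential_from_chart:
  assumes A: "smooth_atlas A" "c \<in> A" and B: "smooth_atlas B" "d \<in> B"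
    and f: "smooth_map_on A B U f" "open U" and p: "p \<in> chart_dom c d U f"
  shows "differential A B f p (from_chart A c p u) = from_chart B d (f p) (map_deriv c d f p u)"
  using to_chart_differential[OF assms, of "from_chart A c p u"] p
    from_to_chart[OF B, of "f p" "differential A B f p (from_chart A c p u)"]
  by (simp add: to_from_chart A chart_dom_def)

lemma linear_differential:
  assumes "smooth_atlas A" "smooth_atlas B" "smooth_map_on A B U f" "p \<in> U"
  shows "linear (differential A B f p)"
  unfolding differential_eq
  by (rule linear_map_deriv[OF assms(3)]) (use assms in \<open>auto simp: chart_at_in chart_dom_def\<close>)


section \<open>Curves in charts\<close>

lemma chart_inv_line: "chart_inv (UNIV, id) = (id :: real \<Rightarrow> real)"
  by (simp add: chart_inv_def fun_eq_iff)

lemma smooth_atlas_line: "smooth_atlas line_atlas"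
  by (auto simp: smooth_atlas_def line_atlas_def chart_inv_line homeomorphism_def o_def
      intro!: smooth_on_id continuous_intros)

lemma chart_at_line: "chart_at line_atlas t = (UNIV, id)"
  using chart_at_in(1)[OF smooth_atlas_line, of t] by (simp add: line_atlas_def)

lemma line_chart_dom: "chart_dom (UNIV, id) d I \<gamma> = I \<inter> \<gamma> -` fst d"
  by (auto simp: chart_dom_def)

lemma smooth_curve_rep:
  assumes "smooth_map_on line_atlas A I \<gamma>" "c \<in> A"
  shows "smooth_on (I \<inter> \<gamma> -` fst c) (snd c \<circ> \<gamma>)"
  using smooth_map_rep[OF assms(1) _ assms(2), of "(UNIV, id)"]
  by (simp add: line_chart_dom chart_inv_line line_atlas_def)

lemma to_chart_velocity:
  assumes A: "smooth_atlas A" "c \<in> A" and \<gamma>: "smooth_map_on line_atlas A I \<gamma>" "open I"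
    and t: "t \<in> I" "\<gamma> t \<in> fst c"
  shows "to_chart A c (\<gamma> t) (velocity A \<gamma> t) = frechet_derivative (snd c \<circ> \<gamma>) (at t) 1"
proof -
  have l: "(UNIV, id) \<in> line_atlas" by (simp add: line_atlas_def)
  have "to_chart line_atlas (UNIV, id) t = id"
    unfolding to_chart_eq chart_at_line by (rule map_deriv_id_same[OF smooth_atlas_line l]) simp
  moreover have "map_deriv (UNIV, id) c \<gamma> t = frechet_derivative (snd c \<circ> \<gamma>) (at t)"
    by (simp add: map_deriv_def chart_inv_line)
  ultimately show ?thesis
    unfolding velocity_def
    using to_chart_differential[OF smooth_atlas_line l A \<gamma>, of t 1] t by (simp add: line_chart_dom)
qed

text \<open>The chart \<open>c\<close> need not belong to the atlas, since this is applied to slice charts too.\<close>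

lemma smooth_curve_from_chart:
  assumes A: "smooth_atlas (insert c A)" and I: "open I" and u: "smooth_on I u" "u ` I \<subseteq> snd c ` fst c"
  shows "smooth_map_on line_atlas A I (chart_inv c \<circ> u)"
  unfolding smooth_map_on_def
proof (intro conjI ballI)
  have c: "c \<in> insert c A" by simp
  show cont: "continuous_on I (chart_inv c \<circ> u)"
  proof (rule continuous_on_compose[OF smooth_on_continuous[OF u(1)]])
    have "continuous_on (snd c ` fst c) (chart_inv c)"
      using atlas_chart(3)[OF A c] by (simp add: homeomorphism_def)
    then show "continuous_on (u ` I) (chart_inv c)" using u(2) continuous_on_subset by blast
  qed
  fix l :: "(real, real) chart" and d
  assume l: "l \<in> line_atlas" and d: "d \<in> A"
  then have d': "d \<in> insert c A" by simp
  let ?J = "I \<inter> (chart_inv c \<circ> u) -` fst d"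
  have J: "open ?J"
    using continuous_open_preimage[OF cont I atlas_chart(1)[OF A d']] .
  have "smooth_on ?J (\<lambda>t. (snd d \<circ> id \<circ> chart_inv c) (u t))"
  proof (rule smooth_on_compose[OF J _ _ _ smooth_transition[OF A c d']])
    show "open (snd c ` (fst c \<inter> fst d))"
      by (rule open_chart_image[OF A c open_Int[OF atlas_chart(1)[OF A c] atlas_chart(1)[OF A d']]]) auto
    show "u ` ?J \<subseteq> snd c ` (fst c \<inter> fst d)"
      using u(2) chart_inv_in[OF A c] chart_chart_inv[OF A c] by (force simp: image_iff)
    show "smooth_on ?J u" by (rule smooth_on_subset[OF u(1)]) auto
  qed
  then show "smooth_on (snd l ` (I \<inter> fst l \<inter> (chart_inv c \<circ> u) -` fst d)) (snd d \<circ> (chart_inv c \<circ> u) \<circ> chart_inv l)"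
    using l by (simp add: line_atlas_def chart_inv_line o_def)
qed


section \<open>Compatible charts\<close>

lemma from_chart_transition_compatible:
  assumes A: "smooth_atlas A" "smooth_atlas (insert e A)" and c: "c \<in> insert e A" "d \<in> insert e A"
    and p: "p \<in> fst c" "p \<in> fst d"
  shows "from_chart A d p (map_deriv c d id p u) = from_chart A c p u"
  unfolding from_chart_eq
  by (rule map_deriv_id_compose[OF A(2)]) (use A c p chart_at_in[OF A(1)] in auto)

text \<open>Slice charts arise from a chart of the atlas by composing it, on a part of its domain, with an injective map of nonsingular
  derivative. The transition maps are smooth because this map and its inverse are.\<close>

lemma smooth_atlas_insert_reparametrization:
  fixes A :: "('m::{t2_space,second_countable_topology}, 'a::euclidean_space) chart set"
  assumes A: "smooth_atlas A" "c \<in> A" and V: "open V" "V \<subseteq> snd c ` fst c"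
    and \<Psi>: "smooth_on V \<Psi>" "inj_on \<Psi> V" "open (\<Psi> ` V)"
    and inj: "\<And>x. x \<in> V \<Longrightarrow> inj (frechet_derivative \<Psi> (at x))"
  shows "smooth_atlas (insert (fst c \<inter> snd c -` V, \<Psi> \<circ> snd c) A)"
proof -
  define M where "M = fst c \<inter> snd c -` V"
  define e where "e = (M, \<Psi> \<circ> snd c)"
  define \<Theta> where "\<Theta> = inv_into V \<Psi>"
  have M_sub: "M \<subseteq> fst c" by (simp add: M_def)
  have cM: "snd c ` M = V" using V(2) by (auto simp: M_def)
  have openM: "open M" unfolding M_def by (rule open_chart_vimage[OF A V(1)])
  have \<Theta>\<Psi>: "\<Theta> (\<Psi> x) = x" if "x \<in> V" for x using \<Psi>(2) that by (simp add: \<Theta>_def)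
  have sm\<Theta>: "smooth_on (\<Psi> ` V) \<Theta>"
    by (rule smooth_on_inverse_map[OF V(1) \<Psi>(3,1) \<Theta>\<Psi> inj])
  have eM: "snd e ` M = \<Psi> ` V" using cM by (auto simp: e_def image_comp[symmetric])
  have inj_e: "inj_on (snd e) M"
    by (rule inj_on_inverseI[where g="chart_inv c \<circ> \<Theta>"])
       (use \<Theta>\<Psi> cM M_sub chart_inv_chart[OF A] in \<open>auto simp: e_def\<close>)
  have inv_e: "chart_inv e y = chart_inv c (\<Theta> y)" if "y \<in> \<Psi> ` V" for y
  proof -
    from that obtain x where x: "x \<in> V" "y = \<Psi> x" by auto
    let ?q = "chart_inv c x"
    have "?q \<in> M" using x V(2) chart_inv_in[OF A] chart_chart_inv[OF A] by (auto simp: M_def)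
    moreover have "snd e ?q = y" using x V(2) chart_chart_inv[OF A] by (auto simp: e_def)
    ultimately show ?thesis
      using inv_into_f_f[OF inj_e] x \<Theta>\<Psi> by (force simp: chart_inv_def e_def)
  qed
  have homeo: "homeomorphism M (snd e ` M) (snd e) (chart_inv e)"
  proof (rule homeomorphismI)
    show "continuous_on M (snd e)"
      unfolding e_def snd_conv
    proof (rule continuous_on_compose)
      show "continuous_on M (snd c)"
        using atlas_chart(3)[OF A] M_sub continuous_on_subset by (auto simp: homeomorphism_def)
      show "continuous_on (snd c ` M) \<Psi>" unfolding cM by (rule smooth_on_continuous[OF \<Psi>(1)])
    qed
    have "continuous_on (\<Psi> ` V) (\<lambda>y. chart_inv c (\<Theta> y))"
      by (rule continuous_on_compose2[of "snd c ` fst c"])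
         (use atlas_chart(3)[OF A] smooth_on_continuous[OF sm\<Theta>] \<Theta>\<Psi> V(2) in \<open>auto simp: homeomorphism_def\<close>)
    then show "continuous_on (snd e ` M) (chart_inv e)"
      unfolding eM using inv_e by (simp cong: continuous_on_cong)
    show "snd e ` M \<subseteq> snd e ` M" by simp
    show "chart_inv e ` (snd e ` M) \<subseteq> M"
      using inv_into_into[of _ "snd e" M] by (auto simp: chart_inv_def e_def)
    show "chart_inv e (snd e q) = q" if "q \<in> M" for q
      using inv_into_f_f[OF inj_e that] by (simp add: chart_inv_def e_def)
    show "snd e (chart_inv e y) = y" if "y \<in> snd e ` M" for y
      using f_inv_into_f[OF that] by (simp add: chart_inv_def e_def)
  qed
  have Te: "open (snd d ` (fst d \<inter> M))" if "d \<in> A" for d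
    by (rule open_chart_image[OF A(1) that]) (use atlas_chart(1)[OF A(1) that] openM in auto)
  have de: "smooth_on (snd d ` (fst d \<inter> M)) (snd e \<circ> chart_inv d)" if d: "d \<in> A" for d
  proof -
    have "smooth_on (snd d ` (fst d \<inter> M)) (\<lambda>x. \<Psi> ((snd c \<circ> id \<circ> chart_inv d) x))"
    proof (rule smooth_on_compose[OF Te[OF d] V(1) _ _ \<Psi>(1)])
      show "(snd c \<circ> id \<circ> chart_inv d) ` snd d ` (fst d \<inter> M) \<subseteq> V"
        using cM chart_inv_chart[OF A(1) d] by auto
      show "smooth_on (snd d ` (fst d \<inter> M)) (snd c \<circ> id \<circ> chart_inv d)"
        by (rule smooth_on_subset[OF smooth_transition[OF A(1) d A(2)]]) (use M_sub in auto)
    qed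
    then show ?thesis by (simp add: e_def o_def)
  qed
  have Se: "open (snd e ` (M \<inter> fst d))" if d: "d \<in> A" for d
  proof -
    have "snd e ` (M \<inter> fst d) = \<Psi> ` V \<inter> \<Theta> -` (snd c ` (fst c \<inter> fst d))"
    proof (intro set_eqI iffI)
      fix y assume "y \<in> snd e ` (M \<inter> fst d)"
      then obtain q where q: "q \<in> M" "q \<in> fst d" "y = snd e q" by auto
      then have "snd c q \<in> V" "y = \<Psi> (snd c q)" using cM by (auto simp: e_def)
      then show "y \<in> \<Psi> ` V \<inter> \<Theta> -` (snd c ` (fst c \<inter> fst d))"
        using q M_sub \<Theta>\<Psi> by auto
    next
      fix y assume y: "y \<in> \<Psi> ` V \<inter> \<Theta> -` (snd c ` (fst c \<inter> fst d))"
      then obtain x where x: "x \<in> V" "y = \<Psi> x" by auto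
      with y \<Theta>\<Psi> obtain q where q: "q \<in> fst c" "q \<in> fst d" "x = snd c q" by auto
      then have "q \<in> M" using x by (simp add: M_def)
      then show "y \<in> snd e ` (M \<inter> fst d)" using q x by (auto simp: e_def)
    qed
    moreover have "open (snd c ` (fst c \<inter> fst d))"
      by (rule open_chart_image[OF A]) (use atlas_chart(1)[OF A] atlas_chart(1)[OF A(1) d] in auto)
    ultimately show ?thesis
      using continuous_open_preimage[OF smooth_on_continuous[OF sm\<Theta>] \<Psi>(3)] by simp
  qed
  have ed: "smooth_on (snd e ` (M \<inter> fst d)) (snd d \<circ> chart_inv e)" if d: "d \<in> A" for d
  proof (rule smooth_on_cong[OF Se[OF d]])
    have sub: "snd e ` (M \<inter> fst d) \<subseteq> \<Psi> ` V" using eM by auto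
    show "smooth_on (snd e ` (M \<inter> fst d)) (\<lambda>y. (snd d \<circ> id \<circ> chart_inv c) (\<Theta> y))"
    proof (rule smooth_on_compose[OF Se[OF d] _ _ smooth_on_subset[OF sm\<Theta> sub] smooth_transition[OF A d]])
      show "open (snd c ` (fst c \<inter> fst d))"
        by (rule open_chart_image[OF A]) (use atlas_chart(1)[OF A] atlas_chart(1)[OF A(1) d] in auto)
      show "\<Theta> ` snd e ` (M \<inter> fst d) \<subseteq> snd c ` (fst c \<inter> fst d)"
      proof
        fix z assume "z \<in> \<Theta> ` snd e ` (M \<inter> fst d)"
        then obtain q where q: "q \<in> M" "q \<in> fst d" "z = \<Theta> (\<Psi> (snd c q))" by (auto simp: e_def)
        then have "z = snd c q" using \<Theta>\<Psi> cM by auto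
        then show "z \<in> snd c ` (fst c \<inter> fst d)" using q M_sub by auto
      qed
    qed
    show "(snd d \<circ> id \<circ> chart_inv c) (\<Theta> y) = (snd d \<circ> chart_inv e) y" if "y \<in> snd e ` (M \<inter> fst d)" for y
      using inv_e sub that by auto
  qed
  have ee: "smooth_on (snd e ` (M \<inter> M)) (snd e \<circ> chart_inv e)"
    by (rule smooth_on_cong[OF _ _ smooth_on_id])
       (use homeo eM \<Psi>(3) in \<open>auto simp: homeomorphism_def\<close>)
  have fe: "fst e = M" by (simp add: e_def)
  have "smooth_atlas (insert e A)"
    unfolding smooth_atlas_def
  proof (intro conjI ballI)
    show "(\<Union>c\<in>insert e A. fst c) = UNIV" using A(1) unfolding smooth_atlas_def by auto
    fix x assume x: "x \<in> insert e A"
    show "open (fst x)" "open (snd x ` fst x)" "homeomorphism (fst x) (snd x ` fst x) (snd x) (chart_inv x)"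
      by (cases "x = e"; use x fe openM eM \<Psi>(3) homeo atlas_chart[OF A(1), of x] in simp)+
    fix y assume y: "y \<in> insert e A"
    show "smooth_on (snd x ` (fst x \<inter> fst y)) (snd y \<circ> chart_inv x)"
      using x y fe ed[of y] de[of x] ee smooth_transition[OF A(1), of x y]
      by (cases "x = e"; cases "y = e") simp_all
  qed
  then show ?thesis by (simp add: e_def M_def)
qed

text \<open>Straight lines in a chart provide curves with any prescribed velocity. If the chart is a slice chart and the line lies
  in the slice, then the curve stays in the submanifold.\<close>

lemma chart_line_curve:
  assumes A: "smooth_atlas A" "smooth_atlas (insert e A)" and q: "q \<in> fst e"
  obtains \<epsilon> \<gamma> where "\<epsilon> > 0" "smooth_map_on line_atlas A {-\<epsilon><..<\<epsilon>} \<gamma>" "\<gamma> 0 = q"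
    "velocity A \<gamma> 0 = from_chart A e q v"
    "\<And>t. t \<in> {-\<epsilon><..<\<epsilon>} \<Longrightarrow> \<gamma> t \<in> fst e \<and> snd e (\<gamma> t) = snd e q + t *\<^sub>R v"
proof -
  have e: "e \<in> insert e A" by simp
  let ?y = "snd e q"
  obtain r where r: "r > 0" "ball ?y r \<subseteq> snd e ` fst e"
    using atlas_chart(2)[OF A(2) e] q open_contains_ball by blast
  define \<epsilon> where "\<epsilon> = r / (norm v + 1)"
  have \<epsilon>: "\<epsilon> > 0" using r by (simp add: \<epsilon>_def add_nonneg_pos)
  define u where "u = (\<lambda>t. ?y + t *\<^sub>R v)"
  have u_in: "u t \<in> snd e ` fst e" if "t \<in> {-\<epsilon><..<\<epsilon>}" for t
  proof -
    have "\<bar>t\<bar> < \<epsilon>" using that by auto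
    then have "\<bar>t\<bar> * (norm v + 1) < r"
      unfolding \<epsilon>_def by (simp add: pos_less_divide_eq add_nonneg_pos)
    then have "\<bar>t\<bar> * norm v < r" by (simp add: distrib_left)
    then have "u t \<in> ball ?y r" by (simp add: u_def dist_norm)
    then show ?thesis using r by blast
  qed
  have smu: "smooth_on {-\<epsilon><..<\<epsilon>} u"
    unfolding u_def
    by (intro smooth_on_add smooth_on_const smooth_on_bounded_linear_compose[OF _ bounded_linear_scaleR_left]
        smooth_on_id open_greaterThanLessThan)
  define \<gamma> where "\<gamma> = chart_inv e \<circ> u"
  have \<gamma>: "smooth_map_on line_atlas A {-\<epsilon><..<\<epsilon>} \<gamma>"
    unfolding \<gamma>_def by (rule smooth_curve_from_chart[OF A(2) open_greaterThanLessThan smu]) (use u_in in auto)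
  have \<gamma>_in: "\<gamma> t \<in> fst e \<and> snd e (\<gamma> t) = ?y + t *\<^sub>R v" if "t \<in> {-\<epsilon><..<\<epsilon>}" for t
    using chart_inv_in[OF A(2) e u_in[OF that]] chart_chart_inv[OF A(2) e u_in[OF that]]
    by (simp add: \<gamma>_def u_def)
  have \<gamma>0: "\<gamma> 0 = q" using chart_inv_chart[OF A(2) e q] by (simp add: \<gamma>_def u_def)
  let ?d = "chart_at A q"
  have d: "?d \<in> A" "q \<in> fst ?d" using chart_at_in[OF A(1)] by auto
  have "((snd ?d \<circ> id \<circ> chart_inv e) has_derivative map_deriv e ?d id q) (at (u 0))"
    using map_deriv_has_derivative[OF smooth_map_on_id[OF A(2)] e, of ?d q] d q
    by (simp add: chart_dom_def u_def)
  moreover have "(u has_derivative (\<lambda>t. t *\<^sub>R v)) (at 0)"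
    unfolding u_def by (auto intro!: derivative_eq_intros)
  ultimately have "((\<lambda>t. (snd ?d \<circ> id \<circ> chart_inv e) (u t)) has_derivative
      (\<lambda>t. map_deriv e ?d id q (t *\<^sub>R v))) (at 0)"
    by (rule has_derivative_compose[rotated])
  then have "((snd ?d \<circ> \<gamma>) has_derivative (\<lambda>t. map_deriv e ?d id q (t *\<^sub>R v))) (at 0)"
    by (simp add: \<gamma>_def o_def)
  from frechet_derivative_at[OF this]
  have "frechet_derivative (snd ?d \<circ> \<gamma>) (at 0) 1 = from_chart A e q v"
    by (metis from_chart_eq scaleR_one)
  then have "velocity A \<gamma> 0 = from_chart A e q v"
    using to_chart_velocity[OF A(1) d(1) \<gamma> open_greaterThanLessThan, of 0] \<epsilon> d \<gamma>0
    by (simp add: to_chart_at[OF A(1)])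
  then show ?thesis using that \<epsilon> \<gamma> \<gamma>0 \<gamma>_in by blast
qed

text \<open>The inner product with a vector orthogonal to the subspace is constantly zero, and so is its derivative.\<close>

lemma derivative_in_subspace:
  fixes \<gamma> :: "real \<Rightarrow> 'a::euclidean_space"
  assumes L: "subspace L" and I: "open I" "t \<in> I" and \<gamma>: "\<And>s. s \<in> I \<Longrightarrow> \<gamma> s \<in> L"
    and d: "(\<gamma> has_derivative \<gamma>') (at t)"
  shows "\<gamma>' h \<in> L"
proof -
  have "\<gamma>' h \<bullet> y = 0" if y: "y \<in> L\<^sup>\<bottom>" for y
  proof -
    have "((\<lambda>s. 0) has_derivative (\<lambda>h. \<gamma>' h \<bullet> y)) (at t)"
      by (rule has_derivative_transform_within_open[OF has_derivative_inner_left[OF d] I])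
         (use y \<gamma> in \<open>auto simp: orthogonal_comp_def orthogonal_def inner_commute\<close>)
    from has_derivative_unique[OF this has_derivative_const] show ?thesis by (metis)
  qed
  then have "\<gamma>' h \<in> L\<^sup>\<bottom>\<^sup>\<bottom>"
    by (auto simp: orthogonal_comp_def orthogonal_def inner_commute)
  then show ?thesis using orthogonal_comp_self[OF L] by simp
qed


section \<open>Riemannian metrics in charts\<close>

lemma riemannian_inner_form: "riemannian_metric A g \<Longrightarrow> inner_form (g p)"
  unfolding riemannian_metric_def inner_form_def by blast

lemma metric_in_chart_inner_form:
  assumes A: "smooth_atlas A" "c \<in> A" and g: "\<And>p. inner_form (g p)" and x: "x \<in> snd c ` fst c"
  shows "inner_form (metric_in_chart A g c x)"
  unfolding metric_in_chart_def
  by (rule inner_form_pullback[OF g linear_from_chart[OF A] inj_from_chart[OF A]])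
     (use chart_inv_in[OF A x] in auto)

lemma metric_in_chart_smooth:
  "riemannian_metric A g \<Longrightarrow> c \<in> A \<Longrightarrow> smooth_on (snd c ` fst c) (\<lambda>x. metric_in_chart A g c x v w)"
  unfolding riemannian_metric_def by blast

lemma christoffel_levi_civita:
  assumes A: "smooth_atlas A" "c \<in> A" and g: "riemannian_metric A g" and x: "x \<in> snd c ` fst c"
  shows "levi_civita_at (metric_in_chart A g c) x (christoffel A g c x)"
proof -
  have "\<exists>!\<Gamma>. levi_civita_at (metric_in_chart A g c) x \<Gamma>"
    by (rule ex1_levi_civita_at[OF atlas_chart(2)[OF A] x
          metric_in_chart_inner_form[OF A riemannian_inner_form[OF g]]
          smooth_on_differentiable[OF metric_in_chart_smooth[OF g A(2)] x]])
  from theI'[OF this] show ?thesis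
    unfolding christoffel_def levi_civita_at_def .
qed


section \<open>Closed forms dual to unit vector fields\<close>

locale unit_field =
  fixes A :: "('m::{t2_space,second_countable_topology}, 'a::euclidean_space) chart set"
    and h :: "'m \<Rightarrow> 'a \<Rightarrow> 'a \<Rightarrow> real" and U :: "'m set" and \<xi> :: "'m \<Rightarrow> 'a"
  assumes atlas: "smooth_atlas A" and metric: "riemannian_metric A h" and U: "open U"
    and smooth: "smooth_field_along A A id U \<xi>" and unit: "\<And>p. p \<in> U \<Longrightarrow> h p (\<xi> p) (\<xi> p) = 1"
begin

definition dual :: "'m \<Rightarrow> 'a \<Rightarrow> real" where
  "dual p u = h p u (\<xi> p)"

definition dual_in :: "('m, 'a) chart \<Rightarrow> 'a \<Rightarrow> 'a \<Rightarrow> real" where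
  "dual_in c x w = dual (chart_inv c x) (from_chart A c (chart_inv c x) w)"

text \<open>The components of \<open>dual\<close> and of the field \<open>\<xi>\<close> in a chart are \<open>dual_in\<close> and \<open>field_in\<close>. The definition of the former also makes
  sense for charts outside of the atlas, such as slice charts.\<close>

definition field_in :: "('m, 'a) chart \<Rightarrow> 'a \<Rightarrow> 'a" where
  "field_in c x = to_chart A c (chart_inv c x) (\<xi> (chart_inv c x))"

lemma inner: "inner_form (h p)"
  by (rule riemannian_inner_form[OF metric])

lemma dual_linear: "linear (dual p)"
  using inner_form_bilinear[OF inner, of p] by (simp add: dual_def[abs_def] bilinear_def)

lemma dual_self: "p \<in> U \<Longrightarrow> dual p (\<xi> p) = 1"
  by (simp add: dual_def unit)

lemma open_chart_domain: "c \<in> A \<Longrightarrow> open (snd c ` (U \<inter> fst c))"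
  using open_chart_image[OF atlas _ open_Int[OF U atlas_chart(1)[OF atlas]]] by simp

lemma field_in_smooth:
  assumes "c \<in> A"
  shows "smooth_on (snd c ` (U \<inter> fst c)) (field_in c)"
proof -
  have "smooth_on (snd c ` (U \<inter> fst c \<inter> id -` fst c))
      (\<lambda>x. to_chart A c (id (chart_inv c x)) (\<xi> (chart_inv c x)))"
    using smooth assms unfolding smooth_field_along_def by blast
  then show ?thesis by (simp add: field_in_def[abs_def] Int_assoc)
qed

lemma chart_domain:
  assumes "c \<in> A" "x \<in> snd c ` (U \<inter> fst c)"
  shows "x \<in> snd c ` fst c" "chart_inv c x \<in> U" "chart_inv c x \<in> fst c"
proof -
  from assms(2) obtain q where "q \<in> U" "q \<in> fst c" "x = snd c q" by blast
  then show "x \<in> snd c ` fst c" "chart_inv c x \<in> U" "chart_inv c x \<in> fst c"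
    using chart_inv_chart[OF atlas assms(1)] by simp_all
qed

lemma dual_in_eq:
  assumes "c \<in> A" "x \<in> snd c ` (U \<inter> fst c)"
  shows "dual_in c x w = metric_in_chart A h c x (field_in c x) w"
  using inner_form_commute[OF inner] chart_domain[OF assms]
  by (simp add: dual_in_def dual_def metric_in_chart_def field_in_def from_to_chart[OF atlas assms(1)])

lemma dual_in_linear:
  assumes "c \<in> A" "x \<in> snd c ` (U \<inter> fst c)"
  shows "linear (dual_in c x)"
  using linear_compose[OF linear_from_chart[OF atlas assms(1) chart_domain(3)[OF assms]] dual_linear]
  by (simp add: dual_in_def[abs_def] o_def)

lemma dual_in_smooth:
  assumes c: "c \<in> A"
  shows "smooth_on (snd c ` (U \<inter> fst c)) (\<lambda>x. dual_in c x w)"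
proof (rule smooth_on_cong[OF open_chart_domain[OF c]])
  show "smooth_on (snd c ` (U \<inter> fst c)) (\<lambda>x. metric_in_chart A h c x (field_in c x) w)"
    by (rule smooth_on_bilinear_family[OF open_chart_domain[OF c]
          inner_form_bilinear[OF metric_in_chart_inner_form[OF atlas c inner]]
          smooth_on_subset[OF metric_in_chart_smooth[OF metric c]] field_in_smooth[OF c]
          smooth_on_const[OF open_chart_domain[OF c]]]) auto
qed (simp add: dual_in_eq[OF c])

lemma chart_at_domain: "p \<in> U \<Longrightarrow> snd (chart_at A p) p \<in> snd (chart_at A p) ` (U \<inter> fst (chart_at A p))"
  using chart_at_in[OF atlas] by blast

lemma ext_deriv_dual: "ext_deriv A dual p u v = form_deriv (dual_in (chart_at A p)) (snd (chart_at A p) p) u v"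
  by (simp add: ext_deriv_def form_deriv_def dual_in_def Let_def)

text \<open>In another chart the form has as components its pullback under the transition map.\<close>

lemma dual_in_transition:
  assumes e: "smooth_atlas (insert e A)" and d: "d \<in> A" and x: "x \<in> snd e ` (U \<inter> fst e \<inter> fst d)"
  shows "dual_in e x w = dual_in d ((snd d \<circ> id \<circ> chart_inv e) x) (frechet_derivative (snd d \<circ> id \<circ> chart_inv e) (at x) w)"
proof -
  have e': "e \<in> insert e A" "d \<in> insert e A" using d by auto
  from x obtain q where q: "q \<in> U" "q \<in> fst e" "q \<in> fst d" "x = snd e q" by auto
  have "frechet_derivative (snd d \<circ> id \<circ> chart_inv e) (at x) = map_deriv e d id q" by (simp add: map_deriv_def q)
  then show ?thesis
    using from_chart_transition_compatible[OF atlas e e' q(2,3)] q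
    by (simp add: dual_in_def chart_inv_chart[OF e e'(1)] chart_inv_chart[OF atlas d])
qed

lemma transition_domain:
  assumes e: "smooth_atlas (insert e A)" and d: "d \<in> A"
  shows "open (snd e ` (U \<inter> fst e \<inter> fst d))"
    "(snd d \<circ> id \<circ> chart_inv e) ` snd e ` (U \<inter> fst e \<inter> fst d) \<subseteq> snd d ` (U \<inter> fst d)"
    "smooth_on (snd e ` (U \<inter> fst e \<inter> fst d)) (snd d \<circ> id \<circ> chart_inv e)"
proof -
  have e': "e \<in> insert e A" "d \<in> insert e A" using d by auto
  show "open (snd e ` (U \<inter> fst e \<inter> fst d))"
    by (rule open_chart_image[OF e e'(1)]) (use U atlas_chart(1)[OF e e'(1)] atlas_chart(1)[OF e e'(2)] in auto)
  show "smooth_on (snd e ` (U \<inter> fst e \<inter> fst d)) (snd d \<circ> id \<circ> chart_inv e)"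
    by (rule smooth_on_subset[OF smooth_transition[OF e e']]) auto
  show "(snd d \<circ> id \<circ> chart_inv e) ` snd e ` (U \<inter> fst e \<inter> fst d) \<subseteq> snd d ` (U \<inter> fst d)"
  proof
    fix y assume "y \<in> (snd d \<circ> id \<circ> chart_inv e) ` snd e ` (U \<inter> fst e \<inter> fst d)"
    then obtain q where "q \<in> U" "q \<in> fst e" "q \<in> fst d" "y = (snd d \<circ> id \<circ> chart_inv e) (snd e q)" by blast
    then show "y \<in> snd d ` (U \<inter> fst d)" using chart_inv_chart[OF e e'(1)] by simp
  qed
qed

lemma dual_in_smooth_compatible:
  assumes e: "smooth_atlas (insert e A)"
  shows "smooth_on (snd e ` (U \<inter> fst e)) (\<lambda>x. dual_in e x w)"
proof (rule smooth_on_local)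
  fix x
  assume "x \<in> snd e ` (U \<inter> fst e)"
  then obtain p where p: "p \<in> U" "p \<in> fst e" "x = snd e p" by blast
  let ?d = "chart_at A p"
  have d: "?d \<in> A" "p \<in> fst ?d" using chart_at_in[OF atlas] by auto
  let ?S = "snd e ` (U \<inter> fst e \<inter> fst ?d)"
  let ?\<phi> = "snd ?d \<circ> id \<circ> chart_inv e"
  note S = transition_domain(1)[OF e d(1)] and \<phi>T = transition_domain(2)[OF e d(1)]
    and \<phi> = transition_domain(3)[OF e d(1)]
  have "smooth_on ?S (\<lambda>x. dual_in ?d (?\<phi> x) (frechet_derivative ?\<phi> (at x) w))"
  proof (rule smooth_on_linear_family[OF S _ _ smooth_on_derivative[OF \<phi>]])
    show "linear (dual_in ?d (?\<phi> x))" if "x \<in> ?S" for x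
      by (rule dual_in_linear[OF d(1)]) (use \<phi>T that in blast)
    show "smooth_on ?S (\<lambda>x. dual_in ?d (?\<phi> x) b)" for b
      by (rule smooth_on_compose[OF S open_chart_domain[OF d(1)] \<phi>T \<phi> dual_in_smooth[OF d(1)]])
  qed
  then have "smooth_on ?S (\<lambda>x. dual_in e x w)"
    by (rule smooth_on_cong[OF S, rotated]) (rule dual_in_transition[OF e d(1), symmetric])
  then show "\<exists>T. open T \<and> x \<in> T \<and> smooth_on T (\<lambda>x. dual_in e x w)"
    using S p d by blast
qed

text \<open>As pullback commutes with the exterior derivative, \<open>ext_deriv\<close>, which refers to the preferred chart, can be computed in any
  chart compatible with the atlas.\<close>

lemma form_deriv_dual_in:
  assumes e: "smooth_atlas (insert e A)" and p: "p \<in> U" "p \<in> fst e"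
  shows "form_deriv (dual_in e) (snd e p) u v = ext_deriv A dual p (from_chart A e p u) (from_chart A e p v)"
proof -
  let ?d = "chart_at A p"
  have d: "?d \<in> A" "p \<in> fst ?d" using chart_at_in[OF atlas] by auto
  let ?S = "snd e ` (U \<inter> fst e \<inter> fst ?d)"
  let ?\<phi> = "snd ?d \<circ> id \<circ> chart_inv e"
  note S = transition_domain(1)[OF e d(1)] and \<phi>T = transition_domain(2)[OF e d(1)]
    and \<phi> = transition_domain(3)[OF e d(1)]
  have pS: "snd e p \<in> ?S" using p d by blast
  have \<phi>p: "?\<phi> (snd e p) = snd ?d p" using chart_inv_chart[OF e insertI1] p by simp
  have diff: "(\<lambda>x. dual_in e x w) differentiable (at (snd e p))" for w
    using smooth_on_differentiable[OF dual_in_smooth_compatible[OF e]] p by blast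
  have "form_deriv (dual_in e) (snd e p) u v =
      form_deriv (\<lambda>x w. dual_in ?d (?\<phi> x) (frechet_derivative ?\<phi> (at x) w)) (snd e p) u v"
    by (rule form_deriv_cong[OF S pS dual_in_transition[OF e d(1)] diff])
  also have "\<dots> = form_deriv (dual_in ?d) (?\<phi> (snd e p)) (frechet_derivative ?\<phi> (at (snd e p)) u)
      (frechet_derivative ?\<phi> (at (snd e p)) v)"
    by (rule form_deriv_pullback[OF S pS open_chart_domain[OF d(1)] \<phi>T \<phi> dual_in_linear[OF d(1)] dual_in_smooth[OF d(1)]])
  also have "frechet_derivative ?\<phi> (at (snd e p)) = from_chart A e p"
    by (simp add: from_chart_eq map_deriv_def)
  finally show ?thesis by (simp only: \<phi>p ext_deriv_dual)
qed

lemma ext_deriv_bilinear: "p \<in> U \<Longrightarrow> bilinear (ext_deriv A dual p)"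
proof -
  assume p: "p \<in> U"
  note d = chart_at_in(1)[OF atlas, of p]
  have "bilinear (form_deriv (dual_in (chart_at A p)) (snd (chart_at A p) p))"
    by (rule form_deriv_bilinear[OF open_chart_domain[OF d] chart_at_domain[OF p] dual_in_linear[OF d]
          smooth_on_differentiable[OF dual_in_smooth[OF d] chart_at_domain[OF p]]])
  then show ?thesis by (simp add: ext_deriv_dual[abs_def])
qed

abbreviation acceleration :: "'m \<Rightarrow> 'a" where
  "acceleration p \<equiv> cov_deriv A A h id \<xi> p (\<xi> p)"

lemma acceleration_eq:
  "acceleration p = frechet_derivative (field_in (chart_at A p)) (at (snd (chart_at A p) p)) (\<xi> p) +
     christoffel A h (chart_at A p) (snd (chart_at A p) p) (\<xi> p) (\<xi> p)"
proof -
  have "differential A A id p u = u" for u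
    using map_deriv_id_same[OF atlas chart_at_in[OF atlas], of p] by (simp add: differential_eq)
  then show ?thesis by (simp add: cov_deriv_def Let_def field_in_def[abs_def])
qed

lemma ext_deriv_field:
  assumes p: "p \<in> U"
  shows "ext_deriv A dual p (\<xi> p) v = h p (acceleration p) v"
proof -
  let ?d = "chart_at A p"
  let ?x = "snd ?d p"
  note d = chart_at_in[OF atlas, of p]
  have x: "?x \<in> snd ?d ` fst ?d" using d by blast
  have Xp: "field_in ?d ?x = \<xi> p"
    by (simp add: field_in_def chart_inv_chart[OF atlas d] to_chart_at[OF atlas])
  have Gp: "metric_in_chart A h ?d ?x = h p"
    by (simp add: fun_eq_iff metric_in_chart_def chart_inv_chart[OF atlas d] from_chart_at[OF atlas])
  have inn: "inner_form (metric_in_chart A h ?d y)" if "y \<in> snd ?d ` (U \<inter> fst ?d)" for y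
    using metric_in_chart_inner_form[where g=h, OF atlas d(1) inner] that by blast
  have diff: "(\<lambda>y. metric_in_chart A h ?d y v w) differentiable at ?x" for v w
    by (rule smooth_on_differentiable[OF metric_in_chart_smooth[OF metric d(1)] x])
  have one: "metric_in_chart A h ?d y (field_in ?d y) (field_in ?d y) = 1" if "y \<in> snd ?d ` (U \<inter> fst ?d)" for y
    using chart_domain[OF d(1) that] unit
    by (simp add: metric_in_chart_def field_in_def from_to_chart[OF atlas d(1)])
  have "form_deriv (dual_in ?d) ?x (\<xi> p) v =
      form_deriv (\<lambda>x w. metric_in_chart A h ?d x (field_in ?d x) w) ?x (\<xi> p) v"
    by (rule form_deriv_cong[OF open_chart_domain[OF d(1)] chart_at_domain[OF p] dual_in_eq[OF d(1)]
          smooth_on_differentiable[OF dual_in_smooth[OF d(1)] chart_at_domain[OF p]]])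
  also have "\<dots> = metric_in_chart A h ?d ?x (frechet_derivative (field_in ?d) (at ?x) (field_in ?d ?x) +
      christoffel A h ?d ?x (field_in ?d ?x) (field_in ?d ?x)) v"
    using form_deriv_dual_unit_field[where X="field_in ?d" and v=v, OF open_chart_domain[OF d(1)] chart_at_domain[OF p]
        inn diff christoffel_levi_civita[OF atlas d(1) metric x]
        smooth_on_has_derivative[OF field_in_smooth[OF d(1)] chart_at_domain[OF p]] one]
    by (simp only: Xp)
  finally show ?thesis by (simp only: ext_deriv_dual Xp Gp acceleration_eq)
qed

text \<open>In the preferred chart at \<open>\<gamma> t\<close> the velocity is the field composed with the curve, so the chain rule turns the
  derivative along the curve into the derivative of the field in its own direction.\<close>

lemma integral_curve_acceleration:
  assumes I: "open I" and \<gamma>: "integral_curve_on A U \<xi> I \<gamma>" and t: "t \<in> I"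
  shows "cov_deriv line_atlas A h \<gamma> (velocity A \<gamma>) t 1 = acceleration (\<gamma> t)"
proof -
  have sm: "smooth_map_on line_atlas A I \<gamma>" and \<gamma>U: "\<And>s. s \<in> I \<Longrightarrow> \<gamma> s \<in> U"
    and vel: "\<And>s. s \<in> I \<Longrightarrow> velocity A \<gamma> s = \<xi> (\<gamma> s)"
    using \<gamma> by (auto simp: integral_curve_on_def)
  define p where "p = \<gamma> t"
  let ?d = "chart_at A p"
  note d = chart_at_in[OF atlas, of p]
  have pU: "p \<in> U" using \<gamma>U t by (simp add: p_def)
  let ?J = "I \<inter> \<gamma> -` fst ?d"
  have J: "open ?J" "t \<in> ?J"
    using continuous_open_preimage[OF _ I atlas_chart(1)[OF atlas d(1)]] sm t d
    by (auto simp: smooth_map_on_def p_def)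
  have "((snd ?d \<circ> \<gamma>) has_derivative frechet_derivative (snd ?d \<circ> \<gamma>) (at t)) (at t)"
    by (rule smooth_on_has_derivative[OF smooth_curve_rep[OF sm d(1)] J(2)])
  moreover have "(field_in ?d has_derivative frechet_derivative (field_in ?d) (at (snd ?d p))) (at ((snd ?d \<circ> \<gamma>) t))"
    using smooth_on_has_derivative[OF field_in_smooth[OF d(1)] chart_at_domain[OF pU]] by (simp add: p_def)
  ultimately have "((\<lambda>s. field_in ?d ((snd ?d \<circ> \<gamma>) s)) has_derivative
      (\<lambda>s. frechet_derivative (field_in ?d) (at (snd ?d p)) (frechet_derivative (snd ?d \<circ> \<gamma>) (at t) s))) (at t)"
    by (rule has_derivative_compose)
  then have "((\<lambda>s. to_chart A ?d (\<gamma> s) (velocity A \<gamma> s)) has_derivative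
      (\<lambda>s. frechet_derivative (field_in ?d) (at (snd ?d p)) (frechet_derivative (snd ?d \<circ> \<gamma>) (at t) s))) (at t)"
    by (rule has_derivative_transform_within_open[OF _ J])
       (simp add: field_in_def chart_inv_chart[OF atlas d(1)] vel)
  from frechet_derivative_at[OF this]
  have "frechet_derivative (\<lambda>s. to_chart A ?d (\<gamma> s) (velocity A \<gamma> s)) (at t) 1 =
      frechet_derivative (field_in ?d) (at (snd ?d p)) (frechet_derivative (snd ?d \<circ> \<gamma>) (at t) 1)"
    by (metis)
  also have "frechet_derivative (snd ?d \<circ> \<gamma>) (at t) 1 = \<xi> p"
    using to_chart_velocity[OF atlas d(1) sm I t] d vel[OF t] to_chart_at[OF atlas, of p] by (simp add: p_def)
  finally show ?thesis
    unfolding acceleration_eq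
    using vel[OF t] by (simp add: cov_deriv_def Let_def chart_at_line chart_inv_line p_def velocity_def)
qed

text \<open>Solve the differential equation in a chart.\<close>

lemma integral_curve_exists:
  assumes p: "p \<in> U"
  obtains \<tau> \<gamma> where "\<tau> > 0" "\<gamma> 0 = p" "integral_curve_on A U \<xi> {-\<tau><..<\<tau>} \<gamma>"
proof -
  let ?d = "chart_at A p"
  note d = chart_at_in[OF atlas, of p]
  let ?S = "snd ?d ` (U \<inter> fst ?d)"
  obtain \<tau> u where \<tau>: "\<tau> > 0" "u 0 = snd ?d p"
    and u: "\<And>t. t \<in> {-\<tau><..<\<tau>} \<Longrightarrow> u t \<in> ?S"
      "\<And>t. t \<in> {-\<tau><..<\<tau>} \<Longrightarrow> (u has_vector_derivative field_in ?d (u t)) (at t)"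
    using picard_lindelof[OF open_chart_domain[OF d(1)] chart_at_domain[OF p] field_in_smooth[OF d(1)]] by blast
  let ?I = "{-\<tau><..<\<tau>}"
  define \<gamma> where "\<gamma> = chart_inv ?d \<circ> u"
  have smu: "smooth_on ?I u"
    by (rule smooth_integral_curve[OF open_chart_domain[OF d(1)] open_greaterThanLessThan field_in_smooth[OF d(1)] u])
  have \<gamma>: "smooth_map_on line_atlas A ?I \<gamma>"
    unfolding \<gamma>_def
    by (rule smooth_curve_from_chart[OF _ open_greaterThanLessThan smu])
       (use chart_domain(1)[OF d(1) u(1)] atlas d(1) in \<open>auto simp: insert_absorb\<close>)
  have \<gamma>_in: "\<gamma> t \<in> U" "\<gamma> t \<in> fst ?d" "snd ?d (\<gamma> t) = u t" if "t \<in> ?I" for t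
    using chart_domain[OF d(1) u(1)[OF that]] chart_chart_inv[OF atlas d(1)] by (auto simp: \<gamma>_def)
  have "velocity A \<gamma> t = \<xi> (\<gamma> t)" if t: "t \<in> ?I" for t
  proof -
    have "((snd ?d \<circ> \<gamma>) has_derivative (\<lambda>h. h *\<^sub>R field_in ?d (u t))) (at t)"
      by (rule has_derivative_transform_within_open[OF u(2)[OF t, unfolded has_vector_derivative_def]
            open_greaterThanLessThan t]) (simp add: \<gamma>_in)
    from frechet_derivative_at[OF this, symmetric]
    have "to_chart A ?d (\<gamma> t) (velocity A \<gamma> t) = field_in ?d (u t)"
      using to_chart_velocity[OF atlas d(1) \<gamma> open_greaterThanLessThan t \<gamma>_in(2)[OF t]] by simp
    also have "\<dots> = to_chart A ?d (\<gamma> t) (\<xi> (\<gamma> t))" by (simp add: field_in_def \<gamma>_def)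
    finally show ?thesis by (metis from_to_chart[OF atlas d(1) \<gamma>_in(2)[OF t]])
  qed
  then have "integral_curve_on A U \<xi> ?I \<gamma>" using \<gamma> \<gamma>_in by (simp add: integral_curve_on_def)
  moreover have "\<gamma> 0 = p" using chart_inv_chart[OF atlas d] \<tau> by (simp add: \<gamma>_def)
  ultimately show ?thesis using that \<tau> by blast
qed

text \<open>Both sides say that the acceleration vanishes on \<open>U\<close>: the left hand side because an integral curve passes through every
  point, the right hand side because \<open>d\<eta>(\<xi>, v) = h(\<nabla>\<^sub>\<xi> \<xi>, v)\<close> for the dual form \<open>\<eta>\<close>.\<close>

lemma integral_curves_geodesic_iff:
  "(\<forall>I \<gamma>. open I \<longrightarrow> is_interval I \<longrightarrow> integral_curve_on A U \<xi> I \<gamma> \<longrightarrow> geodesic_on A h I \<gamma>) \<longleftrightarrow>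
   (\<forall>p\<in>U. \<forall>v. ext_deriv A dual p (\<xi> p) v = 0)" (is "?geo \<longleftrightarrow> ?ext")
proof
  assume geo: ?geo
  show ?ext
  proof (intro ballI allI)
    fix p v
    assume p: "p \<in> U"
    obtain \<tau> \<gamma> where \<tau>: "\<tau> > 0" "\<gamma> 0 = p" "integral_curve_on A U \<xi> {-\<tau><..<\<tau>} \<gamma>"
      using integral_curve_exists[OF p] by blast
    have "geodesic_on A h {-\<tau><..<\<tau>} \<gamma>"
      using geo \<tau>(3) is_interval_oo open_greaterThanLessThan by blast
    then have "cov_deriv line_atlas A h \<gamma> (velocity A \<gamma>) 0 1 = 0"
      using \<tau>(1) by (simp add: geodesic_on_def)
    then have "acceleration p = 0"
      using integral_curve_acceleration[OF open_greaterThanLessThan \<tau>(3), of 0] \<tau>(1,2) by simp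
    then show "ext_deriv A dual p (\<xi> p) v = 0"
      by (simp add: ext_deriv_field[OF p] bilinear_lzero[OF inner_form_bilinear[OF inner]])
  qed
next
  assume ext: ?ext
  have acc: "acceleration p = 0" if p: "p \<in> U" for p
    by (rule inner_form_eq_0[OF inner[of p]]) (use ext p in \<open>simp add: ext_deriv_field[OF p, symmetric]\<close>)
  show ?geo
    unfolding geodesic_on_def
    using integral_curve_acceleration acc by (auto simp: integral_curve_on_def)
qed

text \<open>In a slice chart the submanifold is a piece of a subspace \<open>L\<close>, and the form vanishes at points of \<open>L\<close> on vectors of \<open>L\<close>, because lines
  in \<open>L\<close> are curves in the submanifold. Hence its derivatives in directions of \<open>L\<close> vanish as well. Every vector annihilated by the
  form at \<open>p\<close> is the velocity of a curve in the submanifold, hence corresponds to a vector of \<open>L\<close>.\<close>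

lemma ext_deriv_vanishes_on_integral_manifold:
  assumes N: "embedded_submanifold A k N" "p \<in> N" and p: "p \<in> U"
    and tan: "\<And>q. q \<in> N \<Longrightarrow> q \<in> U \<Longrightarrow> tangent_space_of A N q = {u. dual q u = 0}"
    and u: "dual p u = 0" and v: "dual p v = 0"
  shows "ext_deriv A dual p u v = 0"
proof -
  obtain e L where e: "smooth_atlas (insert e A)" "p \<in> fst e" and L: "subspace L"
    and slice: "snd e ` (fst e \<inter> N) = snd e ` fst e \<inter> L"
    using N unfolding embedded_submanifold_def by blast
  have eA: "e \<in> insert e A" by simp
  have in_N: "q \<in> N" if "q \<in> fst e" "snd e q \<in> L" for q
  proof -
    have "snd e q \<in> snd e ` (fst e \<inter> N)" using slice that by blast
    then obtain q' where "q' \<in> fst e" "q' \<in> N" "snd e q = snd e q'" by blast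
    then show ?thesis using chart_inv_chart[OF e(1) eA] that(1) by metis
  qed
  have in_L: "snd e q \<in> L" if "q \<in> fst e" "q \<in> N" for q
    using slice that by blast
  let ?W = "snd e ` (U \<inter> fst e)"
  have W: "open ?W"
    by (rule open_chart_image[OF e(1) eA]) (use U atlas_chart(1)[OF e(1) eA] in auto)
  have zero: "dual_in e y w = 0" if y: "y \<in> ?W" "y \<in> L" and w: "w \<in> L" for y w
  proof -
    from y obtain q where q: "q \<in> U" "q \<in> fst e" "y = snd e q" by blast
    have qN: "q \<in> N" using in_N q y by blast
    obtain \<epsilon> \<gamma> where \<gamma>: "\<epsilon> > 0" "smooth_map_on line_atlas A {-\<epsilon><..<\<epsilon>} \<gamma>" "\<gamma> 0 = q"
      "velocity A \<gamma> 0 = from_chart A e q w"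
      "\<And>t. t \<in> {-\<epsilon><..<\<epsilon>} \<Longrightarrow> \<gamma> t \<in> fst e \<and> snd e (\<gamma> t) = snd e q + t *\<^sub>R w"
      using chart_line_curve[OF atlas e(1) q(2)] by blast
    have "\<gamma> ` {-\<epsilon><..<\<epsilon>} \<subseteq> N"
      using \<gamma>(5) in_N subspace_add[OF L] subspace_scale[OF L w] y q by fastforce
    then have "from_chart A e q w \<in> tangent_space_of A N q"
      unfolding tangent_space_of_def using \<gamma> by (metis (mono_tags, lifting) mem_Collect_eq)
    then show ?thesis
      using tan[OF qN q(1)] by (simp add: dual_in_def q chart_inv_chart[OF e(1) eA])
  qed
  let ?d = "chart_at A p"
  have d: "?d \<in> A" "p \<in> fst ?d" "?d \<in> insert e A" using chart_at_in[OF atlas] by auto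
  have lift: "\<exists>w\<in>L. from_chart A e p w = u" if "dual p u = 0" for u
  proof -
    have "u \<in> tangent_space_of A N p" using tan[OF N(2) p] that by simp
    then obtain \<gamma> \<epsilon> where \<gamma>: "\<epsilon> > 0" "smooth_map_on line_atlas A {-\<epsilon><..<\<epsilon>} \<gamma>"
      "\<gamma> ` {-\<epsilon><..<\<epsilon>} \<subseteq> N" "\<gamma> 0 = p" "u = velocity A \<gamma> 0"
      unfolding tangent_space_of_def by blast
    let ?I = "{-\<epsilon><..<\<epsilon>}"
    let ?J = "?I \<inter> \<gamma> -` (fst e \<inter> fst ?d)"
    have J: "open ?J"
      by (rule continuous_open_preimage[OF _ open_greaterThanLessThan
            open_Int[OF atlas_chart(1)[OF e(1) eA] atlas_chart(1)[OF atlas d(1)]]])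
         (use \<gamma>(2) in \<open>simp add: smooth_map_on_def\<close>)
    have J0: "0 \<in> ?J" using \<gamma> e(2) d(2) by auto
    have dc: "((snd ?d \<circ> \<gamma>) has_derivative frechet_derivative (snd ?d \<circ> \<gamma>) (at 0)) (at 0)"
      by (rule smooth_on_has_derivative[OF smooth_curve_rep[OF \<gamma>(2) d(1)]]) (use J0 in auto)
    have "((snd e \<circ> id \<circ> chart_inv ?d) has_derivative map_deriv ?d e id p) (at ((snd ?d \<circ> \<gamma>) 0))"
      using map_deriv_has_derivative[OF smooth_map_on_id[OF e(1)] d(3) eA, of p] e(2) d(2) \<gamma>(4)
      by (simp add: chart_dom_def)
    from has_derivative_compose[OF dc this]
    have "((\<lambda>s. (snd e \<circ> id \<circ> chart_inv ?d) ((snd ?d \<circ> \<gamma>) s)) has_derivative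
        (\<lambda>s. map_deriv ?d e id p (frechet_derivative (snd ?d \<circ> \<gamma>) (at 0) s))) (at 0)" .
    moreover have "(snd e \<circ> id \<circ> chart_inv ?d) ((snd ?d \<circ> \<gamma>) s) \<in> L" if "s \<in> ?J" for s
      using that in_L[of "\<gamma> s"] image_subset_iff[THEN iffD1, OF \<gamma>(3)] chart_inv_chart[OF atlas d(1)] by auto
    ultimately have "map_deriv ?d e id p (frechet_derivative (snd ?d \<circ> \<gamma>) (at 0) 1) \<in> L"
      by (rule derivative_in_subspace[OF L J J0, rotated])
    moreover have "frechet_derivative (snd ?d \<circ> \<gamma>) (at 0) 1 = u"
      using to_chart_velocity[OF atlas d(1) \<gamma>(2) open_greaterThanLessThan, of 0] \<gamma> d
        to_chart_at[OF atlas, of p] by simp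
    moreover have "from_chart A e p (map_deriv ?d e id p u) = u"
      using from_chart_transition_compatible[OF atlas e(1) d(3) eA d(2) e(2)] from_chart_at[OF atlas] by simp
    ultimately show ?thesis by auto
  qed
  obtain a b where a: "a \<in> L" "from_chart A e p a = u" and b: "b \<in> L" "from_chart A e p b = v"
    using lift u v by blast
  let ?y = "snd e p"
  have yW: "?y \<in> ?W" using p e(2) by blast
  have yL: "?y \<in> L" using in_L e(2) N(2) by blast
  have flat: "frechet_derivative (\<lambda>y. dual_in e y w) (at ?y) w' = 0" if w: "w \<in> L" "w' \<in> L" for w w'
  proof -
    have l: "((\<lambda>t. ?y + t *\<^sub>R w') has_derivative (\<lambda>t. t *\<^sub>R w')) (at 0)"
      by (auto intro!: derivative_eq_intros)
    have D: "((\<lambda>y. dual_in e y w) has_derivative frechet_derivative (\<lambda>y. dual_in e y w) (at ?y)) (at (?y + 0 *\<^sub>R w'))"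
      using smooth_on_has_derivative[OF dual_in_smooth_compatible[OF e(1)] yW] by simp
    let ?T = "(\<lambda>t. ?y + t *\<^sub>R w') -` ?W"
    have T: "open ?T" by (rule open_vimage[OF W]) (intro continuous_intros)
    have "((\<lambda>t. 0 :: real) has_derivative (\<lambda>t. frechet_derivative (\<lambda>y. dual_in e y w) (at ?y) (t *\<^sub>R w'))) (at 0)"
    proof (rule has_derivative_transform_within_open[OF has_derivative_compose[OF l D] T])
      show "0 \<in> ?T" using yW by simp
      show "dual_in e (?y + t *\<^sub>R w') w = 0" if "t \<in> ?T" for t
        by (rule zero[OF _ _ w(1)]) (use that yL subspace_add[OF L] subspace_scale[OF L w(2)] in auto)
    qed
    from has_derivative_unique[OF this has_derivative_const] show ?thesis
      by (metis scaleR_one)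
  qed
  have "form_deriv (dual_in e) ?y a b = 0"
    by (simp add: form_deriv_def flat a b)
  then show ?thesis using form_deriv_dual_in[OF e(1) p e(2)] a b by metis
qed

text \<open>Let \<open>h\<close> be a local potential of the form. The integral manifold is the level set of \<open>h\<close> through \<open>p\<close>, and a slice chart for it
  replaces the component along \<open>a = \<xi> p\<close> by the change of \<open>h\<close>. With \<open>\<omega>\<close> the form in the preferred chart, the linear form
  \<open>\<omega> x0\<close> takes \<open>\<Psi> x\<close> to \<open>h x - h x0\<close>, so the level set becomes the kernel of \<open>\<omega> x0\<close>.

  Where \<open>\<omega> x a > 0\<close> the potential increases strictly along lines in direction \<open>a\<close>. This makes \<open>\<Psi>\<close> injective on a ball, and
  invariance of domain makes its image open; for the derivative of \<open>\<Psi>\<close> the same argument is linear.\<close>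

lemma closed_dual_integral_manifold:
  assumes closed: "\<And>q u v. q \<in> U \<Longrightarrow> ext_deriv A dual q u v = 0" and p: "p \<in> U"
  obtains N where "p \<in> N" "N \<subseteq> U" "embedded_submanifold A (dim {u. dual p u = 0}) N"
    "\<And>q. q \<in> N \<Longrightarrow> tangent_space_of A N q = {u. dual q u = 0}"
proof -
  let ?c = "chart_at A p"
  note c = chart_at_in[OF atlas, of p]
  have insc: "insert ?c A = A" using c(1) by (rule insert_absorb)
  define x0 where "x0 = snd ?c p"
  define \<omega> where "\<omega> = dual_in ?c"
  let ?S = "snd ?c ` (U \<inter> fst ?c)"
  have S: "open ?S" by (rule open_chart_domain[OF c(1)])
  have x0: "x0 \<in> ?S" unfolding x0_def by (rule chart_at_domain[OF p])
  have lin: "linear (\<omega> x)" if "x \<in> ?S" for x unfolding \<omega>_def by (rule dual_in_linear[OF c(1) that])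
  have sm: "smooth_on ?S (\<lambda>x. \<omega> x w)" for w unfolding \<omega>_def by (rule dual_in_smooth[OF c(1)])
  have closed': "form_deriv \<omega> x u v = 0" if "x \<in> ?S" for x u v
  proof -
    from that obtain q where q: "q \<in> U" "q \<in> fst ?c" "x = snd ?c q" by blast
    show ?thesis
      using form_deriv_dual_in[OF _ q(1,2), of u v] closed[OF q(1)] atlas by (simp add: \<omega>_def q insc)
  qed
  define a where "a = \<xi> p"
  have \<omega>0: "\<omega> x0 u = dual p u" for u
    by (simp add: \<omega>_def dual_in_def x0_def chart_inv_chart[OF atlas c] from_chart_at[OF atlas])
  have \<omega>0a: "\<omega> x0 a = 1" by (simp add: \<omega>0 a_def dual_self[OF p])
  have lin0: "linear (\<omega> x0)" by (rule lin[OF x0])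
  have a0: "a \<noteq> 0" using \<omega>0a linear_0[OF lin0] by auto
  have "open (?S \<inter> (\<lambda>x. \<omega> x a) -` {0<..})"
    by (rule continuous_open_preimage[OF smooth_on_continuous[OF sm] S open_greaterThan])
  then obtain r where r: "r > 0" "ball x0 r \<subseteq> ?S \<inter> (\<lambda>x. \<omega> x a) -` {0<..}"
    using x0 \<omega>0a open_contains_ball by (metis IntI vimageI greaterThan_iff zero_less_one)
  let ?V = "ball x0 r"
  have VS: "?V \<subseteq> ?S" and pos: "\<And>x. x \<in> ?V \<Longrightarrow> \<omega> x a > 0" using r by auto
  have Vc: "?V \<subseteq> snd ?c ` fst ?c" using VS by blast
  have x0V: "x0 \<in> ?V" using r by simp
  obtain h where h: "\<And>x. x \<in> ?V \<Longrightarrow> (h has_derivative \<omega> x) (at x)"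
    using closed_form_exact_on_ball[OF r(1) lin smooth_on_subset[OF sm VS] closed'] VS by blast
  have smh: "smooth_on ?V h"
    by (rule smooth_on_if_derivative_smooth[OF open_ball h smooth_on_subset[OF sm VS]])
  define \<Psi> where "\<Psi> = (\<lambda>x. (x - x0) + (h x - h x0 - \<omega> x0 (x - x0)) *\<^sub>R a)"
  define \<Psi>' where "\<Psi>' = (\<lambda>x v. v + (\<omega> x v - \<omega> x0 v) *\<^sub>R a)"
  have bl0: "bounded_linear (\<omega> x0)" using lin0 by (simp add: linear_conv_bounded_linear)
  have d\<Psi>: "(\<Psi> has_derivative \<Psi>' x) (at x)" if "x \<in> ?V" for x
    unfolding \<Psi>_def \<Psi>'_def
    by (auto intro!: derivative_eq_intros h[OF that] bounded_linear.has_derivative[OF bl0])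
  have d\<Psi>': "frechet_derivative \<Psi> (at x) = \<Psi>' x" if "x \<in> ?V" for x
    by (rule frechet_derivative_at[OF d\<Psi>[OF that], symmetric])
  have sm\<Psi>: "smooth_on ?V \<Psi>"
    unfolding \<Psi>_def
    by (intro smooth_on_add[OF open_ball] smooth_on_diff[OF open_ball] smooth_on_id[OF open_ball]
        smooth_on_const[OF open_ball] smooth_on_bilinear[OF open_ball bounded_bilinear_scaleR] smh
        smooth_on_bounded_linear_compose[OF open_ball bl0])
  have inj': "inj (\<Psi>' x)" if x: "x \<in> ?V" for x
  proof (rule injI)
    fix v w
    assume eq: "\<Psi>' x v = \<Psi>' x w"
    define s where "s = \<omega> x0 (v - w) - \<omega> x (v - w)"
    have linx: "linear (\<omega> x)" using lin VS x by blast
    have vw: "v - w = s *\<^sub>R a"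
      using eq by (simp add: \<Psi>'_def s_def linear_diff[OF linx] linear_diff[OF lin0] algebra_simps)
    have "s = s * \<omega> x0 a - s * \<omega> x a"
      using s_def unfolding vw by (simp add: linear_cmul[OF linx] linear_cmul[OF lin0])
    then have "s * \<omega> x a = 0" using \<omega>0a by simp
    then show "v = w" using pos[OF x] vw by simp
  qed
  have inj: "inj_on \<Psi> ?V"
  proof (rule inj_onI)
    fix x y
    assume x: "x \<in> ?V" and y: "y \<in> ?V" and eq: "\<Psi> x = \<Psi> y"
    define s where "s = \<omega> x0 (x - y) - (h x - h y)"
    have "x - y = s *\<^sub>R a"
    proof -
      have "\<omega> x0 (x - x0) - \<omega> x0 (y - x0) = \<omega> x0 (x - y)"
        using linear_diff[OF lin0, of "x - x0" "y - x0"] by simp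
      then have s': "s = (h y - h x0 - \<omega> x0 (y - x0)) - (h x - h x0 - \<omega> x0 (x - x0))"
        by (simp add: s_def)
      show ?thesis using eq unfolding s' by (simp add: \<Psi>_def scaleR_diff_left algebra_simps)
    qed
    then have xy: "x = y + s *\<^sub>R a" by (simp add: algebra_simps)
    have seg: "y + t *\<^sub>R (s *\<^sub>R a) \<in> ?V" if "0 \<le> t" "t \<le> 1" for t
    proof -
      have "(1 - t) *\<^sub>R y + t *\<^sub>R x \<in> ?V"
        using convexD_alt[OF convex_ball y x that] .
      then show ?thesis by (simp add: xy algebra_simps)
    qed
    have dh: "((\<lambda>t. h (y + t *\<^sub>R (s *\<^sub>R a))) has_real_derivative s * \<omega> (y + t *\<^sub>R (s *\<^sub>R a)) a) (at t)"
      if t: "0 \<le> t" "t \<le> 1" for t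
    proof -
      have l: "((\<lambda>t. y + t *\<^sub>R (s *\<^sub>R a)) has_derivative (\<lambda>d. d *\<^sub>R (s *\<^sub>R a))) (at t)"
        by (auto intro!: derivative_eq_intros)
      show ?thesis
        unfolding has_field_derivative_def
        by (rule has_derivative_eq_rhs[OF has_derivative_compose[OF l h[OF seg[OF t]]]])
           (use lin VS seg[OF t] in \<open>auto simp: fun_eq_iff linear_cmul\<close>)
    qed
    \<comment> \<open>The mean value theorem on the segment from \<open>y\<close> to \<open>x\<close>, which is parallel to \<open>a\<close>.\<close>
    obtain t where t: "0 < t" "t < 1"
      and eq_t: "h (y + 1 *\<^sub>R (s *\<^sub>R a)) - h (y + 0 *\<^sub>R (s *\<^sub>R a)) = (1 - 0) * (s * \<omega> (y + t *\<^sub>R (s *\<^sub>R a)) a)"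
      using MVT2[OF zero_less_one dh] by auto
    have "s = s * \<omega> x0 a - (h x - h y)"
      using s_def xy by (simp add: linear_cmul[OF lin0])
    then have "s * \<omega> (y + t *\<^sub>R (s *\<^sub>R a)) a = 0"
      using eq_t \<omega>0a by (simp add: xy[symmetric])
    then have "s = 0" using pos[OF seg[of t]] t by simp
    then show "x = y" using xy by simp
  qed
  have op: "open (\<Psi> ` ?V)"
    by (rule invariance_of_domain[OF smooth_on_continuous[OF sm\<Psi>] open_ball inj])
  define e where "e = (fst ?c \<inter> snd ?c -` ?V, \<Psi> \<circ> snd ?c)"
  have e: "smooth_atlas (insert e A)"
    unfolding e_def
    by (rule smooth_atlas_insert_reparametrization[OF atlas c(1) open_ball Vc sm\<Psi> inj op])
       (use inj' d\<Psi>' in auto)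
  have eA: "e \<in> insert e A" "?c \<in> insert e A" using c by auto
  define L where "L = {v. \<omega> x0 v = 0}"
  have L: "subspace L"
    unfolding L_def using linear_subspace_kernel[OF lin0] by simp
  have e_dom: "q \<in> fst ?c \<and> q \<in> U \<and> snd ?c q \<in> ?V \<and> snd e q = \<Psi> (snd ?c q)" if q: "q \<in> fst e" for q
  proof -
    have q': "q \<in> fst ?c" "snd ?c q \<in> ?V" using q by (auto simp: e_def)
    then show ?thesis
      using chart_domain(2)[OF c(1), of "snd ?c q"] VS chart_inv_chart[OF atlas c(1)] by (auto simp: e_def)
  qed
  have in_dom: "q \<in> fst e" if "q \<in> fst ?c" "snd ?c q \<in> ?V" for q
    using that by (simp add: e_def)
  have \<Psi>L: "\<Psi> x \<in> L \<longleftrightarrow> h x = h x0" for x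
    using \<omega>0a by (simp add: L_def \<Psi>_def linear_add[OF lin0] linear_cmul[OF lin0])
  define N where "N = {q \<in> fst e. h (snd ?c q) = h x0}"
  have NL: "q \<in> N \<longleftrightarrow> q \<in> fst e \<and> snd e q \<in> L" for q
    using e_dom \<Psi>L by (auto simp: N_def)
  have slice: "snd e ` (fst e \<inter> N) = snd e ` fst e \<inter> L"
    using NL by auto
  \<comment> \<open>In the preferred chart at \<open>p\<close> the vectors tangent at \<open>p\<close> are their own components.\<close>
  have dimL: "dim L = dim {u. dual p u = 0}" by (simp add: L_def \<omega>0)
  have emb: "embedded_submanifold A (dim {u. dual p u = 0}) N"
    unfolding embedded_submanifold_def using e L slice dimL NL by blast
  have \<omega>_chart: "\<omega> (snd ?c q) (to_chart A ?c q u) = dual q u" if "q \<in> fst ?c" for q u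
    using that by (simp add: \<omega>_def dual_in_def chart_inv_chart[OF atlas c(1)] from_to_chart[OF atlas c(1)])
  have tan: "tangent_space_of A N q = {u. dual q u = 0}" if q: "q \<in> N" for q
  proof (intro set_eqI iffI)
    let ?x = "snd ?c q"
    have qe: "q \<in> fst e" and hq: "h ?x = h x0" using q by (auto simp: N_def)
    have qc: "q \<in> fst ?c" "?x \<in> ?V" using e_dom[OF qe] by auto
    {
      fix u
      assume "u \<in> tangent_space_of A N q"
      then obtain \<gamma> \<epsilon> where \<gamma>: "\<epsilon> > 0" "smooth_map_on line_atlas A {-\<epsilon><..<\<epsilon>} \<gamma>"
        "\<gamma> ` {-\<epsilon><..<\<epsilon>} \<subseteq> N" "\<gamma> 0 = q" "u = velocity A \<gamma> 0"
        unfolding tangent_space_of_def by blast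
      let ?I = "{-\<epsilon><..<\<epsilon>}"
      have I0: "0 \<in> ?I" using \<gamma>(1) by simp
      have dc: "((snd ?c \<circ> \<gamma>) has_derivative frechet_derivative (snd ?c \<circ> \<gamma>) (at 0)) (at 0)"
        by (rule smooth_on_has_derivative[OF smooth_curve_rep[OF \<gamma>(2) c(1)]]) (use I0 \<gamma>(4) qc in auto)
      have "(h has_derivative \<omega> ?x) (at ((snd ?c \<circ> \<gamma>) 0))" using h[OF qc(2)] \<gamma>(4) by simp
      from has_derivative_compose[OF dc this]
      have 1: "((\<lambda>t. h ((snd ?c \<circ> \<gamma>) t)) has_derivative (\<lambda>t. \<omega> ?x (frechet_derivative (snd ?c \<circ> \<gamma>) (at 0) t))) (at 0)" .
      have "((\<lambda>t. h x0) has_derivative (\<lambda>t. \<omega> ?x (frechet_derivative (snd ?c \<circ> \<gamma>) (at 0) t))) (at 0)"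
        by (rule has_derivative_transform_within_open[OF 1 open_greaterThanLessThan I0])
           (use \<gamma>(3) in \<open>auto simp: N_def image_subset_iff\<close>)
      from has_derivative_unique[OF this has_derivative_const]
      have "\<omega> ?x (frechet_derivative (snd ?c \<circ> \<gamma>) (at 0) 1) = 0" by metis
      moreover have "to_chart A ?c q u = frechet_derivative (snd ?c \<circ> \<gamma>) (at 0) 1"
        using to_chart_velocity[OF atlas c(1) \<gamma>(2) open_greaterThanLessThan I0] \<gamma>(4,5) qc by simp
      ultimately show "u \<in> {u. dual q u = 0}" using \<omega>_chart[OF qc(1), of u] by simp
    next
      fix u
      assume u: "u \<in> {u. dual q u = 0}"
      define v where "v = \<Psi>' ?x (to_chart A ?c q u)"
      have "\<omega> ?x (to_chart A ?c q u) = 0" using u \<omega>_chart[OF qc(1)] by simp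
      then have vL: "v \<in> L"
        using \<omega>0a by (simp add: v_def L_def \<Psi>'_def linear_add[OF lin0] linear_diff[OF lin0] linear_cmul[OF lin0])
      have "map_deriv ?c e id q = \<Psi>' ?x"
      proof -
        have "((snd e \<circ> id \<circ> chart_inv ?c) has_derivative \<Psi>' ?x) (at ?x)"
          by (rule has_derivative_transform_within_open[OF d\<Psi>[OF qc(2)] open_ball qc(2)])
             (use Vc chart_chart_inv[OF atlas c(1)] in \<open>auto simp: e_def\<close>)
        from frechet_derivative_at[OF this] show ?thesis by (simp add: map_deriv_def)
      qed
      then have fv: "from_chart A e q v = u"
        using from_chart_transition_compatible[OF atlas e eA(2,1) qc(1) qe, of "to_chart A ?c q u"]
        by (simp add: v_def from_to_chart[OF atlas c(1) qc(1)])
      obtain \<epsilon> \<gamma> where \<gamma>: "\<epsilon> > 0" "smooth_map_on line_atlas A {-\<epsilon><..<\<epsilon>} \<gamma>" "\<gamma> 0 = q"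
        "velocity A \<gamma> 0 = from_chart A e q v"
        "\<And>t. t \<in> {-\<epsilon><..<\<epsilon>} \<Longrightarrow> \<gamma> t \<in> fst e \<and> snd e (\<gamma> t) = snd e q + t *\<^sub>R v"
        using chart_line_curve[OF atlas e qe] by blast
      have "snd e q \<in> L" using q NL by blast
      then have "\<gamma> ` {-\<epsilon><..<\<epsilon>} \<subseteq> N"
        using \<gamma>(5) NL subspace_add[OF L] subspace_scale[OF L vL] by auto
      then show "u \<in> tangent_space_of A N q"
        unfolding tangent_space_of_def using \<gamma> fv by (metis (mono_tags, lifting) mem_Collect_eq)
    }
  qed
  have "p \<in> N" using in_dom[OF c(2)] x0V by (simp add: N_def x0_def)
  moreover have "N \<subseteq> U" using e_dom by (auto simp: N_def)
  ultimately show ?thesis using that emb tan by blast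
qed

end


section \<open>The covariant derivative along a map, in coordinates\<close>

text \<open>A map \<open>F\<close> between coordinate domains with a metric \<open>G\<close> on its target. Its Levi-Civita connection \<open>\<Gamma>\<close> is given at the
  image of the one point \<open>x\<close> at which fields along the map are differentiated.\<close>

locale along_map =
  fixes S :: "'a::euclidean_space set" and T :: "'b::euclidean_space set" and F :: "'a \<Rightarrow> 'b"
    and G :: "'b \<Rightarrow> 'b \<Rightarrow> 'b \<Rightarrow> real" and \<Gamma> :: "'b \<Rightarrow> 'b \<Rightarrow> 'b" and x :: 'a
  assumes S: "open S" "x \<in> S" and T: "open T" "F ` S \<subseteq> T" and F: "smooth_on S F"
    and G: "\<And>y. y \<in> T \<Longrightarrow> inner_form (G y)" and smG: "\<And>v w. smooth_on T (\<lambda>y. G y v w)"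
    and \<Gamma>: "levi_civita_at G (F x) \<Gamma>"
begin

abbreviation D :: "'a \<Rightarrow> 'b" where "D \<equiv> frechet_derivative F (at x)"

definition nabla :: "('a \<Rightarrow> 'b) \<Rightarrow> 'a \<Rightarrow> 'b" where
  "nabla \<alpha> u = frechet_derivative \<alpha> (at x) u + \<Gamma> (D u) (\<alpha> x)"

lemma Tx: "F x \<in> T"
  using S T by blast

lemma dF: "(F has_derivative D) (at x)"
  by (rule smooth_on_has_derivative[OF F S(2)])

lemma has_derivative_metric:
  assumes \<alpha>: "\<alpha> differentiable (at x)" and \<beta>: "\<beta> differentiable (at x)"
  shows "((\<lambda>z. G (F z) (\<alpha> z) (\<beta> z)) has_derivative
    (\<lambda>u. G (F x) (nabla \<alpha> u) (\<beta> x) + G (F x) (\<alpha> x) (nabla \<beta> u))) (at x)"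
proof -
  note b = inner_form_bilinear[OF G[OF Tx]]
  have dG: "((\<lambda>z. G (F z) v w) has_derivative
      (\<lambda>u. frechet_derivative (\<lambda>y. G y v w) (at (F x)) (D u))) (at x)" for v w
    by (rule has_derivative_compose[OF dF smooth_on_has_derivative[OF smG Tx]])
  have "((\<lambda>z. G (F z) (\<alpha> z) (\<beta> z)) has_derivative
      (\<lambda>u. frechet_derivative (\<lambda>z. G (F z) (\<alpha> x) (\<beta> x)) (at x) u
        + G (F x) (frechet_derivative \<alpha> (at x) u) (\<beta> x)
        + G (F x) (\<alpha> x) (frechet_derivative \<beta> (at x) u))) (at x)"
  proof (rule has_derivative_bilinear_family[OF S])
    show "bilinear (G (F y))" if "y \<in> S" for y
      by (rule inner_form_bilinear[OF G]) (use that T in blast)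
    show "(\<lambda>y. G (F y) v w) differentiable at x" for v w
      using dG by (auto simp: differentiable_def)
  qed (use \<alpha> \<beta> in \<open>simp_all add: frechet_derivative_works\<close>)
  then show ?thesis
    by (rule has_derivative_eq_rhs)
       (simp add: frechet_derivative_at[OF dG, symmetric] levi_civita_atD(3)[OF \<Gamma>] nabla_def
         bilinear_ladd[OF b] bilinear_radd[OF b] fun_eq_iff)
qed

text \<open>The connection has no torsion: second derivatives and Christoffel symbols are symmetric.\<close>

lemma nabla_tangent_symmetric:
  "nabla (\<lambda>z. frechet_derivative F (at z) v) u = nabla (\<lambda>z. frechet_derivative F (at z) u) v"
  using symmetric_second_derivative[OF S F, of v u] levi_civita_atD(2)[OF \<Gamma>, of "D u" "D v"]
  by (simp add: nabla_def)

lemma tangent_differentiable: "(\<lambda>z. frechet_derivative F (at z) v) differentiable (at x)"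
  by (rule smooth_on_differentiable[OF smooth_on_derivative[OF F] S(2)])

lemma nabla_unit_orthogonal:
  assumes Z: "Z differentiable (at x)" and unit: "\<And>z. z \<in> S \<Longrightarrow> G (F z) (Z z) (Z z) = 1"
  shows "G (F x) (nabla Z u) (Z x) = 0"
proof -
  have "((\<lambda>z. 1 :: real) has_derivative (\<lambda>u. G (F x) (nabla Z u) (Z x) + G (F x) (Z x) (nabla Z u))) (at x)"
    by (rule has_derivative_transform_within_open[OF has_derivative_metric[OF Z Z] S]) (simp add: unit)
  from fun_cong[OF has_derivative_unique[OF this has_derivative_const], of u]
  show ?thesis using inner_form_commute[OF G[OF Tx], of "Z x" "nabla Z u"] by simp
qed

text \<open>Differentiating the orthogonality of \<open>Z\<close> to the tangent vectors moves the derivative from \<open>Z\<close> to the tangent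
  vectors, where it is symmetric.\<close>

lemma second_fundamental_form_symmetric:
  assumes Z: "Z differentiable (at x)"
    and normal: "\<And>z v. z \<in> S \<Longrightarrow> G (F z) (Z z) (frechet_derivative F (at z) v) = 0"
  shows "G (F x) (nabla Z u) (D v) = G (F x) (nabla Z v) (D u)"
proof -
  have *: "G (F x) (nabla Z u) (D v) = - G (F x) (Z x) (nabla (\<lambda>z. frechet_derivative F (at z) v) u)" for u v
  proof -
    have "((\<lambda>z. 0 :: real) has_derivative (\<lambda>u. G (F x) (nabla Z u) (D v) +
        G (F x) (Z x) (nabla (\<lambda>z. frechet_derivative F (at z) v) u))) (at x)"
      by (rule has_derivative_transform_within_open[OF has_derivative_metric[OF Z tangent_differentiable] S])
         (simp add: normal)
    from fun_cong[OF has_derivative_unique[OF this has_derivative_const], of u] show ?thesis by simp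
  qed
  show ?thesis unfolding * by (simp add: nabla_tangent_symmetric[of v u])
qed

text \<open>The product rule, where the derivative of the tangent vectors cancels by symmetry and the derivative passes through
  the parallel endomorphism field \<open>K\<close>.\<close>

lemma form_deriv_parallel:
  assumes Z: "smooth_on S Z" and K: "\<And>y. y \<in> T \<Longrightarrow> linear (K y)" "\<And>v. smooth_on T (\<lambda>y. K y v)"
    and parallel: "\<And>u v. frechet_derivative (\<lambda>y. K y v) (at (F x)) u + \<Gamma> u (K (F x) v) = K (F x) (\<Gamma> u v)"
  shows "form_deriv (\<lambda>z w. - G (F z) (frechet_derivative F (at z) w) (K (F z) (Z z))) x u v =
    G (F x) (D u) (K (F x) (nabla Z v)) - G (F x) (D v) (K (F x) (nabla Z u))"
proof -
  note linK = K(1)[OF Tx]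
  have dK: "((\<lambda>z. K (F z) v) has_derivative (\<lambda>u. frechet_derivative (\<lambda>y. K y v) (at (F x)) (D u))) (at x)" for v
    by (rule has_derivative_compose[OF dF smooth_on_has_derivative[OF K(2) Tx]])
  have "((\<lambda>z. K (F z) (Z z)) has_derivative (\<lambda>u. frechet_derivative (\<lambda>z. K (F z) (Z x)) (at x) u
      + K (F x) (frechet_derivative Z (at x) u))) (at x)"
  proof (rule has_derivative_linear_family[OF S])
    show "linear (K (F z))" if "z \<in> S" for z by (rule K(1)) (use that T in blast)
    show "(\<lambda>y. K (F y) b) differentiable at x" for b using dK by (auto simp: differentiable_def)
    show "(Z has_derivative frechet_derivative Z (at x)) (at x)" by (rule smooth_on_has_derivative[OF Z S(2)])
  qed
  then have dKZ: "((\<lambda>z. K (F z) (Z z)) has_derivative (\<lambda>u. frechet_derivative (\<lambda>y. K y (Z x)) (at (F x)) (D u)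
      + K (F x) (frechet_derivative Z (at x) u))) (at x)"
    by (simp add: frechet_derivative_at[OF dK, symmetric])
  have nKZ: "nabla (\<lambda>z. K (F z) (Z z)) u = K (F x) (nabla Z u)" for u
    using parallel[of "Z x" "D u"]
    by (simp add: nabla_def frechet_derivative_at[OF dKZ, symmetric] linear_add[OF linK] algebra_simps)
  have KZd: "(\<lambda>z. K (F z) (Z z)) differentiable (at x)" using dKZ by (auto simp: differentiable_def)
  have "((\<lambda>z. - G (F z) (frechet_derivative F (at z) w) (K (F z) (Z z))) has_derivative
      (\<lambda>u. - (G (F x) (nabla (\<lambda>z. frechet_derivative F (at z) w) u) (K (F x) (Z x))
        + G (F x) (D w) (K (F x) (nabla Z u))))) (at x)" for w
    using has_derivative_minus[OF has_derivative_metric[OF tangent_differentiable[of w] KZd]] by (simp add: nKZ)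
  from frechet_derivative_at[OF this, symmetric] show ?thesis
    by (simp add: form_deriv_def nabla_tangent_symmetric[of v u])
qed

end


section \<open>Smoothness of vector fields along maps\<close>

text \<open>A smooth field in one pair of charts is smooth in all others, since the transition maps and their derivatives are smooth.\<close>

lemma smooth_field_along_local:
  assumes A: "smooth_atlas A" and B: "smooth_atlas B" and f: "smooth_map_on A B UNIV f"
    and loc: "\<And>q. q \<in> U \<Longrightarrow> \<exists>c\<in>A. \<exists>d\<in>B. \<exists>W. open W \<and> q \<in> W \<and> W \<subseteq> chart_dom c d UNIV f \<and>
      smooth_on (snd c ` W) (\<lambda>x. to_chart B d (f (chart_inv c x)) (Z (chart_inv c x)))"
  shows "smooth_field_along A B f U Z"
  unfolding smooth_field_along_def
proof (intro ballI smooth_on_local)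
  fix c' d' x
  assume c': "c' \<in> A" and d': "d' \<in> B" and "x \<in> snd c' ` (U \<inter> fst c' \<inter> f -` fst d')"
  then obtain q where q: "q \<in> U" "q \<in> fst c'" "f q \<in> fst d'" "x = snd c' q" by blast
  obtain c d W where c: "c \<in> A" and d: "d \<in> B" and W: "open W" "q \<in> W" "W \<subseteq> chart_dom c d UNIV f"
    and sm: "smooth_on (snd c ` W) (\<lambda>x. to_chart B d (f (chart_inv c x)) (Z (chart_inv c x)))"
    using loc[OF q(1)] by blast
  define V where "V = W \<inter> chart_dom c' d' UNIV f"
  have V: "open V" "q \<in> V"
    using W open_chart_dom[OF A B c' d' open_UNIV] f q by (auto simp: V_def smooth_map_on_def chart_dom_def)
  let ?T = "snd c' ` V"
  have T: "open ?T" by (rule open_chart_image[OF A c' V(1)]) (auto simp: V_def chart_dom_def)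
  have Vin: "r \<in> fst c'" "r \<in> fst c" "f r \<in> fst d" "f r \<in> fst d'" "r \<in> W" if "r \<in> V" for r
    using that W(3) by (auto simp: V_def chart_dom_def)
  let ?\<psi> = "snd d' \<circ> id \<circ> chart_inv d" and ?F = "snd d \<circ> f \<circ> chart_inv c'" and ?\<phi> = "snd c \<circ> id \<circ> chart_inv c'"
  have "smooth_on ?T (\<lambda>x. frechet_derivative ?\<psi> (at (?F x)) (to_chart B d (f (chart_inv c (?\<phi> x))) (Z (chart_inv c (?\<phi> x)))))"
  proof (rule smooth_on_linear_family[where M="\<lambda>x. frechet_derivative ?\<psi> (at (?F x))"
        and w="\<lambda>x. to_chart B d (f (chart_inv c (?\<phi> x))) (Z (chart_inv c (?\<phi> x)))", OF T])
    have FT: "?F ` ?T \<subseteq> snd d ` (fst d \<inter> fst d')"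
    proof
      fix y assume "y \<in> ?F ` ?T"
      then obtain r where r: "r \<in> V" "y = ?F (snd c' r)" by blast
      then show "y \<in> snd d ` (fst d \<inter> fst d')" using Vin[OF r(1)] by (simp add: chart_inv_chart[OF A c'])
    qed
    have F: "smooth_on ?T ?F"
      by (rule smooth_on_subset[OF smooth_map_rep[OF f c' d]]) (use Vin in \<open>auto simp: chart_dom_def\<close>)
    have dd: "open (snd d ` (fst d \<inter> fst d'))"
      by (rule open_chart_image[OF B d open_Int[OF atlas_chart(1)[OF B d] atlas_chart(1)[OF B d']]]) simp
    show "linear (frechet_derivative ?\<psi> (at (?F x)))" if "x \<in> ?T" for x
      by (rule smooth_on_linear_derivative[OF smooth_transition[OF B d d']]) (use FT that in blast)
    show "smooth_on ?T (\<lambda>x. frechet_derivative ?\<psi> (at (?F x)) b)" for b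
      by (rule smooth_on_compose[OF T dd FT F smooth_on_derivative[OF smooth_transition[OF B d d']]])
    have \<phi>: "smooth_on ?T ?\<phi>"
      by (rule smooth_on_subset[OF smooth_transition[OF A c' c]]) (use Vin in auto)
    have \<phi>W: "?\<phi> ` ?T \<subseteq> snd c ` W"
    proof
      fix y assume "y \<in> ?\<phi> ` ?T"
      then obtain r where r: "r \<in> V" "y = ?\<phi> (snd c' r)" by blast
      then show "y \<in> snd c ` W" using Vin[OF r(1)] by (simp add: chart_inv_chart[OF A c'])
    qed
    have oW: "open (snd c ` W)"
      by (rule open_chart_image[OF A c W(1)]) (use W(3) in \<open>auto simp: chart_dom_def\<close>)
    show "smooth_on ?T (\<lambda>x. to_chart B d (f (chart_inv c (?\<phi> x))) (Z (chart_inv c (?\<phi> x))))"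
      by (rule smooth_on_compose[OF T oW \<phi>W \<phi> sm])
  qed
  then have "smooth_on ?T (\<lambda>x. to_chart B d' (f (chart_inv c' x)) (Z (chart_inv c' x)))"
  proof (rule smooth_on_cong[OF T, rotated])
    fix x assume "x \<in> ?T"
    then obtain r where r: "r \<in> V" "x = snd c' r" by blast
    note rin = Vin[OF r(1)]
    have "frechet_derivative ?\<psi> (at (?F x)) = map_deriv d d' id (f r)"
      using rin by (simp add: map_deriv_def r chart_inv_chart[OF A c'])
    then show "frechet_derivative ?\<psi> (at (?F x)) (to_chart B d (f (chart_inv c (?\<phi> x))) (Z (chart_inv c (?\<phi> x)))) =
        to_chart B d' (f (chart_inv c' x)) (Z (chart_inv c' x))"
      using transition_to_chart[OF B d d' rin(3,4)] rin
      by (simp add: r chart_inv_chart[OF A c'] chart_inv_chart[OF A c])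
  qed
  then show "\<exists>T. open T \<and> x \<in> T \<and> smooth_on T (\<lambda>x. to_chart B d' (f (chart_inv c' x)) (Z (chart_inv c' x)))"
    using T V q by blast
qed


section \<open>Real hypersurfaces of Kaehler manifolds\<close>

locale kaehler_hypersurface =
  fixes A :: "('m::{t2_space,second_countable_topology}, 'a::euclidean_space) chart set"
    and B :: "('n::{t2_space,second_countable_topology}, 'b::euclidean_space) chart set"
    and f :: "'m \<Rightarrow> 'n" and g :: "'n \<Rightarrow> 'b \<Rightarrow> 'b \<Rightarrow> real" and J :: "'n \<Rightarrow> 'b \<Rightarrow> 'b"
  assumes kaehler: "kaehler_manifold B g J" and hypersurface: "real_hypersurface A B f"
begin

lemma atlasA: "smooth_atlas A" and smooth_f: "smooth_map_on A B UNIV f"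
  and inj_df: "inj (differential A B f p)" and codim: "DIM('a) + 1 = DIM('b)"
  using hypersurface unfolding real_hypersurface_def by blast+

lemma atlasB: "smooth_atlas B" and metricB: "riemannian_metric B g"
  and endoJ: "smooth_endomorphism_field B J" and J_J: "J q (J q u) = - u"
  and J_isometry: "g q (J q u) (J q v) = g q u v"
  and parallelJ: "open U \<Longrightarrow> smooth_field_along B B id U Y \<Longrightarrow> q \<in> U \<Longrightarrow>
    cov_deriv B B g id (\<lambda>q. J q (Y q)) q u = J q (cov_deriv B B g id Y q u)"
  using kaehler unfolding kaehler_manifold_def by blast+

lemma inner_g: "inner_form (g q)"
  by (rule riemannian_inner_form[OF metricB])

lemma linear_J: "linear (J q)"
  using endoJ by (simp add: smooth_endomorphism_field_def)

lemma J_skew: "g q (J q u) v = - g q u (J q v)"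
  using J_isometry[of q u "J q v"] by (simp add: J_J bilinear_rneg[OF inner_form_bilinear[OF inner_g]])

lemma linear_df: "linear (differential A B f p)"
  by (rule linear_differential[OF atlasA atlasB smooth_f]) simp

lemma open_dom: "c \<in> A \<Longrightarrow> d \<in> B \<Longrightarrow> open U \<Longrightarrow> open (snd c ` chart_dom c d U f)"
  by (rule open_chart_image[OF atlasA _ open_chart_dom[OF atlasA atlasB]])
     (use smooth_f in \<open>auto simp: chart_dom_def smooth_map_on_def intro: continuous_on_subset\<close>)

abbreviation F :: "('m, 'a) chart \<Rightarrow> ('n, 'b) chart \<Rightarrow> 'a \<Rightarrow> 'b" where
  "F c d \<equiv> snd d \<circ> f \<circ> chart_inv c"

lemma smooth_F:
  assumes "c \<in> A" "d \<in> B"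
  shows "smooth_on (snd c ` chart_dom c d U f) (F c d)"
  by (rule smooth_on_subset[OF smooth_map_rep[OF smooth_f assms]]) (auto simp: chart_dom_def)

lemma F_image:
  assumes "c \<in> A" "d \<in> B"
  shows "F c d ` snd c ` chart_dom c d U f \<subseteq> snd d ` fst d"
  using chart_inv_chart[OF atlasA assms(1)] by (auto simp: chart_dom_def)

lemma F_chart: "c \<in> A \<Longrightarrow> q \<in> fst c \<Longrightarrow> F c d (snd c q) = snd d (f q)"
  by (simp add: chart_inv_chart[OF atlasA])

lemma df_from_chart:
  assumes "c \<in> A" "d \<in> B" "q \<in> chart_dom c d U f"
  shows "differential A B f q (from_chart A c q u) = from_chart B d (f q) (frechet_derivative (F c d) (at (snd c q)) u)"
  using differential_from_chart[OF atlasA assms(1) atlasB assms(2) smooth_f open_UNIV, of q u] assms(3)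
  by (simp add: chart_dom_def map_deriv_def)

lemma metric_from_chart:
  assumes "d \<in> B" "q \<in> fst d"
  shows "g q (from_chart B d q u) (from_chart B d q v) = metric_in_chart B g d (snd d q) u v"
  by (simp add: metric_in_chart_def chart_inv_chart[OF atlasB assms])

lemma metric_along_smooth:
  assumes c: "c \<in> A" "d \<in> B" and U: "open U"
    and \<alpha>: "smooth_on (snd c ` chart_dom c d U f) \<alpha>" and \<beta>: "smooth_on (snd c ` chart_dom c d U f) \<beta>"
  shows "smooth_on (snd c ` chart_dom c d U f) (\<lambda>x. metric_in_chart B g d (F c d x) (\<alpha> x) (\<beta> x))"
proof (rule smooth_on_bilinear_family[OF open_dom[OF c U] _ _ \<alpha> \<beta>])
  show "bilinear (metric_in_chart B g d (F c d x))" if "x \<in> snd c ` chart_dom c d U f" for x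
    by (rule inner_form_bilinear[OF metric_in_chart_inner_form[OF atlasB c(2) inner_g]])
       (use F_image[OF c] that in blast)
  show "smooth_on (snd c ` chart_dom c d U f) (\<lambda>x. metric_in_chart B g d (F c d x) v w)" for v w
    by (rule smooth_on_compose[OF open_dom[OF c U] atlas_chart(2)[OF atlasB c(2)] F_image[OF c] smooth_F[OF c]
          metric_in_chart_smooth[OF metricB c(2)]])
qed

abbreviation h :: "'m \<Rightarrow> 'a \<Rightarrow> 'a \<Rightarrow> real" where
  "h \<equiv> induced_metric A B f g"

lemma inner_h: "inner_form (h p)"
  unfolding induced_metric_def[abs_def] by (rule inner_form_pullback[OF inner_g linear_df inj_df])

lemma h_in_chart:
  assumes c: "c \<in> A" "d \<in> B" and x: "x \<in> snd c ` chart_dom c d U f"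
  shows "metric_in_chart A h c x v w = metric_in_chart B g d (F c d x)
    (frechet_derivative (F c d) (at x) v) (frechet_derivative (F c d) (at x) w)"
proof -
  from x obtain q where q: "q \<in> chart_dom c d U f" "x = snd c q" by blast
  then have q': "q \<in> fst c" "f q \<in> fst d" by (auto simp: chart_dom_def)
  show ?thesis
    using q' by (simp add: metric_in_chart_def[of A] q(2) chart_inv_chart[OF atlasA c(1)] induced_metric_def
        df_from_chart[OF c q(1)] metric_from_chart[OF c(2)])
qed

lemma riemannian_h: "riemannian_metric A h"
  unfolding riemannian_metric_def
proof (intro conjI allI ballI impI)
  show "bilinear (h p)" "h p u v = h p v u" "u \<noteq> 0 \<Longrightarrow> 0 < h p u u" for p u v
    using inner_h[of p] unfolding inner_form_def by blast+
  fix c v w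
  assume c: "c \<in> A"
  show "smooth_on (snd c ` fst c) (\<lambda>x. metric_in_chart A h c x v w)"
  proof (rule smooth_on_local)
    fix x
    assume "x \<in> snd c ` fst c"
    then obtain q where q: "q \<in> fst c" "x = snd c q" by blast
    let ?d = "chart_at B (f q)"
    note d = chart_at_in[OF atlasB, of "f q"]
    let ?O = "snd c ` chart_dom c ?d UNIV f"
    have "smooth_on ?O (\<lambda>x. metric_in_chart A h c x v w)"
      by (rule smooth_on_cong[OF open_dom[OF c d(1) open_UNIV] h_in_chart[OF c d(1), symmetric]
            metric_along_smooth[OF c d(1) open_UNIV smooth_on_derivative[OF smooth_F[OF c d(1)]]
              smooth_on_derivative[OF smooth_F[OF c d(1)]]]])
    moreover have "x \<in> ?O" using q d by (auto simp: chart_dom_def)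
    ultimately show "\<exists>T. open T \<and> x \<in> T \<and> smooth_on T (\<lambda>x. metric_in_chart A h c x v w)"
      using open_dom[OF c d(1) open_UNIV] by blast
  qed
qed

text \<open>The components of \<open>J\<close> in the chart \<open>d\<close>.\<close>

definition K :: "('n, 'b) chart \<Rightarrow> 'b \<Rightarrow> 'b \<Rightarrow> 'b" where
  "K d y v = to_chart B d (chart_inv d y) (J (chart_inv d y) (from_chart B d (chart_inv d y) v))"

lemma K_smooth: "d \<in> B \<Longrightarrow> smooth_on (snd d ` fst d) (\<lambda>y. K d y v)"
  using endoJ by (simp add: smooth_endomorphism_field_def K_def)

lemma K_linear:
  assumes d: "d \<in> B" and y: "y \<in> snd d ` fst d"
  shows "linear (K d y)"
  using linear_compose[OF linear_compose[OF linear_from_chart[OF atlasB d] linear_J] linear_to_chart[OF atlasB d]]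
    chart_inv_in[OF atlasB d y] by (simp add: K_def[abs_def] o_def)

lemma K_to_chart:
  assumes d: "d \<in> B" and q: "q \<in> fst d"
  shows "K d (snd d q) (to_chart B d q u) = to_chart B d q (J q u)"
  by (simp add: K_def chart_inv_chart[OF atlasB d q] from_to_chart[OF atlasB d q])

text \<open>The hypothesis that \<open>J\<close> is parallel speaks of smooth fields on open subsets of the ambient manifold. Testing it on the fields with
  constant components in the preferred chart gives the coordinate form, which applies to fields along the hypersurface.\<close>

lemma K_parallel:
  fixes q :: 'n
  defines "d \<equiv> chart_at B q"
  shows "frechet_derivative (\<lambda>y. K d y v) (at (snd d q)) u + christoffel B g d (snd d q) u (K d (snd d q) v) =
    K d (snd d q) (christoffel B g d (snd d q) u v)"
proof -
  note d = chart_at_in[OF atlasB, of q, folded d_def]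
  define Y where "Y = (\<lambda>r. from_chart B d r v)"
  have "smooth_field_along B B id (fst d) Y"
  proof (rule smooth_field_along_local[OF atlasB atlasB smooth_map_on_id[OF atlasB]])
    fix r
    assume r: "r \<in> fst d"
    have "smooth_on (snd d ` fst d) (\<lambda>x. to_chart B d (id (chart_inv d x)) (Y (chart_inv d x)))"
      by (rule smooth_on_cong[OF atlas_chart(2)[OF atlasB d(1)] _ smooth_on_const[OF atlas_chart(2)[OF atlasB d(1)], of v]])
         (simp add: Y_def to_from_chart[OF atlasB d(1)] chart_inv_in[OF atlasB d(1)])
    then show "\<exists>c\<in>B. \<exists>d\<in>B. \<exists>W. open W \<and> r \<in> W \<and> W \<subseteq> chart_dom c d UNIV id \<and>
      smooth_on (snd c ` W) (\<lambda>x. to_chart B d (id (chart_inv c x)) (Y (chart_inv c x)))"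
      using d(1) r atlas_chart(1)[OF atlasB d(1)] by (intro bexI[of _ d] exI[of _ "fst d"]) (auto simp: chart_dom_def)
  qed
  from parallelJ[OF atlas_chart(1)[OF atlasB d(1)] this d(2), of u]
  have par: "cov_deriv B B g id (\<lambda>q. J q (Y q)) q u = J q (cov_deriv B B g id Y q u)" .
  have did: "differential B B id q u = u"
    using map_deriv_id_same[OF atlasB d] by (simp add: differential_eq d_def)
  have Kq: "K d (snd d q) w = J q w" for w
    using K_to_chart[OF d, of w] by (simp add: d_def to_chart_at[OF atlasB])
  have Yq: "Y q = v" by (simp add: Y_def d_def from_chart_at[OF atlasB])
  have "((\<lambda>x. to_chart B d (chart_inv d x) (Y (chart_inv d x))) has_derivative (\<lambda>_. 0)) (at (snd d q))"
    by (rule has_derivative_transform_within_open[OF has_derivative_const[of v] atlas_chart(2)[OF atlasB d(1)]])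
       (use d in \<open>auto simp: Y_def to_from_chart[OF atlasB d(1)] chart_inv_in[OF atlasB d(1)]\<close>)
  from frechet_derivative_at[OF this]
  have "frechet_derivative (\<lambda>x. to_chart B d (chart_inv d x) (Y (chart_inv d x))) (at (snd d q)) u = 0" by metis
  then have "cov_deriv B B g id Y q u = christoffel B g d (snd d q) u v"
    by (simp add: cov_deriv_def Let_def d_def[symmetric] did Yq)
  moreover have "cov_deriv B B g id (\<lambda>q. J q (Y q)) q u =
      frechet_derivative (\<lambda>y. K d y v) (at (snd d q)) u + christoffel B g d (snd d q) u (K d (snd d q) v)"
    by (simp add: cov_deriv_def Let_def d_def[symmetric] did Yq Kq) (simp add: K_def[abs_def] Y_def)
  ultimately show ?thesis using par Kq by simp
qed

text \<open>By dimension there is a normal vector \<open>n\<close> at the given point. Regard \<open>n\<close> as constant in coordinates and remove its tangential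
  part, which is represented by a smooth field \<open>Y\<close>; the remaining normal vector is not zero near the given point, where nothing is removed,
  and can be normalized.\<close>

lemma ex_unit_normal:
  obtains U \<zeta> where "open U" "p \<in> U" "unit_normal_on A B f g U \<zeta>"
proof -
  let ?c = "chart_at A p" and ?d = "chart_at B (f p)"
  note c = chart_at_in[OF atlasA, of p] and d = chart_at_in[OF atlasB, of "f p"]
  let ?O = "snd ?c ` chart_dom ?c ?d UNIV f"
  let ?x = "snd ?c p"
  have S: "open ?O" by (rule open_dom[OF c(1) d(1) open_UNIV])
  have x: "?x \<in> ?O" using c d by (auto simp: chart_dom_def)
  define G where "G = (\<lambda>x. metric_in_chart B g ?d (F ?c ?d x))"
  define E where "E = (\<lambda>x. frechet_derivative (F ?c ?d) (at x))"
  have G: "inner_form (G x)" if "x \<in> ?O" for x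
    unfolding G_def
    by (rule metric_in_chart_inner_form[OF atlasB d(1) inner_g]) (use F_image[OF c(1) d(1)] that in blast)
  have linE: "linear (E x)" if "x \<in> ?O" for x
    unfolding E_def by (rule smooth_on_linear_derivative[OF smooth_F[OF c(1) d(1)] that])
  have smE: "smooth_on ?O (\<lambda>x. E x v)" for v
    unfolding E_def by (rule smooth_on_derivative[OF smooth_F[OF c(1) d(1)]])
  have smG: "smooth_on ?O (\<lambda>x. G x (\<alpha> x) (\<beta> x))" if "smooth_on ?O \<alpha>" "smooth_on ?O \<beta>" for \<alpha> \<beta>
    unfolding G_def by (rule metric_along_smooth[OF c(1) d(1) open_UNIV that])
  have H: "inner_form (\<lambda>v w. G x (E x v) (E x w))" if x: "x \<in> ?O" for x
  proof -
    have "inner_form (metric_in_chart A h ?c x)"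
      by (rule metric_in_chart_inner_form[OF atlasA c(1) inner_h]) (use x in \<open>auto simp: chart_dom_def\<close>)
    moreover have "metric_in_chart A h ?c x = (\<lambda>v w. G x (E x v) (E x w))"
      using h_in_chart[OF c(1) d(1) x] by (simp add: G_def E_def fun_eq_iff)
    ultimately show ?thesis by simp
  qed
  obtain n where n: "n \<noteq> 0" "\<And>v. G ?x n (E ?x v) = 0"
  proof -
    have "dim (range (E ?x)) \<le> DIM('a)" using dim_image_le[OF linE[OF x], of UNIV] by simp
    then have "dim (range (E ?x)) < DIM('b)" using codim by simp
    then obtain m where m: "m \<noteq> 0" "\<And>y. y \<in> span (range (E ?x)) \<Longrightarrow> orthogonal m y"
      using orthogonal_to_subspace_exists by blast
    obtain n where n: "gram (G ?x) n = m" using surj_gram[OF G[OF x]] by (metis surjD)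
    have "G ?x n (E ?x v) = 0" for v
      using m(2)[of "E ?x v"] inner_gram[where G="G ?x" and z=n and w="E ?x v", OF inner_form_linear[OF G[OF x]]] n
      by (auto simp: orthogonal_def intro: span_base)
    moreover have "n \<noteq> 0"
      using m(1) n linear_0[OF linear_gram[OF inner_form_bilinear[OF G[OF x]]]] by auto
    ultimately show ?thesis using that by blast
  qed
  have "\<exists>Y. \<forall>w. G x (E x Y) (E x w) = G x n (E x w)" if x: "x \<in> ?O" for x
    using inner_form_riesz[OF H[OF x] linear_compose[OF linE[OF x] inner_form_linear[OF G[OF x], where u=n]]]
    by (metis o_apply)
  then obtain Y where Y: "\<And>x w. x \<in> ?O \<Longrightarrow> G x (E x (Y x)) (E x w) = G x n (E x w)" by metis
  have smY: "smooth_on ?O Y"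
    by (rule smooth_on_riesz[OF S H smG[OF smE smE] smG[OF smooth_on_const[OF S] smE] Y])
  define \<nu> where "\<nu> = (\<lambda>x. n - E x (Y x))"
  have sm\<nu>: "smooth_on ?O \<nu>"
    unfolding \<nu>_def by (intro smooth_on_diff[OF S] smooth_on_const[OF S] smooth_on_linear_family[OF S linE smE smY])
  have \<nu>_normal: "G x (\<nu> x) (E x w) = 0" if "x \<in> ?O" for x w
    using Y[OF that] by (simp add: \<nu>_def bilinear_lsub[OF inner_form_bilinear[OF G[OF that]]])
  have \<nu>x: "\<nu> ?x \<noteq> 0"
  proof -
    have "Y ?x = 0"
      by (rule inner_form_eqI[OF H[OF x]])
         (simp add: Y[OF x] n linear_0[OF linE[OF x]] bilinear_lzero[OF inner_form_bilinear[OF G[OF x]]])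
    then show ?thesis using n linear_0[OF linE[OF x]] by (simp add: \<nu>_def)
  qed
  define s where "s = (\<lambda>x. G x (\<nu> x) (\<nu> x))"
  have sms: "smooth_on ?O s" unfolding s_def by (rule smG[OF sm\<nu> sm\<nu>])
  let ?V = "?O \<inter> s -` {0<..}"
  have V: "open ?V" by (rule continuous_open_preimage[OF smooth_on_continuous[OF sms] S open_greaterThan])
  have xV: "?x \<in> ?V" using x \<nu>x G[OF x] by (simp add: s_def inner_form_def)
  define Z where "Z = (\<lambda>x. (s x powr (-1/2)) *\<^sub>R \<nu> x)"
  have smZ: "smooth_on ?V Z"
    unfolding Z_def
  proof (rule smooth_on_bilinear[OF V bounded_bilinear_scaleR])
    show "smooth_on ?V (\<lambda>x. s x powr (-1/2))"
      by (rule smooth_on_compose[OF V open_greaterThan _ _ smooth_on_powr, where f=s])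
         (use smooth_on_subset[OF sms] in auto)
    show "smooth_on ?V \<nu>" by (rule smooth_on_subset[OF sm\<nu>]) auto
  qed
  have Z1: "G x (Z x) (Z x) = 1" if xV: "x \<in> ?V" for x
  proof -
    have b: "bilinear (G x)" using G xV inner_form_bilinear by blast
    have "G x (Z x) (Z x) = s x powr (-1/2) * (s x powr (-1/2) * s x)"
      by (simp add: Z_def bilinear_lmul[OF b] bilinear_rmul[OF b] s_def)
    also have "\<dots> = s x powr (-1/2) * s x powr (-1/2) * s x powr 1" using xV by simp
    also have "\<dots> = 1" using xV by (simp only: powr_add[symmetric]) simp
    finally show ?thesis .
  qed
  have Zn: "G x (Z x) (E x w) = 0" if "x \<in> ?V" for x w
    using that \<nu>_normal[of x w] bilinear_lmul[OF inner_form_bilinear[OF G[of x]]] by (simp add: Z_def)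
  define U where "U = fst ?c \<inter> snd ?c -` ?V"
  define \<zeta> where "\<zeta> = (\<lambda>q. from_chart B ?d (f q) (Z (snd ?c q)))"
  have Usub: "q \<in> chart_dom ?c ?d UNIV f \<and> q \<in> fst ?c \<and> f q \<in> fst ?d \<and> snd ?c q \<in> ?V" if "q \<in> U" for q
  proof -
    from that have q: "q \<in> fst ?c" "snd ?c q \<in> ?V" by (auto simp: U_def)
    then obtain r where r: "r \<in> chart_dom ?c ?d UNIV f" "snd ?c q = snd ?c r" by blast
    then have "r \<in> fst ?c" by (simp add: chart_dom_def)
    then have "q = r" using q(1) r(2) chart_inv_chart[OF atlasA c(1)] by metis
    then show ?thesis using r q by (auto simp: chart_dom_def)
  qed
  have cU: "snd ?c ` U = ?V" by (auto simp: U_def chart_dom_def)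
  have pU: "p \<in> U" using xV c by (simp add: U_def)
  have openU: "open U" unfolding U_def by (rule open_chart_vimage[OF atlasA c(1) V])
  have "smooth_on ?V (\<lambda>x. to_chart B ?d (f (chart_inv ?c x)) (\<zeta> (chart_inv ?c x)))"
  proof (rule smooth_on_cong[OF V _ smZ])
    fix x assume "x \<in> ?V"
    then obtain q where q: "q \<in> U" "x = snd ?c q" using cU by blast
    then show "Z x = to_chart B ?d (f (chart_inv ?c x)) (\<zeta> (chart_inv ?c x))"
      using Usub[OF q(1)] by (simp add: \<zeta>_def chart_inv_chart[OF atlasA c(1)] to_from_chart[OF atlasB d(1)])
  qed
  then have sm\<zeta>': "smooth_on (snd ?c ` U) (\<lambda>x. to_chart B ?d (f (chart_inv ?c x)) (\<zeta> (chart_inv ?c x)))"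
    unfolding cU .
  have sm\<zeta>: "smooth_field_along A B f U \<zeta>"
  proof (rule smooth_field_along_local[OF atlasA atlasB smooth_f])
    fix q
    assume "q \<in> U"
    then show "\<exists>c\<in>A. \<exists>d\<in>B. \<exists>W. open W \<and> q \<in> W \<and> W \<subseteq> chart_dom c d UNIV f \<and>
        smooth_on (snd c ` W) (\<lambda>x. to_chart B d (f (chart_inv c x)) (\<zeta> (chart_inv c x)))"
      using sm\<zeta>' openU Usub by (intro bexI[OF _ c(1)] bexI[OF _ d(1)] exI[of _ U]) blast
  qed
  have "unit_normal_on A B f g U \<zeta>"
    unfolding unit_normal_on_def
  proof (intro conjI ballI allI sm\<zeta>)
    fix q assume q: "q \<in> U"
    note Uq = Usub[OF q]
    have GF: "metric_in_chart B g ?d (snd ?d (f q)) = G (snd ?c q)"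
      using Uq by (simp add: G_def chart_inv_chart[OF atlasA c(1)])
    show "g (f q) (\<zeta> q) (\<zeta> q) = 1"
      using Uq Z1 by (simp add: \<zeta>_def metric_from_chart[OF d(1)] GF)
    fix u
    have "differential A B f q u = from_chart B ?d (f q) (E (snd ?c q) (to_chart A ?c q u))"
      using df_from_chart[OF c(1) d(1), of q UNIV "to_chart A ?c q u"] Uq
      by (simp add: E_def from_to_chart[OF atlasA c(1)])
    then show "g (f q) (\<zeta> q) (differential A B f q u) = 0"
      using Uq Zn by (simp add: \<zeta>_def metric_from_chart[OF d(1)] GF)
  qed
  then show ?thesis using that openU pU by blast
qed

end


locale hypersurface_normal = kaehler_hypersurface A B f g J
  for A :: "('m::{t2_space,second_countable_topology}, 'a::euclidean_space) chart set"
    and B :: "('n::{t2_space,second_countable_topology}, 'b::euclidean_space) chart set"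
    and f :: "'m \<Rightarrow> 'n" and g :: "'n \<Rightarrow> 'b \<Rightarrow> 'b \<Rightarrow> real" and J :: "'n \<Rightarrow> 'b \<Rightarrow> 'b" +
  fixes U :: "'m set" and \<zeta> :: "'m \<Rightarrow> 'b"
  assumes openU: "open U" and unit_normal: "unit_normal_on A B f g U \<zeta>"
begin

lemma smooth_normal: "smooth_field_along A B f U \<zeta>"
  and normal_unit: "p \<in> U \<Longrightarrow> g (f p) (\<zeta> p) (\<zeta> p) = 1"
  and normal_df: "p \<in> U \<Longrightarrow> g (f p) (\<zeta> p) (differential A B f p u) = 0"
  using unit_normal by (auto simp: unit_normal_on_def)

lemma df_normal: "p \<in> U \<Longrightarrow> g (f p) (differential A B f p u) (\<zeta> p) = 0"
  using normal_df inner_form_commute[OF inner_g] by metis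

text \<open>The tangent space and the normal span a space of full dimension, so the tangent space is the whole orthogonal complement of the normal.\<close>

lemma tangent_if_orthogonal:
  assumes p: "p \<in> U" and v: "g (f p) (\<zeta> p) v = 0"
  shows "\<exists>w. differential A B f p w = v"
proof -
  let ?L = "differential A B f p"
  note b = inner_form_bilinear[OF inner_g, of "f p"]
  have sub: "subspace (range ?L)" using linear_subspace_image[OF linear_df subspace_UNIV] .
  have "\<zeta> p \<notin> range ?L"
    using normal_unit[OF p] normal_df[OF p] by (metis imageE zero_neq_one)
  then have "\<zeta> p \<notin> span (range ?L)" using span_eq_iff sub by blast
  then have "dim (insert (\<zeta> p) (range ?L)) = dim (range ?L) + 1" by (simp add: dim_insert)
  also have "dim (range ?L) = DIM('a)" using dim_image_eq[OF linear_df, of p UNIV] inj_df by simp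
  finally have "span (insert (\<zeta> p) (range ?L)) = UNIV" using codim by (simp add: dim_eq_full)
  then have "v \<in> span (insert (\<zeta> p) (range ?L))" by simp
  then obtain k where "v - k *\<^sub>R \<zeta> p \<in> span (range ?L)" unfolding span_breakdown_eq by blast
  then have "v - k *\<^sub>R \<zeta> p \<in> range ?L" using span_eq_iff sub by blast
  then obtain w where w: "?L w = v - k *\<^sub>R \<zeta> p" by (metis imageE)
  have "k = 0"
    using normal_df[OF p, of w] unfolding w by (simp add: bilinear_rsub[OF b] bilinear_rmul[OF b] v normal_unit[OF p])
  then show ?thesis using w by auto
qed

text \<open>The definite descriptions in the definitions of \<open>\<xi>\<close>, \<open>\<phi>\<close> and the shape operator reduce to this one.\<close>

lemma the_tangent:
  assumes p: "p \<in> U" and v: "g (f p) (\<zeta> p) v = 0"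
  shows "differential A B f p (THE w. differential A B f p w = v) = v"
proof (rule theI')
  show "\<exists>!w. differential A B f p w = v"
    using tangent_if_orthogonal[OF assms] inj_df by (metis injD)
qed

abbreviation \<xi> :: "'m \<Rightarrow> 'a" where "\<xi> \<equiv> reeb_field A B f J \<zeta>"
abbreviation \<eta> :: "'m \<Rightarrow> 'a \<Rightarrow> real" where "\<eta> \<equiv> contact_form A B f g J \<zeta>"
abbreviation \<phi> :: "'m \<Rightarrow> 'a \<Rightarrow> 'a" where "\<phi> \<equiv> structure_tensor A B f g J \<zeta>"
abbreviation shape :: "'m \<Rightarrow> 'a \<Rightarrow> 'a" where "shape \<equiv> shape_operator A B f g \<zeta>"
abbreviation df :: "'m \<Rightarrow> 'a \<Rightarrow> 'b" where "df \<equiv> differential A B f"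

lemma g_neg: "g q (- u) v = - g q u v" "g q u (- v) = - g q u v"
  by (simp_all add: bilinear_lneg[OF inner_form_bilinear[OF inner_g]] bilinear_rneg[OF inner_form_bilinear[OF inner_g]])

lemma df_reeb:
  assumes "p \<in> U"
  shows "df p (\<xi> p) = - J (f p) (\<zeta> p)"
proof -
  have "g (f p) (\<zeta> p) (J (f p) (\<zeta> p)) = 0"
    using J_skew[of "f p" "\<zeta> p" "\<zeta> p"] inner_form_commute[OF inner_g, of "f p" "J (f p) (\<zeta> p)" "\<zeta> p"] by simp
  then show ?thesis unfolding reeb_field_def by (intro the_tangent[OF assms]) (simp add: g_neg)
qed

lemma contact_form_eq: "p \<in> U \<Longrightarrow> \<eta> p u = - g (f p) (df p u) (J (f p) (\<zeta> p))"
  by (simp add: contact_form_def induced_metric_def df_reeb g_neg)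

lemma df_structure:
  assumes p: "p \<in> U"
  shows "J (f p) (df p u) = df p (\<phi> p u) + \<eta> p u *\<^sub>R \<zeta> p"
proof -
  note b = inner_form_bilinear[OF inner_g, of "f p"]
  let ?v = "J (f p) (df p u) - \<eta> p u *\<^sub>R \<zeta> p"
  have "g (f p) (\<zeta> p) (J (f p) (df p u)) = \<eta> p u"
    using J_skew[of "f p" "df p u" "\<zeta> p"] inner_form_commute[OF inner_g, of "f p" "\<zeta> p"]
    by (simp add: contact_form_eq[OF p])
  then have "g (f p) (\<zeta> p) ?v = 0"
    by (simp add: bilinear_rsub[OF b] bilinear_rmul[OF b] normal_unit[OF p])
  from the_tangent[OF p this] have "df p (THE w. df p w = ?v) = ?v" .
  moreover have "\<phi> p u = (THE w. df p w = ?v)"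
    unfolding structure_tensor_def by (rule arg_cong[where f=The]) (auto simp: fun_eq_iff algebra_simps)
  ultimately show ?thesis by simp
qed

text \<open>The normal component of \<open>J\<close> applied to a tangent vector \<open>u\<close> is \<open>\<eta> u\<close>.\<close>

lemma complex_subbundle_eq:
  assumes p: "p \<in> U"
  shows "maximal_complex_subbundle A B f J p = {u. \<eta> p u = 0}"
proof (intro set_eqI iffI)
  fix u
  assume "u \<in> maximal_complex_subbundle A B f J p"
  then obtain w where "df p u = J (f p) (df p w)" unfolding maximal_complex_subbundle_def by blast
  then show "u \<in> {u. \<eta> p u = 0}" by (simp add: contact_form_eq[OF p] J_isometry df_normal[OF p])
next
  fix u
  assume "u \<in> {u. \<eta> p u = 0}"
  then have "J (f p) (df p u) = df p (\<phi> p u)" using df_structure[OF p, of u] by simp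
  then have "J (f p) (df p (\<phi> p u)) = - df p u" by (metis J_J)
  then have "df p u = J (f p) (df p (- \<phi> p u))"
    by (simp add: linear_neg[OF linear_df] linear_neg[OF linear_J])
  then show "u \<in> maximal_complex_subbundle A B f J p" unfolding maximal_complex_subbundle_def by blast
qed

lemma reeb_unit: "p \<in> U \<Longrightarrow> h p (\<xi> p) (\<xi> p) = 1"
  by (simp add: induced_metric_def df_reeb g_neg J_isometry normal_unit)

text \<open>The components of the unit normal in the chart \<open>d\<close> of the ambient manifold, at points given in the chart \<open>c\<close>.\<close>

definition Z :: "('m, 'a) chart \<Rightarrow> ('n, 'b) chart \<Rightarrow> 'a \<Rightarrow> 'b" where
  "Z c d x = to_chart B d (f (chart_inv c x)) (\<zeta> (chart_inv c x))"

lemma Z_smooth: "c \<in> A \<Longrightarrow> d \<in> B \<Longrightarrow> smooth_on (snd c ` chart_dom c d U f) (Z c d)"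
  using smooth_normal unfolding smooth_field_along_def chart_dom_def Z_def[abs_def] by blast

lemma contact_form_in_chart:
  assumes c: "c \<in> A" "d \<in> B" and x: "x \<in> snd c ` chart_dom c d U f"
  shows "\<eta> (chart_inv c x) (from_chart A c (chart_inv c x) w) =
    - metric_in_chart B g d (F c d x) (frechet_derivative (F c d) (at x) w) (K d (F c d x) (Z c d x))"
proof -
  from x obtain q where q: "q \<in> chart_dom c d U f" "x = snd c q" by blast
  then have q': "q \<in> U" "q \<in> fst c" "f q \<in> fst d" by (auto simp: chart_dom_def)
  have "K d (F c d x) (Z c d x) = to_chart B d (f q) (J (f q) (\<zeta> q))"
    using q' by (simp add: q(2) Z_def chart_inv_chart[OF atlasA c(1)] K_to_chart[OF c(2)])
  moreover have "J (f q) (\<zeta> q) = from_chart B d (f q) (to_chart B d (f q) (J (f q) (\<zeta> q)))"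
    using q' by (simp add: from_to_chart[OF atlasB c(2)])
  ultimately show ?thesis
    using q' by (simp add: q(2) chart_inv_chart[OF atlasA c(1)] contact_form_eq df_from_chart[OF c q(1)])
       (metis metric_from_chart[OF c(2)])
qed

text \<open>The Reeb field represents the contact form with respect to the induced metric, and the contact form is smooth because \<open>\<zeta>\<close>, \<open>J\<close> and the metric are.\<close>

lemma reeb_smooth: "smooth_field_along A A id U \<xi>"
proof (rule smooth_field_along_local[OF atlasA atlasA smooth_map_on_id[OF atlasA]])
  fix q
  assume q: "q \<in> U"
  let ?c = "chart_at A q" and ?d = "chart_at B (f q)"
  note c = chart_at_in[OF atlasA, of q] and d = chart_at_in[OF atlasB, of "f q"]
  let ?W = "chart_dom ?c ?d U f"
  let ?S = "snd ?c ` ?W"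
  have S: "open ?S" by (rule open_dom[OF c(1) d(1) openU])
  have W: "open ?W"
    by (rule open_chart_dom[OF atlasA atlasB c(1) d(1) openU])
       (use smooth_f in \<open>auto simp: smooth_map_on_def intro: continuous_on_subset\<close>)
  define X where "X = (\<lambda>x. to_chart A ?c (chart_inv ?c x) (\<xi> (chart_inv ?c x)))"
  have Sc: "?S \<subseteq> snd ?c ` fst ?c" by (auto simp: chart_dom_def)
  have "smooth_on ?S X"
  proof (rule smooth_on_riesz[OF S])
    show "inner_form (metric_in_chart A h ?c y)" if "y \<in> ?S" for y
      by (rule metric_in_chart_inner_form[OF atlasA c(1) inner_h]) (use Sc that in blast)
    show "smooth_on ?S (\<lambda>y. metric_in_chart A h ?c y u v)" for u v
      by (rule smooth_on_subset[OF metric_in_chart_smooth[OF riemannian_h c(1)] Sc])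
    show "smooth_on ?S (\<lambda>x. - metric_in_chart B g ?d (F ?c ?d x) (frechet_derivative (F ?c ?d) (at x) w)
        (K ?d (F ?c ?d x) (Z ?c ?d x)))" for w
    proof (rule smooth_on_minus[OF S metric_along_smooth[OF c(1) d(1) openU smooth_on_derivative[OF smooth_F[OF c(1) d(1)]]]])
      show "smooth_on ?S (\<lambda>x. K ?d (F ?c ?d x) (Z ?c ?d x))"
      proof (rule smooth_on_linear_family[where M="\<lambda>x. K ?d (F ?c ?d x)", OF S _ _ Z_smooth[OF c(1) d(1)]])
        show "linear (K ?d (F ?c ?d x))" if "x \<in> ?S" for x
          by (rule K_linear[OF d(1)]) (use F_image[OF c(1) d(1)] that in blast)
        show "smooth_on ?S (\<lambda>x. K ?d (F ?c ?d x) b)" for b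
          by (rule smooth_on_compose[OF S atlas_chart(2)[OF atlasB d(1)] F_image[OF c(1) d(1)] smooth_F[OF c(1) d(1)] K_smooth[OF d(1)]])
      qed
    qed
    fix y w
    assume y: "y \<in> ?S"
    then obtain r where r: "r \<in> ?W" "y = snd ?c r" by blast
    then have r': "r \<in> U" "r \<in> fst ?c" by (auto simp: chart_dom_def)
    show "metric_in_chart A h ?c y (X y) w = - metric_in_chart B g ?d (F ?c ?d y)
        (frechet_derivative (F ?c ?d) (at y) w) (K ?d (F ?c ?d y) (Z ?c ?d y))"
      unfolding contact_form_in_chart[OF c(1) d(1) y, symmetric]
      using r' by (simp add: r(2) X_def metric_in_chart_def chart_inv_chart[OF atlasA c(1)]
          from_to_chart[OF atlasA c(1)] contact_form_def inner_form_commute[OF inner_h])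
  qed
  then show "\<exists>c\<in>A. \<exists>d\<in>A. \<exists>W. open W \<and> q \<in> W \<and> W \<subseteq> chart_dom c d UNIV id \<and>
      smooth_on (snd c ` W) (\<lambda>x. to_chart A d (id (chart_inv c x)) (\<xi> (chart_inv c x)))"
    using W q c d by (intro bexI[of _ ?c] exI[of _ ?W]) (auto simp: chart_dom_def X_def)
qed

sublocale reeb: unit_field A h U \<xi>
  by unfold_locales (use atlasA riemannian_h openU reeb_smooth reeb_unit in auto)

lemma dual_eq: "reeb.dual = \<eta>"
  by (simp add: fun_eq_iff reeb.dual_def contact_form_def)

text \<open>In the preferred charts at \<open>p\<close> and \<open>f p\<close> the contact form is the one of \<open>form_deriv_parallel\<close>, with \<open>N u = - A u\<close> the derivative of
  the unit normal. This gives \<open>d\<eta>(u, v) = g(v, J A u) - g(u, J A v)\<close>. In the first term only the tangential part \<open>\<phi> A u\<close> of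
  \<open>J A u\<close> matters. In the second term \<open>J\<close> moves to \<open>u\<close> as it is skew, and then \<open>A\<close> moves to \<open>\<phi> u\<close> as it is self-adjoint.\<close>

lemma ext_deriv_contact_form:
  assumes p: "p \<in> U"
  shows "ext_deriv A \<eta> p u v = h p v (shape p (\<phi> p u) + \<phi> p (shape p u))"
proof -
  let ?c = "chart_at A p" and ?d = "chart_at B (f p)"
  note c = chart_at_in[OF atlasA, of p] and d = chart_at_in[OF atlasB, of "f p"]
  let ?S = "snd ?c ` chart_dom ?c ?d U f" and ?T = "snd ?d ` fst ?d"
  let ?x = "snd ?c p"
  let ?G = "metric_in_chart B g ?d"
  let ?\<Gamma> = "christoffel B g ?d (snd ?d (f p))"
  have pd: "p \<in> chart_dom ?c ?d U f" using p c d by (auto simp: chart_dom_def)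
  have S: "open ?S" "?x \<in> ?S" using open_dom[OF c(1) d(1) openU] pd by auto
  have Fx: "F ?c ?d ?x = snd ?d (f p)" by (rule F_chart[OF c])
  have T: "snd ?d (f p) \<in> ?T" using d by blast
  interpret am: along_map ?S ?T "F ?c ?d" ?G ?\<Gamma> ?x
  proof
    show "inner_form (?G y)" if "y \<in> ?T" for y
      by (rule metric_in_chart_inner_form[OF atlasB d(1) inner_g that])
    show "levi_civita_at ?G (F ?c ?d ?x) ?\<Gamma>"
      unfolding Fx by (rule christoffel_levi_civita[OF atlasB d(1) metricB T])
  qed (use S atlas_chart(2)[OF atlasB d(1)] F_image[OF c(1) d(1)] smooth_F[OF c(1) d(1)]
      metric_in_chart_smooth[OF metricB d(1)] in auto)
  have Gp: "?G (F ?c ?d ?x) = g (f p)"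
    unfolding Fx by (simp add: fun_eq_iff metric_in_chart_def chart_inv_chart[OF atlasB d] from_chart_at[OF atlasB])
  have Kp: "K ?d (F ?c ?d ?x) = J (f p)"
    unfolding Fx by (simp add: fun_eq_iff K_def chart_inv_chart[OF atlasB d] from_chart_at[OF atlasB] to_chart_at[OF atlasB])
  have Zp: "Z ?c ?d ?x = \<zeta> p"
    by (simp add: Z_def chart_inv_chart[OF atlasA c] to_chart_at[OF atlasB])
  have Dp: "am.D = df p"
    by (simp add: differential_eq map_deriv_def)
  define N where "N = am.nabla (Z ?c ?d)"
  have N: "cov_deriv A B g f \<zeta> p u = N u" for u
    unfolding N_def am.nabla_def cov_deriv_def Let_def Zp Dp
    by (simp add: Z_def[abs_def] chart_inv_chart[OF atlasA c])
  have smZ: "smooth_on ?S (Z ?c ?d)" by (rule Z_smooth[OF c(1) d(1)])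
  have dZ: "Z ?c ?d differentiable (at ?x)" by (rule smooth_on_differentiable[OF smZ S(2)])
  have Zq: "?G (F ?c ?d z) (Z ?c ?d z) w = g (f (chart_inv ?c z)) (\<zeta> (chart_inv ?c z)) (from_chart B ?d (f (chart_inv ?c z)) w)"
    if "z \<in> ?S" for z w
  proof -
    from that obtain q where q: "q \<in> chart_dom ?c ?d U f" "z = snd ?c q" by blast
    then have q': "q \<in> fst ?c" "f q \<in> fst ?d" by (auto simp: chart_dom_def)
    then show ?thesis
      by (simp add: q(2) Z_def chart_inv_chart[OF atlasA c(1)] metric_in_chart_def chart_inv_chart[OF atlasB d(1)]
          from_to_chart[OF atlasB d(1)])
  qed
  have ZZ: "?G (F ?c ?d z) (Z ?c ?d z) (Z ?c ?d z) = 1" if z: "z \<in> ?S" for z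
  proof -
    from z obtain q where q: "q \<in> chart_dom ?c ?d U f" "z = snd ?c q" by blast
    then have q': "q \<in> U" "q \<in> fst ?c" "f q \<in> fst ?d" by (auto simp: chart_dom_def)
    then show ?thesis
      unfolding Zq[OF z] by (simp add: q(2) Z_def chart_inv_chart[OF atlasA c(1)] from_to_chart[OF atlasB d(1)] normal_unit)
  qed
  have ZD: "?G (F ?c ?d z) (Z ?c ?d z) (frechet_derivative (F ?c ?d) (at z) w) = 0" if z: "z \<in> ?S" for z w
  proof -
    from z obtain q where q: "q \<in> chart_dom ?c ?d U f" "z = snd ?c q" by blast
    then have q': "q \<in> U" "q \<in> fst ?c" "f q \<in> fst ?d" by (auto simp: chart_dom_def)
    then show ?thesis
      unfolding Zq[OF z] using df_from_chart[OF c(1) d(1) q(1), of w] normal_df[OF q'(1)]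
      by (simp add: q(2) chart_inv_chart[OF atlasA c(1)]) (metis)
  qed
  have N_orth: "g (f p) (N u) (\<zeta> p) = 0" for u
    by (rule am.nabla_unit_orthogonal[OF dZ ZZ, unfolded Gp Zp, folded N_def])
  have N_sym: "g (f p) (N u) (df p v) = g (f p) (N v) (df p u)" for u v
    by (rule am.second_fundamental_form_symmetric[OF dZ ZD, unfolded Gp Dp, folded N_def])
  have shape: "df p (shape p u) = - N u" for u
    unfolding shape_operator_def N
    by (rule the_tangent[OF p]) (use N_orth[of u] inner_form_commute[OF inner_g] in \<open>simp add: g_neg\<close>)
  have "ext_deriv A \<eta> p u v = form_deriv (\<lambda>x w. \<eta> (chart_inv ?c x) (from_chart A ?c (chart_inv ?c x) w)) ?x u v"
    by (simp add: ext_deriv_def form_deriv_def Let_def)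
  also have "\<dots> = form_deriv (\<lambda>z w. - ?G (F ?c ?d z) (frechet_derivative (F ?c ?d) (at z) w) (K ?d (F ?c ?d z) (Z ?c ?d z))) ?x u v"
  proof (rule form_deriv_cong[OF S contact_form_in_chart[OF c(1) d(1)]])
    show "(\<lambda>x. \<eta> (chart_inv ?c x) (from_chart A ?c (chart_inv ?c x) w)) differentiable at ?x" for w
      using smooth_on_differentiable[OF reeb.dual_in_smooth[OF c(1)] reeb.chart_at_domain[OF p], of w]
      by (simp add: reeb.dual_in_def dual_eq)
  qed
  also have "\<dots> = ?G (F ?c ?d ?x) (am.D u) (K ?d (F ?c ?d ?x) (am.nabla (Z ?c ?d) v)) -
      ?G (F ?c ?d ?x) (am.D v) (K ?d (F ?c ?d ?x) (am.nabla (Z ?c ?d) u))"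
    by (rule am.form_deriv_parallel[OF smZ K_linear[OF d(1)] K_smooth[OF d(1)]])
       (auto simp: Fx[unfolded o_def] Fx K_parallel)
  also have "\<dots> = g (f p) (df p u) (J (f p) (N v)) - g (f p) (df p v) (J (f p) (N u))"
    by (simp only: Gp Kp Dp N_def)
  finally have ext: "ext_deriv A \<eta> p u v = g (f p) (df p u) (J (f p) (N v)) - g (f p) (df p v) (J (f p) (N u))" .
  note b = inner_form_bilinear[OF inner_g, of "f p"]
  have "J (f p) (N u) = - (df p (\<phi> p (shape p u)) + \<eta> p (shape p u) *\<^sub>R \<zeta> p)"
  proof -
    have "- J (f p) (N u) = df p (\<phi> p (shape p u)) + \<eta> p (shape p u) *\<^sub>R \<zeta> p"
      using df_structure[OF p, of "shape p u"] by (simp add: shape linear_neg[OF linear_J])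
    then show ?thesis by (metis minus_minus)
  qed
  then have 1: "g (f p) (df p v) (J (f p) (N u)) = - h p v (\<phi> p (shape p u))"
    by (simp add: g_neg bilinear_rsub[OF b] bilinear_rmul[OF b] df_normal[OF p] induced_metric_def)
  have "g (f p) (df p u) (J (f p) (N v)) = - g (f p) (J (f p) (df p u)) (N v)"
    by (simp add: J_skew)
  also have "\<dots> = - g (f p) (df p (\<phi> p u)) (N v)"
    using N_orth[of v] inner_form_commute[OF inner_g, of "f p" "\<zeta> p" "N v"]
    by (simp add: df_structure[OF p] bilinear_ladd[OF b] bilinear_lmul[OF b])
  also have "\<dots> = - g (f p) (N (\<phi> p u)) (df p v)"
    using N_sym[of v "\<phi> p u"] inner_form_commute[OF inner_g, of "f p" "N v"] by simp
  also have "\<dots> = h p v (shape p (\<phi> p u))"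
    using inner_form_commute[OF inner_g, of "f p" "N (\<phi> p u)"] by (simp add: induced_metric_def shape g_neg)
  finally show ?thesis
    using ext 1 by (simp add: bilinear_radd[OF inner_form_bilinear[OF inner_h]])
qed

lemma ext_deriv_zero_iff:
  assumes "p \<in> U"
  shows "(\<forall>u v. ext_deriv A \<eta> p u v = 0) \<longleftrightarrow> (\<forall>u. shape p (\<phi> p u) + \<phi> p (shape p u) = 0)"
  unfolding ext_deriv_contact_form[OF assms]
  using inner_form_eq_0[OF inner_h] bilinear_rzero[OF inner_form_bilinear[OF inner_h]] by metis

end


section \<open>The equivalence\<close>

context kaehler_hypersurface
begin

lemma normal_locale: "open U \<Longrightarrow> unit_normal_on A B f g U \<zeta> \<Longrightarrow> hypersurface_normal A B f g J U \<zeta>"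
  by unfold_locales

lemma closed_iff_anticommutes:
  "contact_form_closed A B f g J \<longleftrightarrow> shape_anticommutes_structure A B f g J"
  unfolding contact_form_closed_def shape_anticommutes_structure_def
  by (intro iff_allI imp_cong refl ball_cong hypersurface_normal.ext_deriv_zero_iff[OF normal_locale])

lemma closed_imp_hopf:
  assumes "contact_form_closed A B f g J"
  shows "hopf_hypersurface A B f g J"
  unfolding hopf_hypersurface_def
proof (intro allI impI)
  fix U \<zeta> I \<gamma>
  assume U: "open U" "unit_normal_on A B f g U \<zeta>" and I: "open I" "is_interval I"
    and \<gamma>: "integral_curve_on A U (reeb_field A B f J \<zeta>) I \<gamma>"
  interpret n: hypersurface_normal A B f g J U \<zeta> by (rule normal_locale[OF U])
  have "\<forall>p\<in>U. \<forall>v. ext_deriv A n.reeb.dual p (reeb_field A B f J \<zeta> p) v = 0"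
    using assms U unfolding contact_form_closed_def n.dual_eq by blast
  then show "geodesic_on A h I \<gamma>"
    using n.reeb.integral_curves_geodesic_iff I \<gamma> by blast
qed

lemma closed_imp_integrable:
  assumes "contact_form_closed A B f g J"
  shows "integrable_distribution A (maximal_complex_subbundle A B f J)"
  unfolding integrable_distribution_def
proof
  fix p
  obtain U \<zeta> where U: "open U" "p \<in> U" "unit_normal_on A B f g U \<zeta>" using ex_unit_normal .
  interpret n: hypersurface_normal A B f g J U \<zeta> by (rule normal_locale[OF U(1,3)])
  have closed: "ext_deriv A n.reeb.dual q u v = 0" if "q \<in> U" for q u v
    using assms U that unfolding contact_form_closed_def n.dual_eq by blast
  obtain N where N: "p \<in> N" "N \<subseteq> U" "embedded_submanifold A (dim {u. n.reeb.dual p u = 0}) N"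
    "\<And>q. q \<in> N \<Longrightarrow> tangent_space_of A N q = {u. n.reeb.dual q u = 0}"
    using n.reeb.closed_dual_integral_manifold[OF closed U(2)] by blast
  have D: "maximal_complex_subbundle A B f J q = {u. n.reeb.dual q u = 0}" if "q \<in> U" for q
    unfolding n.dual_eq by (rule n.complex_subbundle_eq[OF that])
  show "\<exists>N. p \<in> N \<and> embedded_submanifold A (dim (maximal_complex_subbundle A B f J p)) N \<and>
      (\<forall>q\<in>N. tangent_space_of A N q = maximal_complex_subbundle A B f J q)"
    using N D U(2) by (intro exI[of _ N]) (metis subsetD)
qed

text \<open>Split both arguments of the exterior derivative into their components along \<open>\<xi>\<close> and in the kernel of \<open>\<eta>\<close>.\<close>

lemma hopf_integrable_imp_closed:
  assumes hopf: "hopf_hypersurface A B f g J"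
    and integrable: "integrable_distribution A (maximal_complex_subbundle A B f J)"
  shows "contact_form_closed A B f g J"
  unfolding contact_form_closed_def
proof (intro allI impI ballI)
  fix U \<zeta> p u v
  assume U: "open U" "unit_normal_on A B f g U \<zeta>" and p: "p \<in> U"
  interpret n: hypersurface_normal A B f g J U \<zeta> by (rule normal_locale[OF U])
  let ?\<xi> = "reeb_field A B f J \<zeta> p"
  let ?\<alpha> = "n.reeb.dual p"
  let ?d = "ext_deriv A n.reeb.dual p"
  have xi: "?d ?\<xi> w = 0" for w
    using n.reeb.integral_curves_geodesic_iff hopf U p unfolding hopf_hypersurface_def by blast
  obtain N where N: "p \<in> N" "embedded_submanifold A (dim (maximal_complex_subbundle A B f J p)) N"
    "\<forall>q\<in>N. tangent_space_of A N q = maximal_complex_subbundle A B f J q"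
    using spec[OF integrable[unfolded integrable_distribution_def], of p] by (elim exE conjE)
  have ker: "?d a b = 0" if "?\<alpha> a = 0" "?\<alpha> b = 0" for a b
    by (rule n.reeb.ext_deriv_vanishes_on_integral_manifold[OF N(2,1) p _ that])
       (simp add: N(3) n.complex_subbundle_eq n.dual_eq)
  note b = n.reeb.ext_deriv_bilinear[OF p]
  have xi': "?d w ?\<xi> = 0" for w
    using xi[of w] by (simp add: ext_deriv_def Let_def)
  have split: "?\<alpha> (w - ?\<alpha> w *\<^sub>R ?\<xi>) = 0" for w
    by (simp add: linear_diff[OF n.reeb.dual_linear] linear_cmul[OF n.reeb.dual_linear] n.reeb.dual_self[OF p])
  have "?d u v = ?d (u - ?\<alpha> u *\<^sub>R ?\<xi>) (v - ?\<alpha> v *\<^sub>R ?\<xi>)"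
    by (simp add: bilinear_lsub[OF b] bilinear_rsub[OF b] bilinear_lmul[OF b] bilinear_rmul[OF b] xi xi')
  also have "\<dots> = 0" by (rule ker[OF split split])
  finally show "ext_deriv A (contact_form A B f g J \<zeta>) p u v = 0" by (simp add: n.dual_eq)
qed

end

theorem proposition2p2:
  fixes A :: "('m::{t2_space,second_countable_topology}, 'a::euclidean_space) chart set"
    and B :: "('n::{t2_space,second_countable_topology}, 'b::euclidean_space) chart set"
    and f :: "'m \<Rightarrow> 'n"
    and g :: "'n \<Rightarrow> 'b \<Rightarrow> 'b \<Rightarrow> real"
    and J :: "'n \<Rightarrow> 'b \<Rightarrow> 'b"
  assumes "kaehler_manifold B g J"
    and "DIM('b) \<ge> 2 * 2"
    and "real_hypersurface A B f"
  shows "(contact_form_closed A B f g J \<longleftrightarrow> shape_anticommutes_structure A B f g J) \<and>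
         (shape_anticommutes_structure A B f g J \<longleftrightarrow>
            hopf_hypersurface A B f g J \<and>
            integrable_distribution A (maximal_complex_subbundle A B f J))"
proof -
  interpret kaehler_hypersurface A B f g J
    by unfold_locales (rule assms)+
  show ?thesis
    using closed_iff_anticommutes closed_imp_hopf closed_imp_integrable hopf_integrable_imp_closed by blast
qed

end
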